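(* Let $(\mathcal{C},\mathbb{E},\mathfrak{s})$ be an extriangulated category satisfying Condition (WIC), and let $\xi$ be a proper class of $\mathbb{E}$-triangles such that $\mathcal{C}$ has enough $\xi$-projectives and enough $\xi$-injectives. Let $A\xrightarrow{x}B\xrightarrow{y}C\overset{\delta}{\dashrightarrow}$ be a $\mathcal C(\mathcal{GP}(\xi),-)$-exact $\mathbb E$-triangle in $\xi$ with $A\in\mathbf{Res}(\mathcal{GP}(\xi))$ and $C\in\mathbf{Res}(\mathcal{GP}(\xi))$. Then for every object $X\in\mathcal C$ there are natural connecting homomorphisms $\partial^n_X:\xi\mathrm{xt}^n_{\mathcal{GP}(\xi)}(A,X)\to\xi\mathrm{xt}^{n+1}_{\mathcal{GP}(\xi)}(C,X)$, $n\geqslant0$, making the sequence $$0\to\xi\mathrm{xt}^0_{\mathcal{GP}(\xi)}(C,X)\to\xi\mathrm{xt}^0_{\mathcal{GP}(\xi)}(B,X)\to\xi\mathrm{xt}^0_{\mathcal{GP}(\xi)}(A,X)\xrightarrow{\partial^0_X}\xi\mathrm{xt}^1_{\mathcal{GP}(\xi)}(C,X)\to\cdots$$ exact.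
   Context: Extriangulated category: an additive category $\mathcal C$ with (ET1) a biadditive functor $\mathbb E:\mathcal C^{op}\times\mathcal C\to\mathbf{Ab}$ and a correspondence $\mathfrak s$ sending each $\delta\in\mathbb E(C,A)$ to a class $[A\xrightarrow{x}B\xrightarrow{y}C]$ of sequences modulo isomorphisms that are the identity on $A$ and $C$. Write $a_*\delta=\mathbb E(C,a)(\delta)$, $c^*\delta=\mathbb E(c,A)(\delta)$; a morphism from $\delta\in\mathbb E(C,A)$ to $\delta'\in\mathbb E(C',A')$ is a pair $(a:A\to A',c:C\to C')$ with $a_*\delta=c^*\delta'$. Axioms: (ET2) every morphism $(a,c)$ of extensions is realized by some $b$ making both squares between the realizing sequences commute, $\mathfrak s(0)=[A\to A\oplus C\to C]$, and $\mathfrak s(\delta\oplus\delta')=\mathfrak s(\delta)\oplus\mathfrak s(\delta')$; (ET3) if $\mathfrak s(\delta)=[A\xrightarrow{x}B\xrightarrow{y}C]$, $\mathfrak s(\delta')=[A'\xrightarrow{x'}B'\xrightarrow{y'}C']$ and $bx=x'a$, there is $c$ with $cy=y'b$ and $(a,c):\delta\to\delta'$ a morphism; (ET4) if $\delta\in\mathbb E(D,A)$, $\delta'\in\mathbb E(F,B)$ are realized by $A\xrightarrow{f}B\xrightarrow{f'}D$ and $B\xrightarrow{g}C\xrightarrow{g'}F$, there are an object $E$, $\delta''\in\mathbb E(E,A)$ realized by $A\xrightarrow{gf}C\xrightarrow{h'}E$, and $D\xrightarrow{d}E\xrightarrow{e}F$ realizing $f'_*\delta'$, with $h'g=df'$,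 $eh'=g'$, $d^*\delta''=\delta$, $f_*\delta''=e^*\delta'$; and the duals (ET3)$^{op}$, (ET4)$^{op}$. If $\mathfrak s(\delta)=[A\xrightarrow{x}B\xrightarrow{y}C]$, then $A\xrightarrow{x}B\xrightarrow{y}C\overset{\delta}{\dashrightarrow}$ is called an $\mathbb E$-triangle, $x$ an inflation, $y$ a deflation; it is split if $\delta=0$. Condition (WIC): for composable $f,g$, if $gf$ is an inflation so is $f$; if $gf$ is a deflation so is $g$. Proper class: a class $\xi$ of $\mathbb E$-triangles closed under isomorphisms such that (1) $\xi$ contains the split $\mathbb E$-triangles and is closed under finite coproducts; (2) if $A\to B\to C\overset{\delta}{\dashrightarrow}$ is in $\xi$, so is every $\mathbb E$-triangle realizing $c^*\delta$ or $a_*\delta$, for any $c:C'\to C$, $a:A\to A'$; (3) (saturated) for $\mathbb E$-triangles $A_i\xrightarrow{x_i}B_i\xrightarrow{y_i}C\overset{\delta_i}{\dashrightarrow}$, $i=1,2$, if the second one and the $\mathbb E$-triangle $A_1\to M\to B_2\overset{y_2^*\delta_1}{\dashrightarrow}$ are in $\xi$, then the first one is in $\xi$. $P$ is $\xi$-projective if $0\to\mathcal C(P,A)\to\mathcal C(P,B)\to\mathcal C(P,C)\to0$ is exact for every $\mathbb E$-triangle $A\to B\to C\dashrightarrow$ in $\xi$; $\xi$-injective is dual. $\mathcal P(\xi)$, $\mathcal I(\xi)$ denote the corresponding classes. Enough $\xi$-projectives: each $A$ admits an $\mathbb E$-triangle $K\to P\to A\dashrightarrow$ in $\xi$ with $P\in\mathcal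 P(\xi)$; enough $\xi$-injectives is dual. For a class $\mathcal W$, an $\mathbb E$-triangle $A\to B\to C\dashrightarrow$ in $\xi$ is $\mathcal C(\mathcal W,-)$-exact if $0\to\mathcal C(W,A)\to\mathcal C(W,B)\to\mathcal C(W,C)\to0$ is exact for all $W\in\mathcal W$, and $\mathcal C(-,\mathcal W)$-exact if $0\to\mathcal C(C,W)\to\mathcal C(B,W)\to\mathcal C(A,W)\to0$ is exact for all $W\in\mathcal W$. A complex $\cdots\to X_1\xrightarrow{d_1}X_0\xrightarrow{d_0}X_{-1}\to\cdots$ is $\xi$-exact if there are $\mathbb E$-triangles $K_{n+1}\xrightarrow{g_n}X_n\xrightarrow{f_n}K_n\dashrightarrow$ in $\xi$ (resolution $\mathbb E$-triangles) with $d_n=g_{n-1}f_n$ for all $n$. A complete $\xi$-projective resolution is a $\xi$-exact complex of $\xi$-projectives whose resolution $\mathbb E$-triangles are $\mathcal C(-,\mathcal P(\xi))$-exact; the objects $K_n$ occurring are called $\xi$-$\mathcal G$projective, forming $\mathcal{GP}(\xi)$. A proper $\xi$-$\mathcal G$projective resolution of $A$ is a $\xi$-exact complex $\cdots\to G_1\to G_0\to A\to0$ with all $G_i\in\mathcal{GP}(\xi)$ whose resolution $\mathbb E$-triangles $K_{i+1}\to G_i\to K_i\dashrightarrow$ ($K_0=A$) are $\mathcal C(\mathcal{GP}(\xi),-)$-exact; its deleted complex $\mathbf G^\sharp$ is $\cdots\to G_1\to G_0\to0$. $\mathbf{Res}(\mathcal{GP}(\xi))$ is the full subcategory of objects having a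 proper $\xi$-$\mathcal G$projective resolution. For $A\in\mathbf{Res}(\mathcal{GP}(\xi))$ and any $X$, $\xi\mathrm{xt}^n_{\mathcal{GP}(\xi)}(A,X):=H^n(\mathcal C(\mathbf G^\sharp,X))$, independent of the choice of resolution up to isomorphism. In the situation of the claim $B$ also lies in $\mathbf{Res}(\mathcal{GP}(\xi))$, so all terms are defined; the unnamed maps are those induced by $y$ and $x$. *)

theory Defs
  imports "HOL-Algebra.Exact_Sequence"
begin

section \<open>Additive categories\<close>

text \<open>
  Objects are the elements of the type \<open>'o\<close>.  The abelian groups \<open>Hom(A, B)\<close> and \<open>E(C, A)\<close> are
  commutative groups in the sense of HOL-Algebra, whose notation is multiplicative: for them
  \<open>\<otimes>\<close> is the sum and \<open>\<one>\<close> is the zero element.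
\<close>

record ('o, 'm) cat =
  Hom :: "'o \<Rightarrow> 'o \<Rightarrow> 'm monoid"
  Idn :: "'o \<Rightarrow> 'm"
  cmp :: "'m \<Rightarrow> 'm \<Rightarrow> 'm"  (infixl \<open>\<cdot>\<index>\<close> 70)

abbreviation Mor :: "('o, 'm, 'z) cat_scheme \<Rightarrow> 'o \<Rightarrow> 'o \<Rightarrow> 'm set"
  where "Mor \<C> A B \<equiv> carrier (Hom \<C> A B)"

abbreviation zero_mor :: "('o, 'm, 'z) cat_scheme \<Rightarrow> 'o \<Rightarrow> 'o \<Rightarrow> 'm"
  where "zero_mor \<C> A B \<equiv> \<one>\<^bsub>Hom \<C> A B\<^esub>"

definition iso_mor :: "('o, 'm, 'z) cat_scheme \<Rightarrow> 'o \<Rightarrow> 'o \<Rightarrow> 'm \<Rightarrow> bool"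
  where "iso_mor \<C> A B f \<longleftrightarrow>
    f \<in> Mor \<C> A B \<and> (\<exists>g \<in> Mor \<C> B A. g \<cdot>\<^bsub>\<C>\<^esub> f = Idn \<C> A \<and> f \<cdot>\<^bsub>\<C>\<^esub> g = Idn \<C> B)"

definition zero_object :: "('o, 'm, 'z) cat_scheme \<Rightarrow> 'o \<Rightarrow> bool"
  where "zero_object \<C> Z \<longleftrightarrow> (\<forall>A. (\<exists>!f. f \<in> Mor \<C> Z A) \<and> (\<exists>!f. f \<in> Mor \<C> A Z))"

record ('o, 'm) biprod_data =
  bobj :: 'o
  in1 :: 'm
  in2 :: 'm
  pr1 :: 'm
  pr2 :: 'm

definition is_biproduct ::
    "('o, 'm, 'z) cat_scheme \<Rightarrow> 'o \<Rightarrow> 'o \<Rightarrow> ('o, 'm) biprod_data \<Rightarrow> bool"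
  where "is_biproduct \<C> A B S \<longleftrightarrow>
    in1 S \<in> Mor \<C> A (bobj S) \<and> in2 S \<in> Mor \<C> B (bobj S) \<and>
    pr1 S \<in> Mor \<C> (bobj S) A \<and> pr2 S \<in> Mor \<C> (bobj S) B \<and>
    pr1 S \<cdot>\<^bsub>\<C>\<^esub> in1 S = Idn \<C> A \<and> pr2 S \<cdot>\<^bsub>\<C>\<^esub> in2 S = Idn \<C> B \<and>
    pr2 S \<cdot>\<^bsub>\<C>\<^esub> in1 S = zero_mor \<C> A B \<and> pr1 S \<cdot>\<^bsub>\<C>\<^esub> in2 S = zero_mor \<C> B A \<and>
    (in1 S \<cdot>\<^bsub>\<C>\<^esub> pr1 S) \<otimes>\<^bsub>Hom \<C> (bobj S) (bobj S)\<^esub> (in2 S \<cdot>\<^bsub>\<C>\<^esub> pr2 S) = Idn \<C> (bobj S)"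

text \<open>The morphism \<open>f \<oplus> f'\<close> from the biproduct \<open>S\<close> to the biproduct \<open>T\<close>.\<close>

definition mor_sum ::
    "('o, 'm, 'z) cat_scheme \<Rightarrow> ('o, 'm) biprod_data \<Rightarrow> ('o, 'm) biprod_data \<Rightarrow> 'm \<Rightarrow> 'm \<Rightarrow> 'm"
  where "mor_sum \<C> S T f f' =
    (in1 T \<cdot>\<^bsub>\<C>\<^esub> f \<cdot>\<^bsub>\<C>\<^esub> pr1 S) \<otimes>\<^bsub>Hom \<C> (bobj S) (bobj T)\<^esub> (in2 T \<cdot>\<^bsub>\<C>\<^esub> f' \<cdot>\<^bsub>\<C>\<^esub> pr2 S)"

text \<open>
  As usual, a morphism determines its source and its target (\<open>hom_disjoint\<close>), which is what allows
  composition to be written without mentioning objects.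
\<close>

locale additive_category =
  fixes \<C> :: "('o, 'm, 'z) cat_scheme" (structure)
  assumes hom_disjoint: "\<lbrakk>f \<in> Mor \<C> A B; f \<in> Mor \<C> A' B'\<rbrakk> \<Longrightarrow> A = A' \<and> B = B'"
    and idn_closed: "Idn \<C> A \<in> Mor \<C> A A"
    and cmp_closed: "\<lbrakk>f \<in> Mor \<C> A B; g \<in> Mor \<C> B C\<rbrakk> \<Longrightarrow> g \<cdot> f \<in> Mor \<C> A C"
    and cmp_assoc: "\<lbrakk>f \<in> Mor \<C> A B; g \<in> Mor \<C> B C; h \<in> Mor \<C> C D\<rbrakk> \<Longrightarrow> (h \<cdot> g) \<cdot> f = h \<cdot> (g \<cdot> f)"
    and idn_left: "f \<in> Mor \<C> A B \<Longrightarrow> Idn \<C> B \<cdot> f = f"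
    and idn_right: "f \<in> Mor \<C> A B \<Longrightarrow> f \<cdot> Idn \<C> A = f"
    and hom_group: "comm_group (Hom \<C> A B)"
    and cmp_add_left: "\<lbrakk>f \<in> Mor \<C> A B; g \<in> Mor \<C> B C; g' \<in> Mor \<C> B C\<rbrakk>
      \<Longrightarrow> (g \<otimes>\<^bsub>Hom \<C> B C\<^esub> g') \<cdot> f = (g \<cdot> f) \<otimes>\<^bsub>Hom \<C> A C\<^esub> (g' \<cdot> f)"
    and cmp_add_right: "\<lbrakk>f \<in> Mor \<C> A B; f' \<in> Mor \<C> A B; g \<in> Mor \<C> B C\<rbrakk>
      \<Longrightarrow> g \<cdot> (f \<otimes>\<^bsub>Hom \<C> A B\<^esub> f') = (g \<cdot> f) \<otimes>\<^bsub>Hom \<C> A C\<^esub> (g \<cdot> f')"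
    and has_zero_object: "\<exists>Z. zero_object \<C> Z"
    and has_biproducts: "\<exists>S. is_biproduct \<C> A B S"


section \<open>Extriangulated categories\<close>

text \<open>
  \<open>Ext \<C> C A\<close> is the group \<open>E(C, A)\<close>, \<open>ext_map \<C> c a\<close> the homomorphism \<open>E(c, a)\<close>, and
  \<open>realz \<C> C A \<delta>\<close> the class \<open>s(\<delta>)\<close> of sequences \<open>A \<rightarrow> B \<rightarrow> C\<close>, each given by its two morphisms.
\<close>

record ('o, 'm, 'e) extri_cat = "('o, 'm) cat" +
  Ext :: "'o \<Rightarrow> 'o \<Rightarrow> 'e monoid"
  ext_map :: "'m \<Rightarrow> 'm \<Rightarrow> 'e \<Rightarrow> 'e"
  realz :: "'o \<Rightarrow> 'o \<Rightarrow> 'e \<Rightarrow> ('m \<times> 'm) set"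

text \<open>\<open>a\<^sub>*\<delta>\<close> for \<open>\<delta> \<in> E(C, A)\<close>, and \<open>c\<^sup>*\<delta>\<close> for \<open>\<delta> \<in> E(C, A)\<close>.\<close>

abbreviation push :: "('o, 'm, 'e, 'z) extri_cat_scheme \<Rightarrow> 'o \<Rightarrow> 'm \<Rightarrow> 'e \<Rightarrow> 'e"
  where "push \<C> C a \<delta> \<equiv> ext_map \<C> (Idn \<C> C) a \<delta>"

abbreviation pull :: "('o, 'm, 'e, 'z) extri_cat_scheme \<Rightarrow> 'o \<Rightarrow> 'm \<Rightarrow> 'e \<Rightarrow> 'e"
  where "pull \<C> A c \<delta> \<equiv> ext_map \<C> c (Idn \<C> A) \<delta>"

definition seqs :: "('o, 'm, 'z) cat_scheme \<Rightarrow> 'o \<Rightarrow> 'o \<Rightarrow> ('m \<times> 'm) set"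
  where "seqs \<C> A C = {(x, y). \<exists>B. x \<in> Mor \<C> A B \<and> y \<in> Mor \<C> B C}"

definition seq_equiv ::
    "('o, 'm, 'z) cat_scheme \<Rightarrow> 'o \<Rightarrow> 'o \<Rightarrow> (('m \<times> 'm) \<times> ('m \<times> 'm)) set"
  where "seq_equiv \<C> A C = {((x, y), (x', y')). \<exists>B B' b.
    x \<in> Mor \<C> A B \<and> y \<in> Mor \<C> B C \<and> x' \<in> Mor \<C> A B' \<and> y' \<in> Mor \<C> B' C \<and>
    iso_mor \<C> B B' b \<and> b \<cdot>\<^bsub>\<C>\<^esub> x = x' \<and> y' \<cdot>\<^bsub>\<C>\<^esub> b = y}"

definition etri ::
    "('o, 'm, 'e, 'z) extri_cat_scheme \<Rightarrow> 'o \<Rightarrow> 'm \<Rightarrow> 'o \<Rightarrow> 'm \<Rightarrow> 'o \<Rightarrow> 'e \<Rightarrow> bool"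
  where "etri \<C> A x B y C \<delta> \<longleftrightarrow>
    \<delta> \<in> carrier (Ext \<C> C A) \<and> x \<in> Mor \<C> A B \<and> y \<in> Mor \<C> B C \<and> (x, y) \<in> realz \<C> C A \<delta>"

definition ext_morphism ::
    "('o, 'm, 'e, 'z) extri_cat_scheme \<Rightarrow> 'o \<Rightarrow> 'o \<Rightarrow> 'e \<Rightarrow> 'o \<Rightarrow> 'o \<Rightarrow> 'e \<Rightarrow> 'm \<Rightarrow> 'm \<Rightarrow> bool"
  where "ext_morphism \<C> A C \<delta> A' C' \<delta>' a c \<longleftrightarrow>
    a \<in> Mor \<C> A A' \<and> c \<in> Mor \<C> C C' \<and> push \<C> C a \<delta> = pull \<C> A' c \<delta>'"

text \<open>
  \<open>\<delta> \<oplus> \<delta>'\<close>: the element of \<open>E(C \<oplus> C', A \<oplus> A')\<close> with components \<open>(\<delta>, 0, 0, \<delta>')\<close>, where \<open>S\<close> is the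
  biproduct of \<open>C, C'\<close> and \<open>T\<close> that of \<open>A, A'\<close>.
\<close>

definition ext_sum ::
    "('o, 'm, 'e, 'z) extri_cat_scheme \<Rightarrow> ('o, 'm) biprod_data \<Rightarrow> ('o, 'm) biprod_data
      \<Rightarrow> 'e \<Rightarrow> 'e \<Rightarrow> 'e"
  where "ext_sum \<C> S T \<delta> \<delta>' =
    ext_map \<C> (pr1 S) (in1 T) \<delta> \<otimes>\<^bsub>Ext \<C> (bobj S) (bobj T)\<^esub> ext_map \<C> (pr2 S) (in2 T) \<delta>'"

locale extriangulated_category = additive_category \<C>
  for \<C> :: "('o, 'm, 'e, 'z) extri_cat_scheme" (structure) +
  \<comment> \<open>(ET1)\<close>
  assumes ext_group: "comm_group (Ext \<C> C A)"
    and ext_map_hom: "\<lbrakk>c \<in> Mor \<C> C' C; a \<in> Mor \<C> A A'\<rbrakk>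
      \<Longrightarrow> ext_map \<C> c a \<in> hom (Ext \<C> C A) (Ext \<C> C' A')"
    and ext_map_idn: "\<delta> \<in> carrier (Ext \<C> C A) \<Longrightarrow> ext_map \<C> (Idn \<C> C) (Idn \<C> A) \<delta> = \<delta>"
    and ext_map_cmp: "\<lbrakk>c \<in> Mor \<C> C' C; c' \<in> Mor \<C> C'' C'; a \<in> Mor \<C> A A'; a' \<in> Mor \<C> A' A'';
        \<delta> \<in> carrier (Ext \<C> C A)\<rbrakk>
      \<Longrightarrow> ext_map \<C> (c \<cdot> c') (a' \<cdot> a) \<delta> = ext_map \<C> c' a' (ext_map \<C> c a \<delta>)"
    and ext_map_add_left: "\<lbrakk>c \<in> Mor \<C> C' C; d \<in> Mor \<C> C' C; a \<in> Mor \<C> A A';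
        \<delta> \<in> carrier (Ext \<C> C A)\<rbrakk>
      \<Longrightarrow> ext_map \<C> (c \<otimes>\<^bsub>Hom \<C> C' C\<^esub> d) a \<delta> = ext_map \<C> c a \<delta> \<otimes>\<^bsub>Ext \<C> C' A'\<^esub> ext_map \<C> d a \<delta>"
    and ext_map_add_right: "\<lbrakk>c \<in> Mor \<C> C' C; a \<in> Mor \<C> A A'; b \<in> Mor \<C> A A';
        \<delta> \<in> carrier (Ext \<C> C A)\<rbrakk>
      \<Longrightarrow> ext_map \<C> c (a \<otimes>\<^bsub>Hom \<C> A A'\<^esub> b) \<delta> = ext_map \<C> c a \<delta> \<otimes>\<^bsub>Ext \<C> C' A'\<^esub> ext_map \<C> c b \<delta>"
    and realz_class: "\<delta> \<in> carrier (Ext \<C> C A) \<Longrightarrow> realz \<C> C A \<delta> \<in> seqs \<C> A C // seq_equiv \<C> A C"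
  \<comment> \<open>(ET2)\<close>
    and realz_morphism: "\<lbrakk>etri \<C> A x B y C \<delta>; etri \<C> A' x' B' y' C' \<delta>';
        ext_morphism \<C> A C \<delta> A' C' \<delta>' a c\<rbrakk>
      \<Longrightarrow> \<exists>b \<in> Mor \<C> B B'. b \<cdot> x = x' \<cdot> a \<and> y' \<cdot> b = c \<cdot> y"
    and realz_zero: "is_biproduct \<C> A C S
      \<Longrightarrow> etri \<C> A (in1 S) (bobj S) (pr2 S) C \<one>\<^bsub>Ext \<C> C A\<^esub>"
    and realz_sum: "\<lbrakk>etri \<C> A x B y C \<delta>; etri \<C> A' x' B' y' C' \<delta>';
        is_biproduct \<C> A A' SA; is_biproduct \<C> B B' SB; is_biproduct \<C> C C' SC\<rbrakk>
      \<Longrightarrow> etri \<C> (bobj SA) (mor_sum \<C> SA SB x x') (bobj SB) (mor_sum \<C> SB SC y y') (bobj SC)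
            (ext_sum \<C> SC SA \<delta> \<delta>')"
  \<comment> \<open>(ET3) and its dual\<close>
    and ET3: "\<lbrakk>etri \<C> A x B y C \<delta>; etri \<C> A' x' B' y' C' \<delta>';
        a \<in> Mor \<C> A A'; b \<in> Mor \<C> B B'; b \<cdot> x = x' \<cdot> a\<rbrakk>
      \<Longrightarrow> \<exists>c. c \<cdot> y = y' \<cdot> b \<and> ext_morphism \<C> A C \<delta> A' C' \<delta>' a c"
    and ET3_op: "\<lbrakk>etri \<C> A x B y C \<delta>; etri \<C> A' x' B' y' C' \<delta>';
        b \<in> Mor \<C> B B'; c \<in> Mor \<C> C C'; c \<cdot> y = y' \<cdot> b\<rbrakk>
      \<Longrightarrow> \<exists>a. b \<cdot> x = x' \<cdot> a \<and> ext_morphism \<C> A C \<delta> A' C' \<delta>' a c"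
  \<comment> \<open>(ET4) and its dual; the dual is obtained by reversing all arrows and swapping the
      arguments of \<open>E\<close>, keeping the names\<close>
    and ET4: "\<lbrakk>etri \<C> A f B f' D \<delta>; etri \<C> B g C g' F \<delta>'\<rbrakk>
      \<Longrightarrow> \<exists>E h' d e \<delta>''. etri \<C> A (g \<cdot> f) C h' E \<delta>'' \<and> etri \<C> D d E e F (push \<C> F f' \<delta>') \<and>
            h' \<cdot> g = d \<cdot> f' \<and> e \<cdot> h' = g' \<and>
            pull \<C> A d \<delta>'' = \<delta> \<and> push \<C> E f \<delta>'' = pull \<C> B e \<delta>'"
    and ET4_op: "\<lbrakk>etri \<C> D f' B f A \<delta>; etri \<C> F g' C g B \<delta>'\<rbrakk>
      \<Longrightarrow> \<exists>E h' d e \<delta>''. etri \<C> E h' C (f \<cdot> g) A \<delta>'' \<and> etri \<C> F e E d D (pull \<C> F f' \<delta>') \<and>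
            g \<cdot> h' = f' \<cdot> d \<and> h' \<cdot> e = g' \<and>
            push \<C> A d \<delta>'' = \<delta> \<and> pull \<C> E f \<delta>'' = push \<C> B e \<delta>'"

definition inflation :: "('o, 'm, 'e, 'z) extri_cat_scheme \<Rightarrow> 'm \<Rightarrow> bool"
  where "inflation \<C> x \<longleftrightarrow> (\<exists>A B y C \<delta>. etri \<C> A x B y C \<delta>)"

definition deflation :: "('o, 'm, 'e, 'z) extri_cat_scheme \<Rightarrow> 'm \<Rightarrow> bool"
  where "deflation \<C> y \<longleftrightarrow> (\<exists>A x B C \<delta>. etri \<C> A x B y C \<delta>)"

definition WIC :: "('o, 'm, 'e, 'z) extri_cat_scheme \<Rightarrow> bool"
  where "WIC \<C> \<longleftrightarrow> (\<forall>A B C. \<forall>f \<in> Mor \<C> A B. \<forall>g \<in> Mor \<C> B C.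
    (inflation \<C> (g \<cdot>\<^bsub>\<C>\<^esub> f) \<longrightarrow> inflation \<C> f) \<and> (deflation \<C> (g \<cdot>\<^bsub>\<C>\<^esub> f) \<longrightarrow> deflation \<C> g))"


section \<open>Proper classes\<close>

text \<open>A class of triangles \<open>A \<rightarrow> B \<rightarrow> C\<close> with extension \<open>\<delta>\<close> is a predicate on \<open>A, x, B, y, C, \<delta>\<close>.\<close>

type_synonym ('o, 'm, 'e) tri_class = "'o \<Rightarrow> 'm \<Rightarrow> 'o \<Rightarrow> 'm \<Rightarrow> 'o \<Rightarrow> 'e \<Rightarrow> bool"

locale proper_class = extriangulated_category \<C>
  for \<C> :: "('o, 'm, 'e, 'z) extri_cat_scheme" (structure) +
  fixes \<xi> :: "('o, 'm, 'e) tri_class"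
  assumes xi_etri: "\<xi> A x B y C \<delta> \<Longrightarrow> etri \<C> A x B y C \<delta>"
    and xi_iso: "\<lbrakk>\<xi> A x B y C \<delta>; etri \<C> A' x' B' y' C' \<delta>';
        iso_mor \<C> A A' a; iso_mor \<C> B B' b; iso_mor \<C> C C' c;
        b \<cdot> x = x' \<cdot> a; c \<cdot> y = y' \<cdot> b; ext_morphism \<C> A C \<delta> A' C' \<delta>' a c\<rbrakk>
      \<Longrightarrow> \<xi> A' x' B' y' C' \<delta>'"
    and xi_split: "etri \<C> A x B y C \<one>\<^bsub>Ext \<C> C A\<^esub> \<Longrightarrow> \<xi> A x B y C \<one>\<^bsub>Ext \<C> C A\<^esub>"
    and xi_sum: "\<lbrakk>\<xi> A x B y C \<delta>; \<xi> A' x' B' y' C' \<delta>';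
        is_biproduct \<C> A A' SA; is_biproduct \<C> B B' SB; is_biproduct \<C> C C' SC\<rbrakk>
      \<Longrightarrow> \<xi> (bobj SA) (mor_sum \<C> SA SB x x') (bobj SB) (mor_sum \<C> SB SC y y') (bobj SC)
            (ext_sum \<C> SC SA \<delta> \<delta>')"
    and xi_base_change: "\<lbrakk>\<xi> A x B y C \<delta>; c \<in> Mor \<C> C' C; etri \<C> A x' B' y' C' (pull \<C> A c \<delta>)\<rbrakk>
      \<Longrightarrow> \<xi> A x' B' y' C' (pull \<C> A c \<delta>)"
    and xi_cobase_change: "\<lbrakk>\<xi> A x B y C \<delta>; a \<in> Mor \<C> A A'; etri \<C> A' x' B' y' C (push \<C> C a \<delta>)\<rbrakk>
      \<Longrightarrow> \<xi> A' x' B' y' C (push \<C> C a \<delta>)"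
    and xi_saturated: "\<lbrakk>etri \<C> A1 x1 B1 y1 C \<delta>1; \<xi> A2 x2 B2 y2 C \<delta>2;
        \<xi> A1 m M m' B2 (pull \<C> A1 y2 \<delta>1)\<rbrakk>
      \<Longrightarrow> \<xi> A1 x1 B1 y1 C \<delta>1"

text \<open>
  Exactness of \<open>0 \<rightarrow> C(W, A) \<rightarrow> C(W, B) \<rightarrow> C(W, C) \<rightarrow> 0\<close> and of
  \<open>0 \<rightarrow> C(C, W) \<rightarrow> C(B, W) \<rightarrow> C(A, W) \<rightarrow> 0\<close>; \<^const>\<open>short_exact_sequence\<close> lists groups and maps from
  right to left.
\<close>

definition hom_exact_from ::
    "('o, 'm, 'z) cat_scheme \<Rightarrow> 'o \<Rightarrow> 'o \<Rightarrow> 'm \<Rightarrow> 'o \<Rightarrow> 'm \<Rightarrow> 'o \<Rightarrow> bool"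
  where "hom_exact_from \<C> W A x B y C \<longleftrightarrow>
    short_exact_sequence (Hom \<C> W C) (Hom \<C> W B) (Hom \<C> W A) (\<lambda>\<phi>. y \<cdot>\<^bsub>\<C>\<^esub> \<phi>) (\<lambda>\<phi>. x \<cdot>\<^bsub>\<C>\<^esub> \<phi>)"

definition hom_exact_into ::
    "('o, 'm, 'z) cat_scheme \<Rightarrow> 'o \<Rightarrow> 'o \<Rightarrow> 'm \<Rightarrow> 'o \<Rightarrow> 'm \<Rightarrow> 'o \<Rightarrow> bool"
  where "hom_exact_into \<C> W A x B y C \<longleftrightarrow>
    short_exact_sequence (Hom \<C> A W) (Hom \<C> B W) (Hom \<C> C W) (\<lambda>\<phi>. \<phi> \<cdot>\<^bsub>\<C>\<^esub> x) (\<lambda>\<phi>. \<phi> \<cdot>\<^bsub>\<C>\<^esub> y)"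

definition xi_projectives ::
    "('o, 'm, 'z) cat_scheme \<Rightarrow> ('o, 'm, 'e) tri_class \<Rightarrow> 'o set"
  where "xi_projectives \<C> \<xi> = {P. \<forall>A x B y C \<delta>. \<xi> A x B y C \<delta> \<longrightarrow> hom_exact_from \<C> P A x B y C}"

definition xi_injectives ::
    "('o, 'm, 'z) cat_scheme \<Rightarrow> ('o, 'm, 'e) tri_class \<Rightarrow> 'o set"
  where "xi_injectives \<C> \<xi> = {I. \<forall>A x B y C \<delta>. \<xi> A x B y C \<delta> \<longrightarrow> hom_exact_into \<C> I A x B y C}"

definition enough_xi_projectives ::
    "('o, 'm, 'z) cat_scheme \<Rightarrow> ('o, 'm, 'e) tri_class \<Rightarrow> bool"
  where "enough_xi_projectives \<C> \<xi> \<longleftrightarrow>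
    (\<forall>A. \<exists>K k P p \<delta>. \<xi> K k P p A \<delta> \<and> P \<in> xi_projectives \<C> \<xi>)"

definition enough_xi_injectives ::
    "('o, 'm, 'z) cat_scheme \<Rightarrow> ('o, 'm, 'e) tri_class \<Rightarrow> bool"
  where "enough_xi_injectives \<C> \<xi> \<longleftrightarrow>
    (\<forall>A. \<exists>i I p K \<delta>. \<xi> A i I p K \<delta> \<and> I \<in> xi_injectives \<C> \<xi>)"


section \<open>Gorenstein projectives and proper resolutions\<close>

text \<open>
  \<open>X, d\<close> with \<open>d n : X n \<rightarrow> X (n - 1)\<close> is \<open>\<xi>\<close>-exact with resolution triangles
  \<open>K (n + 1) \<rightarrow> X n \<rightarrow> K n\<close>; that \<open>d\<close> squares to zero is automatic.
\<close>

definition xi_exact_complex ::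
    "('o, 'm, 'z) cat_scheme \<Rightarrow> ('o, 'm, 'e) tri_class \<Rightarrow> (int \<Rightarrow> 'o) \<Rightarrow> (int \<Rightarrow> 'm)
      \<Rightarrow> (int \<Rightarrow> 'o) \<Rightarrow> (int \<Rightarrow> 'm) \<Rightarrow> (int \<Rightarrow> 'm) \<Rightarrow> (int \<Rightarrow> 'e) \<Rightarrow> bool"
  where "xi_exact_complex \<C> \<xi> X d K g f \<delta> \<longleftrightarrow>
    (\<forall>n. \<xi> (K (n + 1)) (g n) (X n) (f n) (K n) (\<delta> n) \<and> d n = g (n - 1) \<cdot>\<^bsub>\<C>\<^esub> f n)"

definition complete_xi_projective_resolution ::
    "('o, 'm, 'z) cat_scheme \<Rightarrow> ('o, 'm, 'e) tri_class \<Rightarrow> (int \<Rightarrow> 'o) \<Rightarrow> (int \<Rightarrow> 'm)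
      \<Rightarrow> (int \<Rightarrow> 'o) \<Rightarrow> (int \<Rightarrow> 'm) \<Rightarrow> (int \<Rightarrow> 'm) \<Rightarrow> (int \<Rightarrow> 'e) \<Rightarrow> bool"
  where "complete_xi_projective_resolution \<C> \<xi> X d K g f \<delta> \<longleftrightarrow>
    xi_exact_complex \<C> \<xi> X d K g f \<delta> \<and>
    (\<forall>n. X n \<in> xi_projectives \<C> \<xi>) \<and>
    (\<forall>n. \<forall>W \<in> xi_projectives \<C> \<xi>. hom_exact_into \<C> W (K (n + 1)) (g n) (X n) (f n) (K n))"

definition GProj :: "('o, 'm, 'z) cat_scheme \<Rightarrow> ('o, 'm, 'e) tri_class \<Rightarrow> 'o set"
  where "GProj \<C> \<xi> =
    {G. \<exists>X d K g f \<delta> n. complete_xi_projective_resolution \<C> \<xi> X d K g f \<delta> \<and> G = K n}"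

text \<open>
  The underlying complex \<open>\<cdots> \<rightarrow> G 1 \<rightarrow> G 0 \<rightarrow> A \<rightarrow> 0\<close> of a resolution: \<open>rdif 0 : G 0 \<rightarrow> A\<close> is the
  augmentation and \<open>rdif (n + 1) : G (n + 1) \<rightarrow> G n\<close>.
\<close>

record ('o, 'm) resolution =
  robj :: "nat \<Rightarrow> 'o"
  rdif :: "nat \<Rightarrow> 'm"

definition proper_GProj_resolution ::
    "('o, 'm, 'z) cat_scheme \<Rightarrow> ('o, 'm, 'e) tri_class \<Rightarrow> 'o \<Rightarrow> ('o, 'm) resolution \<Rightarrow> bool"
  where "proper_GProj_resolution \<C> \<xi> A R \<longleftrightarrow>
    (\<forall>n. robj R n \<in> GProj \<C> \<xi>) \<and>
    (\<exists>K g f \<delta>. K 0 = A \<and>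
      (\<forall>n. \<xi> (K (Suc n)) (g n) (robj R n) (f n) (K n) (\<delta> n) \<and>
        (\<forall>W \<in> GProj \<C> \<xi>. hom_exact_from \<C> W (K (Suc n)) (g n) (robj R n) (f n) (K n))) \<and>
      rdif R 0 = f 0 \<and> (\<forall>n. rdif R (Suc n) = g n \<cdot>\<^bsub>\<C>\<^esub> f (Suc n)))"

definition Res :: "('o, 'm, 'z) cat_scheme \<Rightarrow> ('o, 'm, 'e) tri_class \<Rightarrow> 'o set"
  where "Res \<C> \<xi> = {A. \<exists>R. proper_GProj_resolution \<C> \<xi> A R}"


section \<open>The derived functors\<close>

text \<open>
  Cocycles and coboundaries of the complex \<open>0 \<rightarrow> C(G 0, X) \<rightarrow> C(G 1, X) \<rightarrow> \<cdots>\<close>, which does not involve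
  the augmentation.
\<close>

definition cocycles :: "('o, 'm, 'z) cat_scheme \<Rightarrow> ('o, 'm) resolution \<Rightarrow> nat \<Rightarrow> 'o \<Rightarrow> 'm set"
  where "cocycles \<C> R n X =
    kernel (Hom \<C> (robj R n) X) (Hom \<C> (robj R (Suc n)) X) (\<lambda>\<phi>. \<phi> \<cdot>\<^bsub>\<C>\<^esub> rdif R (Suc n))"

definition coboundaries :: "('o, 'm, 'z) cat_scheme \<Rightarrow> ('o, 'm) resolution \<Rightarrow> nat \<Rightarrow> 'o \<Rightarrow> 'm set"
  where "coboundaries \<C> R n X =
    (case n of 0 \<Rightarrow> {zero_mor \<C> (robj R 0) X}
      | Suc m \<Rightarrow> (\<lambda>\<phi>. \<phi> \<cdot>\<^bsub>\<C>\<^esub> rdif R (Suc m)) ` Mor \<C> (robj R m) X)"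

definition coh_class :: "('o, 'm, 'z) cat_scheme \<Rightarrow> ('o, 'm) resolution \<Rightarrow> nat \<Rightarrow> 'o \<Rightarrow> 'm \<Rightarrow> 'm set"
  where "coh_class \<C> R n X \<phi> = coboundaries \<C> R n X #>\<^bsub>Hom \<C> (robj R n) X\<^esub> \<phi>"

text \<open>
  In what follows \<open>R\<close> assigns to each object of \<^const>\<open>Res\<close> a chosen proper resolution; \<open>xt \<C> R n A X\<close> is
  \<open>\<xi>xt\<^sup>n(A, X)\<close> computed with \<open>R A\<close>.
\<close>

definition xt ::
    "('o, 'm, 'z) cat_scheme \<Rightarrow> ('o \<Rightarrow> ('o, 'm) resolution) \<Rightarrow> nat \<Rightarrow> 'o \<Rightarrow> 'o \<Rightarrow> 'm set monoid"
  where "xt \<C> R n A X =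
    (Hom \<C> (robj (R A) n) X)\<lparr>carrier := cocycles \<C> (R A) n X\<rparr> Mod coboundaries \<C> (R A) n X"

definition lifts ::
    "('o, 'm, 'z) cat_scheme \<Rightarrow> ('o, 'm) resolution \<Rightarrow> ('o, 'm) resolution \<Rightarrow> 'm \<Rightarrow> (nat \<Rightarrow> 'm) \<Rightarrow> bool"
  where "lifts \<C> R S f F \<longleftrightarrow>
    (\<forall>n. F n \<in> Mor \<C> (robj R n) (robj S n)) \<and>
    rdif S 0 \<cdot>\<^bsub>\<C>\<^esub> F 0 = f \<cdot>\<^bsub>\<C>\<^esub> rdif R 0 \<and>
    (\<forall>n. rdif S (Suc n) \<cdot>\<^bsub>\<C>\<^esub> F (Suc n) = F n \<cdot>\<^bsub>\<C>\<^esub> rdif R (Suc n))"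

text \<open>
  The map \<open>\<xi>xt\<^sup>n(B, X) \<rightarrow> \<xi>xt\<^sup>n(A, X)\<close> induced by \<open>f : A \<rightarrow> B\<close>: it sends the class of \<open>\<phi>\<close> to the class of
  \<open>\<phi> \<cdot> F n\<close>, for any lift \<open>F\<close> of \<open>f\<close> to the resolutions and any representative \<open>\<phi>\<close>.
\<close>

definition xt_contra ::
    "('o, 'm, 'z) cat_scheme \<Rightarrow> ('o \<Rightarrow> ('o, 'm) resolution) \<Rightarrow> nat \<Rightarrow> 'o \<Rightarrow> 'o \<Rightarrow> 'm \<Rightarrow> 'o
      \<Rightarrow> 'm set \<Rightarrow> 'm set"
  where "xt_contra \<C> R n A B f X c =
    (THE c'. \<exists>F \<phi>. lifts \<C> (R A) (R B) f F \<and> \<phi> \<in> c \<and> c' = coh_class \<C> (R A) n X (\<phi> \<cdot>\<^bsub>\<C>\<^esub> F n))"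

text \<open>The map \<open>\<xi>xt\<^sup>n(A, X) \<rightarrow> \<xi>xt\<^sup>n(A, X')\<close> induced by \<open>u : X \<rightarrow> X'\<close>.\<close>

definition xt_co ::
    "('o, 'm, 'z) cat_scheme \<Rightarrow> ('o \<Rightarrow> ('o, 'm) resolution) \<Rightarrow> nat \<Rightarrow> 'o \<Rightarrow> 'm \<Rightarrow> 'o
      \<Rightarrow> 'm set \<Rightarrow> 'm set"
  where "xt_co \<C> R n A u X' c =
    (THE c'. \<exists>\<phi> \<in> c. c' = coh_class \<C> (R A) n X' (u \<cdot>\<^bsub>\<C>\<^esub> \<phi>))"

end

theory Submission
  imports Defs
begin

text \<open>
  The horseshoe lemma produces a proper resolution \<open>S\<close> of \<open>B\<close> which in each degree is the biproduct of
  the chosen resolutions of \<open>A\<close> and \<open>C\<close>, compatibly with \<open>x\<close> and \<open>y\<close>.  In each step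
  the resolution triangle lies in \<open>\<xi>\<close> by saturation, and the first term of that triangle is the middle
  term of a triangle in \<open>\<xi>\<close> between the next syzygies of \<open>A\<close> and \<open>C\<close>, which is again exact under
  \<open>Hom(W, -)\<close> for Gorenstein projective \<open>W\<close>; so the construction can be iterated.  Although
  inflations are not monic, proper resolutions are exact under these functors, and so lifts to them
  exist and are unique up to homotopy; hence \<open>S\<close> may replace the chosen resolution of \<open>B\<close>.  As the
  sequence of complexes is degreewise split, the connecting homomorphism is composition with the
  off-diagonal entry of the differential of \<open>S\<close>, and naturality in \<open>X\<close> is associativity.
\<close>

section \<open>Morphism calculus\<close>

text \<open>In general there are neither kernels nor pullbacks here, and the fillers supplied by
  (ET2) and (ET3) are not unique. So every object of the horseshoe is obtained by realizing an
  extension and applying (ET4) or its dual; what comes out is then identified with the intended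
  object through the uniqueness of realizations up to isomorphism. Exactness in the middle of Hom
  holds for every triangle, but injectivity at the inflation has to be carried along from one syzygy
  to the next. It is what allows a cycle of a spliced complex to be traced back to a syzygy, and
  hence what makes lifts exist. The direct sum of two Gorenstein projectives is shown to be
  Gorenstein projective only for a suitable choice of the biproduct, so the horseshoe is built on
  biproducts chosen in that way. Comparison of lifts and the long exact sequence need no triangles:
  they are stated over an additive category, for complexes that become exact under Hom from the test
  objects.\<close>

context additive_category
begin

definition src :: "'m \<Rightarrow> 'o" where "src f = (THE A. \<exists>B. f \<in> Mor \<C> A B)"
definition tgt :: "'m \<Rightarrow> 'o" where "tgt f = (THE B. \<exists>A. f \<in> Mor \<C> A B)"
definition arr :: "'m \<Rightarrow> bool" where "arr f \<longleftrightarrow> f \<in> Mor \<C> (src f) (tgt f)"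

text \<open>
  Sum and negative with the hom group read off from the first argument: outside hom groups they are
  junk, but no objects have to be written, and the group laws become conditional rewrite rules whose
  side conditions the simplifier can discharge.
\<close>

definition madd :: "'m \<Rightarrow> 'm \<Rightarrow> 'm" (infixl \<open>\<boxplus>\<close> 65)
  where "f \<boxplus> g = f \<otimes>\<^bsub>Hom \<C> (src f) (tgt f)\<^esub> g"
definition mneg :: "'m \<Rightarrow> 'm" (\<open>\<boxminus> _\<close> [80] 80)
  where "\<boxminus> f = inv\<^bsub>Hom \<C> (src f) (tgt f)\<^esub> f"

text \<open>Replaces membership in a hom group by equations on \<open>src\<close> and
  \<open>tgt\<close>. These can be computed for composites and sums by rewriting, whereas a closure
  rule for \<open>Mor\<close> would have to guess the object in the middle.\<close>

lemma mor_iff: "f \<in> Mor \<C> A B \<longleftrightarrow> arr f \<and> src f = A \<and> tgt f = B"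
proof
  assume f: "f \<in> Mor \<C> A B"
  have "src f = A" unfolding src_def using f hom_disjoint by blast
  moreover have "tgt f = B" unfolding tgt_def using f hom_disjoint by blast
  ultimately show "arr f \<and> src f = A \<and> tgt f = B" using f by (simp add: arr_def)
qed (auto simp: arr_def)

lemma idn_arr: "arr (Idn \<C> A)" "src (Idn \<C> A) = A" "tgt (Idn \<C> A) = A"
  using idn_closed[of A] by (simp_all add: mor_iff)

lemma cmp_arr:
  assumes "arr f" "arr g" "tgt f = src g"
  shows "arr (g \<cdot> f)" "src (g \<cdot> f) = src f" "tgt (g \<cdot> f) = tgt g"
  using cmp_closed[of f "src f" "tgt f" g "tgt g"] assms by (simp_all add: mor_iff)

lemma cmp_assoc': "\<lbrakk>arr f; arr g; arr h; tgt f = src g; tgt g = src h\<rbrakk> \<Longrightarrow> (h \<cdot> g) \<cdot> f = h \<cdot> (g \<cdot> f)"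
  by (rule cmp_assoc) (auto simp: mor_iff)

lemma idn_cmp: "\<lbrakk>arr f; tgt f = B\<rbrakk> \<Longrightarrow> Idn \<C> B \<cdot> f = f" "\<lbrakk>arr f; src f = A\<rbrakk> \<Longrightarrow> f \<cdot> Idn \<C> A = f"
  using idn_left idn_right by (auto simp: mor_iff)

lemma zero_arr: "arr (zero_mor \<C> A B)" "src (zero_mor \<C> A B) = A" "tgt (zero_mor \<C> A B) = B"
proof -
  interpret comm_group "Hom \<C> A B" by (rule hom_group)
  show "arr (zero_mor \<C> A B)" "src (zero_mor \<C> A B) = A" "tgt (zero_mor \<C> A B) = B"
    using one_closed by (simp_all add: mor_iff)
qed

lemma madd_arr:
  assumes "arr f" "arr g" "src f = src g" "tgt f = tgt g"
  shows "arr (f \<boxplus> g)" "src (f \<boxplus> g) = src g" "tgt (f \<boxplus> g) = tgt g"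
proof -
  interpret comm_group "Hom \<C> (src g) (tgt g)" by (rule hom_group)
  show "arr (f \<boxplus> g)" "src (f \<boxplus> g) = src g" "tgt (f \<boxplus> g) = tgt g"
    using m_closed[of f g] assms by (simp_all add: mor_iff madd_def)
qed

lemma mneg_arr:
  assumes "arr f" shows "arr (\<boxminus> f)" "src (\<boxminus> f) = src f" "tgt (\<boxminus> f) = tgt f"
proof -
  interpret comm_group "Hom \<C> (src f) (tgt f)" by (rule hom_group)
  show "arr (\<boxminus> f)" "src (\<boxminus> f) = src f" "tgt (\<boxminus> f) = tgt f"
    using inv_closed[of f] assms by (simp_all add: mor_iff mneg_def)
qed

lemma mult_madd: "f \<in> Mor \<C> A B \<Longrightarrow> f \<otimes>\<^bsub>Hom \<C> A B\<^esub> g = f \<boxplus> g"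
  by (simp add: mor_iff madd_def)

lemma inv_mneg: "f \<in> Mor \<C> A B \<Longrightarrow> inv\<^bsub>Hom \<C> A B\<^esub> f = \<boxminus> f"
  by (simp add: mor_iff mneg_def)

text \<open>All laws come from a single interpretation of the hom group under uniform assumptions.
  The separate rules that follow are instances, with an argument repeated where a law has fewer than
  three variables.\<close>

lemma madd_group:
  assumes "arr f" "arr g" "arr h" "src f = A" "src g = A" "src h = A" "tgt f = B" "tgt g = B" "tgt h = B"
  shows "(f \<boxplus> g) \<boxplus> h = f \<boxplus> (g \<boxplus> h)" "f \<boxplus> g = g \<boxplus> f" "f \<boxplus> (g \<boxplus> h) = g \<boxplus> (f \<boxplus> h)"
    "f \<boxplus> zero_mor \<C> A B = f" "zero_mor \<C> A B \<boxplus> f = f" "f \<boxplus> \<boxminus> f = zero_mor \<C> A B"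
    "\<boxminus> f \<boxplus> f = zero_mor \<C> A B" "f \<boxplus> (\<boxminus> f \<boxplus> g) = g" "\<boxminus> f \<boxplus> (f \<boxplus> g) = g"
    "\<boxminus> (f \<boxplus> g) = \<boxminus> f \<boxplus> \<boxminus> g" "\<boxminus> \<boxminus> f = f" "\<boxminus> zero_mor \<C> A B = zero_mor \<C> A B"
    "f \<boxplus> g = f \<boxplus> h \<longleftrightarrow> g = h" "f = g \<longleftrightarrow> f \<boxplus> \<boxminus> g = zero_mor \<C> A B"
proof -
  interpret G: comm_group "Hom \<C> A B" by (rule hom_group)
  have m: "f \<in> Mor \<C> A B" "g \<in> Mor \<C> A B" "h \<in> Mor \<C> A B" using assms by (simp_all add: mor_iff)
  note c = m G.m_closed G.inv_closed G.one_closed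
  have e: "u \<boxplus> v = u \<otimes>\<^bsub>Hom \<C> A B\<^esub> v" if "u \<in> Mor \<C> A B" for u v
    using that by (simp add: mult_madd)
  have i: "\<boxminus> u = inv\<^bsub>Hom \<C> A B\<^esub> u" if "u \<in> Mor \<C> A B" for u
    using that by (simp add: inv_mneg)
  show "(f \<boxplus> g) \<boxplus> h = f \<boxplus> (g \<boxplus> h)" "f \<boxplus> g = g \<boxplus> f" "f \<boxplus> (g \<boxplus> h) = g \<boxplus> (f \<boxplus> h)"
    "f \<boxplus> zero_mor \<C> A B = f" "zero_mor \<C> A B \<boxplus> f = f" "f \<boxplus> \<boxminus> f = zero_mor \<C> A B"
    "\<boxminus> f \<boxplus> f = zero_mor \<C> A B" "f \<boxplus> (\<boxminus> f \<boxplus> g) = g" "\<boxminus> f \<boxplus> (f \<boxplus> g) = g"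
    "\<boxminus> (f \<boxplus> g) = \<boxminus> f \<boxplus> \<boxminus> g" "\<boxminus> \<boxminus> f = f" "\<boxminus> zero_mor \<C> A B = zero_mor \<C> A B"
    "f \<boxplus> g = f \<boxplus> h \<longleftrightarrow> g = h"
         apply (simp_all only: e i c G.inv_mult G.inv_inv G.inv_one G.r_one G.l_one G.r_inv G.l_inv)
      apply (rule G.m_assoc[OF m])
     apply (rule G.m_comm[OF m(1,2)])
    apply (rule G.m_lcomm[OF m])
    apply (simp_all add: m G.m_assoc[symmetric])
  done
  show "f = g \<longleftrightarrow> f \<boxplus> \<boxminus> g = zero_mor \<C> A B"
    by (metis G.inv_closed G.inv_equality G.inv_inv G.r_inv e i m(1) m(2))
qed

lemma madd_assoc: "\<lbrakk>arr f; arr g; arr h; src f = src g; src g = src h; tgt f = tgt g; tgt g = tgt h\<rbrakk>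
   \<Longrightarrow> (f \<boxplus> g) \<boxplus> h = f \<boxplus> (g \<boxplus> h)"
  by (rule madd_group(1)) auto
lemma madd_comm: "\<lbrakk>arr f; arr g; src f = src g; tgt f = tgt g\<rbrakk> \<Longrightarrow> f \<boxplus> g = g \<boxplus> f"
  by (rule madd_group(2)[where h=f]) auto
lemma madd_lcomm: "\<lbrakk>arr f; arr g; arr h; src f = src g; src g = src h; tgt f = tgt g; tgt g = tgt h\<rbrakk>
   \<Longrightarrow> f \<boxplus> (g \<boxplus> h) = g \<boxplus> (f \<boxplus> h)"
  by (rule madd_group(3)) auto
lemma madd_zero: "\<lbrakk>arr f; src f = A; tgt f = B\<rbrakk> \<Longrightarrow> f \<boxplus> zero_mor \<C> A B = f"
  "\<lbrakk>arr f; src f = A; tgt f = B\<rbrakk> \<Longrightarrow> zero_mor \<C> A B \<boxplus> f = f"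
  by (auto intro: madd_group(4,5)[where g=f and h=f])
lemma madd_mneg: "arr f \<Longrightarrow> f \<boxplus> \<boxminus> f = zero_mor \<C> (src f) (tgt f)"
  "arr f \<Longrightarrow> \<boxminus> f \<boxplus> f = zero_mor \<C> (src f) (tgt f)"
  by (auto intro: madd_group(6,7)[where g=f and h=f])
lemma madd_cancel: "\<lbrakk>arr f; arr g; src f = src g; tgt f = tgt g\<rbrakk> \<Longrightarrow> f \<boxplus> (\<boxminus> f \<boxplus> g) = g"
  "\<lbrakk>arr f; arr g; src f = src g; tgt f = tgt g\<rbrakk> \<Longrightarrow> \<boxminus> f \<boxplus> (f \<boxplus> g) = g"
  by (auto intro: madd_group(8,9)[where h=f])
lemma mneg_madd: "\<lbrakk>arr f; arr g; src f = src g; tgt f = tgt g\<rbrakk> \<Longrightarrow> \<boxminus> (f \<boxplus> g) = \<boxminus> f \<boxplus> \<boxminus> g"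
  "arr f \<Longrightarrow> \<boxminus> \<boxminus> f = f" "\<boxminus> zero_mor \<C> A B = zero_mor \<C> A B"
    apply (rule madd_group(10)[where h=f]; simp)
   apply (rule madd_group(11)[where h=f and g=f]; simp)
  by (rule madd_group(12)[of "zero_mor \<C> A B" "zero_mor \<C> A B" "zero_mor \<C> A B"]; simp add: zero_arr)
lemma madd_eq_iff: "\<lbrakk>arr f; arr g; src f = src g; tgt f = tgt g\<rbrakk>
   \<Longrightarrow> f = g \<longleftrightarrow> f \<boxplus> \<boxminus> g = zero_mor \<C> (src f) (tgt f)"
  by (rule madd_group(14)[where h=f]) auto

lemma cmp_madd:
  assumes "arr f" "arr f'" "arr g" "src f = src f'" "tgt f = tgt f'" "tgt f = src g"
  shows "g \<cdot> (f \<boxplus> f') = (g \<cdot> f) \<boxplus> (g \<cdot> f')"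
  using cmp_add_right[of f "src f" "tgt f" f' g "tgt g"] assms by (simp add: mor_iff mult_madd cmp_arr)
lemma madd_cmp:
  assumes "arr f" "arr g" "arr g'" "src g = src g'" "tgt g = tgt g'" "tgt f = src g"
  shows "(g \<boxplus> g') \<cdot> f = (g \<cdot> f) \<boxplus> (g' \<cdot> f)"
  using cmp_add_left[of f "src f" "tgt f" g "tgt g" g'] assms by (simp add: mor_iff mult_madd cmp_arr)

text \<open>Cancellation in the hom group. Biadditivity makes \<open>g \<cdot> 0\<close> and
  \<open>0 \<cdot> g\<close> idempotent for the sum, so composition preserves zero.\<close>

lemma madd_idem: "\<lbrakk>arr f; f \<boxplus> f = f\<rbrakk> \<Longrightarrow> f = zero_mor \<C> (src f) (tgt f)"
  using madd_group(13)[of f f "zero_mor \<C> (src f) (tgt f)" "src f" "tgt f"] by (simp add: zero_arr madd_zero)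

lemma cmp_zero: "\<lbrakk>arr g; src g = B\<rbrakk> \<Longrightarrow> g \<cdot> zero_mor \<C> A B = zero_mor \<C> A (tgt g)"
  using madd_idem[of "g \<cdot> zero_mor \<C> A B"] cmp_madd[of "zero_mor \<C> A B" "zero_mor \<C> A B" g]
  by (simp add: cmp_arr zero_arr madd_zero)
lemma zero_cmp: "\<lbrakk>arr g; tgt g = A\<rbrakk> \<Longrightarrow> zero_mor \<C> A B \<cdot> g = zero_mor \<C> (src g) B"
  using madd_idem[of "zero_mor \<C> A B \<cdot> g"] madd_cmp[of g "zero_mor \<C> A B" "zero_mor \<C> A B"]
  by (simp add: cmp_arr zero_arr madd_zero)

lemma mneg_unique: "\<lbrakk>arr f; arr g; src f = src g; tgt f = tgt g; f \<boxplus> g = zero_mor \<C> (src f) (tgt f)\<rbrakk>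
   \<Longrightarrow> g = \<boxminus> f"
  using madd_cancel(2)[of f g] by (simp add: madd_zero mneg_arr)

lemma cmp_mneg: "\<lbrakk>arr f; arr g; tgt f = src g\<rbrakk> \<Longrightarrow> g \<cdot> \<boxminus> f = \<boxminus> (g \<cdot> f)"
  by (rule mneg_unique) (simp_all add: cmp_arr mneg_arr cmp_madd[symmetric] madd_mneg cmp_zero)
lemma mneg_cmp: "\<lbrakk>arr f; arr g; tgt f = src g\<rbrakk> \<Longrightarrow> (\<boxminus> g) \<cdot> f = \<boxminus> (g \<cdot> f)"
  by (rule mneg_unique) (simp_all add: cmp_arr mneg_arr madd_cmp[symmetric] madd_mneg zero_cmp)

lemmas arr_simps = mor_iff idn_arr cmp_arr zero_arr madd_arr mneg_arr
text \<open>Normal form: composites associated to the right, expanded over sums, signs outside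
  composites. The permutative rules for the sum are added only in \<open>cat_ac\<close>.\<close>

lemmas cat_simps = arr_simps cmp_assoc' idn_cmp madd_assoc madd_zero madd_mneg madd_cancel mneg_madd
  cmp_madd madd_cmp cmp_zero zero_cmp cmp_mneg mneg_cmp
lemmas cat_ac = cat_simps madd_comm madd_lcomm

text \<open>Under right association a known equation \<open>a \<cdot> b = c\<close> no longer
  matches inside \<open>a \<cdot> (b \<cdot> z)\<close>; this is the form in which it can still be
  applied, and the standard way commuting squares are used below.\<close>

lemma cmp_eq_extend:
  "\<lbrakk>a \<cdot> b = c; arr a; arr b; src a = tgt b; arr z; tgt z = src b\<rbrakk> \<Longrightarrow> a \<cdot> (b \<cdot> z) = c \<cdot> z"
  by (metis cmp_assoc')

section \<open>Biproducts and exactness of Hom\<close>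

lemma biproduct_iff:
  "is_biproduct \<C> A B S \<longleftrightarrow>
    in1 S \<in> Mor \<C> A (bobj S) \<and> in2 S \<in> Mor \<C> B (bobj S) \<and>
    pr1 S \<in> Mor \<C> (bobj S) A \<and> pr2 S \<in> Mor \<C> (bobj S) B \<and>
    pr1 S \<cdot> in1 S = Idn \<C> A \<and> pr2 S \<cdot> in2 S = Idn \<C> B \<and>
    pr2 S \<cdot> in1 S = zero_mor \<C> A B \<and> pr1 S \<cdot> in2 S = zero_mor \<C> B A \<and>
    (in1 S \<cdot> pr1 S) \<boxplus> (in2 S \<cdot> pr2 S) = Idn \<C> (bobj S)"
proof -
  have "(in1 S \<cdot> pr1 S) \<otimes>\<^bsub>Hom \<C> (bobj S) (bobj S)\<^esub> (in2 S \<cdot> pr2 S) = (in1 S \<cdot> pr1 S) \<boxplus> (in2 S \<cdot> pr2 S)"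
    if "in1 S \<in> Mor \<C> A (bobj S)" "pr1 S \<in> Mor \<C> (bobj S) A"
    using that by (auto intro!: mult_madd simp: arr_simps)
  then show ?thesis unfolding is_biproduct_def by auto
qed

context
  fixes A B S assumes S: "is_biproduct \<C> A B S"
begin

lemma biprod_arr:
  "arr (in1 S)" "arr (in2 S)" "arr (pr1 S)" "arr (pr2 S)"
  "src (in1 S) = A" "src (in2 S) = B" "src (pr1 S) = bobj S" "src (pr2 S) = bobj S"
  "tgt (in1 S) = bobj S" "tgt (in2 S) = bobj S" "tgt (pr1 S) = A" "tgt (pr2 S) = B"
  using S by (simp_all add: biproduct_iff mor_iff)

lemma biprod_eqs:
  "pr1 S \<cdot> in1 S = Idn \<C> A" "pr2 S \<cdot> in2 S = Idn \<C> B"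
  "pr2 S \<cdot> in1 S = zero_mor \<C> A B" "pr1 S \<cdot> in2 S = zero_mor \<C> B A"
  "(in1 S \<cdot> pr1 S) \<boxplus> (in2 S \<cdot> pr2 S) = Idn \<C> (bobj S)"
  using S by (simp_all add: biproduct_iff)

lemma biprod_ext:
  "\<lbrakk>arr z; tgt z = A\<rbrakk> \<Longrightarrow> pr1 S \<cdot> (in1 S \<cdot> z) = z" "\<lbrakk>arr z; tgt z = B\<rbrakk> \<Longrightarrow> pr2 S \<cdot> (in2 S \<cdot> z) = z"
  "\<lbrakk>arr z; tgt z = A\<rbrakk> \<Longrightarrow> pr2 S \<cdot> (in1 S \<cdot> z) = zero_mor \<C> (src z) B"
  "\<lbrakk>arr z; tgt z = B\<rbrakk> \<Longrightarrow> pr1 S \<cdot> (in2 S \<cdot> z) = zero_mor \<C> (src z) A"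
  by (simp_all add: cmp_assoc'[symmetric] biprod_arr biprod_eqs idn_cmp zero_cmp)

lemma biprod_split_into: "\<lbrakk>arr v; tgt v = bobj S\<rbrakk> \<Longrightarrow> (in1 S \<cdot> (pr1 S \<cdot> v)) \<boxplus> (in2 S \<cdot> (pr2 S \<cdot> v)) = v"
  by (simp add: cmp_assoc'[symmetric] biprod_arr biprod_eqs idn_cmp madd_cmp[symmetric] cmp_arr)

lemma biprod_split_from: "\<lbrakk>arr v; src v = bobj S\<rbrakk> \<Longrightarrow> (v \<cdot> (in1 S \<cdot> pr1 S)) \<boxplus> (v \<cdot> (in2 S \<cdot> pr2 S)) = v"
  by (simp add: biprod_arr biprod_eqs idn_cmp cmp_madd[symmetric] cmp_arr)

lemma biprod_eq_from:
  assumes "arr u" "arr v" "src u = bobj S" "src v = bobj S" "u \<cdot> in1 S = v \<cdot> in1 S" "u \<cdot> in2 S = v \<cdot> in2 S"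
  shows "u = v"
proof -
  have "u \<cdot> (in1 S \<cdot> pr1 S) = v \<cdot> (in1 S \<cdot> pr1 S)" "u \<cdot> (in2 S \<cdot> pr2 S) = v \<cdot> (in2 S \<cdot> pr2 S)"
    using assms by (simp_all add: cmp_assoc'[symmetric] biprod_arr)
  then show ?thesis using biprod_split_from assms by metis
qed

end

lemmas biprod_simps = biprod_arr biprod_eqs biprod_ext

lemma mor_sum_madd:
  assumes "is_biproduct \<C> A A' S" "is_biproduct \<C> B B' T" "f \<in> Mor \<C> A B" "f' \<in> Mor \<C> A' B'"
  shows "mor_sum \<C> S T f f' = (in1 T \<cdot> (f \<cdot> pr1 S)) \<boxplus> (in2 T \<cdot> (f' \<cdot> pr2 S))"
proof -
  note b = biprod_arr[OF assms(1)] biprod_arr[OF assms(2)] assms(3,4)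
  have "in1 T \<cdot> f \<cdot> pr1 S \<in> Mor \<C> (bobj S) (bobj T)" using b by (simp add: arr_simps)
  then show ?thesis unfolding mor_sum_def using b by (simp add: mult_madd cmp_assoc' arr_simps)
qed

lemma mor_sum_simps:
  assumes S: "is_biproduct \<C> A A' S" and T: "is_biproduct \<C> B B' T"
    and f: "f \<in> Mor \<C> A B" "f' \<in> Mor \<C> A' B'"
  shows "mor_sum \<C> S T f f' \<in> Mor \<C> (bobj S) (bobj T)"
    "mor_sum \<C> S T f f' \<cdot> in1 S = in1 T \<cdot> f" "mor_sum \<C> S T f f' \<cdot> in2 S = in2 T \<cdot> f'"
    "pr1 T \<cdot> mor_sum \<C> S T f f' = f \<cdot> pr1 S" "pr2 T \<cdot> mor_sum \<C> S T f f' = f' \<cdot> pr2 S"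
  using f by (simp_all add: mor_sum_madd[OF S T f] biprod_simps[OF S] biprod_simps[OF T] cat_simps)

lemma zero_object_mor:
  assumes "zero_object \<C> Z"
  shows "f \<in> Mor \<C> Z A \<Longrightarrow> f = zero_mor \<C> Z A" "f \<in> Mor \<C> A Z \<Longrightarrow> f = zero_mor \<C> A Z"
    "Idn \<C> Z = zero_mor \<C> Z Z"
proof -
  have z: "zero_mor \<C> U V \<in> Mor \<C> U V" for U V by (simp add: arr_simps)
  show 1: "f \<in> Mor \<C> Z A \<Longrightarrow> f = zero_mor \<C> Z A" for f A
    using assms z unfolding zero_object_def by blast
  show "f \<in> Mor \<C> A Z \<Longrightarrow> f = zero_mor \<C> A Z"
    using assms z unfolding zero_object_def by blast
  show "Idn \<C> Z = zero_mor \<C> Z Z" by (rule 1) (simp add: arr_simps)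
qed

text \<open>Taking \<open>A\<close> itself as its sum with a zero object, here and in the mirror
  version, makes \<open>realz_zero\<close> yield the triangles A -> A -> Z and Z -> A -> A with
  literal identities. These are the test triangles for exactness, and they leave end terms unchanged
  when triangles are added.\<close>

definition biprod_zero_right :: "'o \<Rightarrow> 'o \<Rightarrow> ('o, 'm) biprod_data"
  where "biprod_zero_right A Z = \<lparr>bobj = A, in1 = Idn \<C> A, in2 = zero_mor \<C> Z A, pr1 = Idn \<C> A, pr2 = zero_mor \<C> A Z\<rparr>"

definition biprod_zero_left :: "'o \<Rightarrow> 'o \<Rightarrow> ('o, 'm) biprod_data"
  where "biprod_zero_left Z A = \<lparr>bobj = A, in1 = zero_mor \<C> Z A, in2 = Idn \<C> A, pr1 = zero_mor \<C> A Z, pr2 = Idn \<C> A\<rparr>"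

lemma biprod_zero_right: "zero_object \<C> Z \<Longrightarrow> is_biproduct \<C> A Z (biprod_zero_right A Z)"
  by (simp add: biproduct_iff biprod_zero_right_def cat_simps zero_object_mor(3))

lemma biprod_zero_left: "zero_object \<C> Z \<Longrightarrow> is_biproduct \<C> Z A (biprod_zero_left Z A)"
  by (simp add: biproduct_iff biprod_zero_left_def cat_simps zero_object_mor(3))

end

section \<open>Extensions, and exactness of Hom along a single triangle\<close>

context extriangulated_category
begin

lemma ext_closed: "\<lbrakk>c \<in> Mor \<C> C' C; a \<in> Mor \<C> A A'; \<delta> \<in> carrier (Ext \<C> C A)\<rbrakk>
    \<Longrightarrow> ext_map \<C> c a \<delta> \<in> carrier (Ext \<C> C' A')"
  using ext_map_hom by (blast intro: hom_in_carrier)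

lemma ext_map_one: "\<lbrakk>c \<in> Mor \<C> C' C; a \<in> Mor \<C> A A'\<rbrakk> \<Longrightarrow> ext_map \<C> c a \<one>\<^bsub>Ext \<C> C A\<^esub> = \<one>\<^bsub>Ext \<C> C' A'\<^esub>"
  using hom_one[OF ext_map_hom] ext_group by (metis comm_group_def)

lemma ext_map_mult: "\<lbrakk>c \<in> Mor \<C> C' C; a \<in> Mor \<C> A A'; \<delta> \<in> carrier (Ext \<C> C A); \<epsilon> \<in> carrier (Ext \<C> C A)\<rbrakk>
   \<Longrightarrow> ext_map \<C> c a (\<delta> \<otimes>\<^bsub>Ext \<C> C A\<^esub> \<epsilon>) = ext_map \<C> c a \<delta> \<otimes>\<^bsub>Ext \<C> C' A'\<^esub> ext_map \<C> c a \<epsilon>"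
  by (rule hom_mult[OF ext_map_hom])

lemma ext_map_zero_right:
  assumes "c \<in> Mor \<C> C' C" "\<delta> \<in> carrier (Ext \<C> C A)"
  shows "ext_map \<C> c (zero_mor \<C> A A') \<delta> = \<one>\<^bsub>Ext \<C> C' A'\<^esub>"
proof -
  interpret E: comm_group "Ext \<C> C' A'" by (rule ext_group)
  let ?z = "zero_mor \<C> A A'"
  have z: "?z \<in> Mor \<C> A A'" by (simp add: arr_simps)
  show ?thesis
    using ext_map_add_right[OF assms(1) z z assms(2)] ext_closed[OF assms(1) z assms(2)] z
    by (simp add: mult_madd madd_zero arr_simps)
qed

lemma etriD:
  assumes "etri \<C> A x B y C \<delta>"
  shows "\<delta> \<in> carrier (Ext \<C> C A)" "arr x" "src x = A" "tgt x = B" "arr y" "src y = B" "tgt y = C"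
  using assms by (simp_all add: etri_def mor_iff)

lemma etri_split_zero_left:
  assumes "zero_object \<C> Z" shows "etri \<C> Z (zero_mor \<C> Z A) A (Idn \<C> A) A \<one>\<^bsub>Ext \<C> A Z\<^esub>"
  using realz_zero[OF biprod_zero_left[OF assms, of A]] by (simp add: biprod_zero_left_def)

lemma etri_split_zero_right:
  assumes "zero_object \<C> Z" shows "etri \<C> A (Idn \<C> A) A (zero_mor \<C> A Z) Z \<one>\<^bsub>Ext \<C> Z A\<^esub>"
  using realz_zero[OF biprod_zero_right[OF assms, of A]] by (simp add: biprod_zero_right_def)

context
  fixes A x B y C \<delta> assumes e: "etri \<C> A x B y C \<delta>"
begin

text \<open>(ET3) applied to the square formed by the identity of \<open>A\<close> and
  \<open>x\<close>, from the split triangle A -> A -> Z, makes \<open>y \<cdot> x\<close> factor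
  through the zero object.\<close>

lemma etri_cmp_zero: "y \<cdot> x = zero_mor \<C> A C"
proof -
  obtain Z where Z: "zero_object \<C> Z" using has_zero_object by blast
  obtain c where "c \<cdot> zero_mor \<C> A Z = y \<cdot> x" "c \<in> Mor \<C> Z C"
    using ET3[OF etri_split_zero_right[OF Z, of A] e, of "Idn \<C> A" x]
    by (auto simp: ext_morphism_def arr_simps etriD[OF e])
  then show ?thesis by (simp add: cat_simps)
qed

text \<open>The dual of (ET3) for the map from W -> W -> Z given by \<open>t\<close> and zero. The
  filler on first terms is the desired factorization; nothing makes it unique.\<close>

lemma etri_exact_from:
  assumes "t \<in> Mor \<C> W B" "y \<cdot> t = zero_mor \<C> W C"
  shows "\<exists>a\<in>Mor \<C> W A. x \<cdot> a = t"
proof -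
  obtain Z where Z: "zero_object \<C> Z" using has_zero_object by blast
  have "\<exists>a. t \<cdot> Idn \<C> W = x \<cdot> a \<and> ext_morphism \<C> W Z \<one>\<^bsub>Ext \<C> Z W\<^esub> A C \<delta> a (zero_mor \<C> Z C)"
    by (rule ET3_op[OF etri_split_zero_right[OF Z, of W] e]) (use assms in \<open>simp_all add: cat_simps\<close>)
  then show ?thesis using assms by (auto simp: ext_morphism_def cat_simps)
qed

text \<open>(ET3) for the map to Z -> W -> W given by zero and \<open>t\<close>; the filler on third
  terms is the factorization.\<close>

lemma etri_exact_into:
  assumes "t \<in> Mor \<C> B W" "t \<cdot> x = zero_mor \<C> A W"
  shows "\<exists>c\<in>Mor \<C> C W. c \<cdot> y = t"
proof -
  obtain Z where Z: "zero_object \<C> Z" using has_zero_object by blast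
  have "\<exists>c. c \<cdot> y = Idn \<C> W \<cdot> t \<and> ext_morphism \<C> A C \<delta> Z W \<one>\<^bsub>Ext \<C> W Z\<^esub> (zero_mor \<C> A Z) c"
    by (rule ET3[OF e etri_split_zero_left[OF Z, of W]]) (use assms in \<open>simp_all add: cat_simps\<close>)
  then show ?thesis using assms by (auto simp: ext_morphism_def cat_simps)
qed

text \<open>A lift \<open>h\<close> gives a map from the split triangle Z -> W -> W, so the pulled
  back extension is also a pushforward of zero. This is how a lift of \<open>c\<close> through
  \<open>y\<close> forces the base change along \<open>c\<close> to split.\<close>

lemma etri_lift_pull_zero:
  assumes "h \<in> Mor \<C> W B"
  shows "pull \<C> A (y \<cdot> h) \<delta> = \<one>\<^bsub>Ext \<C> W A\<^esub>"
proof -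
  obtain Z where Z: "zero_object \<C> Z" using has_zero_object by blast
  have "\<exists>a. h \<cdot> zero_mor \<C> Z W = x \<cdot> a \<and> ext_morphism \<C> Z W \<one>\<^bsub>Ext \<C> W Z\<^esub> A C \<delta> a (y \<cdot> h)"
    by (rule ET3_op[OF etri_split_zero_left[OF Z, of W] e])
      (use assms etriD[OF e] in \<open>simp_all add: cat_simps\<close>)
  then obtain a where a: "a \<in> Mor \<C> Z A" "push \<C> W a \<one>\<^bsub>Ext \<C> W Z\<^esub> = pull \<C> A (y \<cdot> h) \<delta>"
    by (auto simp: ext_morphism_def)
  then show ?thesis using ext_map_one[of "Idn \<C> W" W W a Z A] by (simp add: arr_simps)
qed

text \<open>Every triangle is exact in the middle under Hom, so only the two ends remain as
  conditions. They are stated elementwise, ready for diagram chases.\<close>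

lemma hom_exact_from_iff:
  "hom_exact_from \<C> W A x B y C \<longleftrightarrow>
    (\<forall>u \<in> Mor \<C> W A. x \<cdot> u = zero_mor \<C> W B \<longrightarrow> u = zero_mor \<C> W A) \<and>
    (\<forall>v \<in> Mor \<C> W C. \<exists>t \<in> Mor \<C> W B. y \<cdot> t = v)"
proof -
  note d = etriD[OF e]
  interpret GA: comm_group "Hom \<C> W A" by (rule hom_group)
  interpret GB: comm_group "Hom \<C> W B" by (rule hom_group)
  interpret GC: comm_group "Hom \<C> W C" by (rule hom_group)
  have hx: "(\<lambda>\<phi>. x \<cdot> \<phi>) \<in> hom (Hom \<C> W A) (Hom \<C> W B)"
    by (rule homI) (use d in \<open>simp_all add: cmp_add_right mor_iff cmp_arr\<close>)
  have hy: "(\<lambda>\<phi>. y \<cdot> \<phi>) \<in> hom (Hom \<C> W B) (Hom \<C> W C)"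
    by (rule homI) (use d in \<open>simp_all add: cmp_add_right mor_iff cmp_arr\<close>)
  interpret X: group_hom "Hom \<C> W A" "Hom \<C> W B" "\<lambda>\<phi>. x \<cdot> \<phi>"
    by (rule group_hom.intro) (use hx in \<open>auto intro: GA.is_group GB.is_group simp: group_hom_axioms_def\<close>)
  interpret Y: group_hom "Hom \<C> W B" "Hom \<C> W C" "\<lambda>\<phi>. y \<cdot> \<phi>"
    by (rule group_hom.intro) (use hy in \<open>auto intro: GB.is_group GC.is_group simp: group_hom_axioms_def\<close>)
  have k: "kernel (Hom \<C> W B) (Hom \<C> W C) (\<lambda>\<phi>. y \<cdot> \<phi>) = (\<lambda>\<phi>. x \<cdot> \<phi>) ` Mor \<C> W A"
    using etri_exact_from etri_cmp_zero
    by (auto simp: kernel_def cat_simps d cmp_assoc'[symmetric])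
  have inj: "inj_on (\<lambda>\<phi>. x \<cdot> \<phi>) (Mor \<C> W A) \<longleftrightarrow>
      (\<forall>u \<in> Mor \<C> W A. x \<cdot> u = zero_mor \<C> W B \<longrightarrow> u = zero_mor \<C> W A)"
    unfolding X.inj_on_one_iff by blast
  show ?thesis
    unfolding hom_exact_from_def short_exact_sequence_iff
    by (auto simp: k mon_def epi_iff_subset inj hx hy X.group_hom_axioms Y.group_hom_axioms
        GA.is_group GB.is_group GC.is_group image_iff subset_iff cong: conj_cong)
qed

lemma hom_exact_into_iff:
  "hom_exact_into \<C> W A x B y C \<longleftrightarrow>
    (\<forall>u \<in> Mor \<C> C W. u \<cdot> y = zero_mor \<C> B W \<longrightarrow> u = zero_mor \<C> C W) \<and>
    (\<forall>v \<in> Mor \<C> A W. \<exists>t \<in> Mor \<C> B W. t \<cdot> x = v)"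
proof -
  note d = etriD[OF e]
  interpret GA: comm_group "Hom \<C> A W" by (rule hom_group)
  interpret GB: comm_group "Hom \<C> B W" by (rule hom_group)
  interpret GC: comm_group "Hom \<C> C W" by (rule hom_group)
  have hx: "(\<lambda>\<phi>. \<phi> \<cdot> x) \<in> hom (Hom \<C> B W) (Hom \<C> A W)"
    by (rule homI) (use d in \<open>simp_all add: cmp_add_left mor_iff cmp_arr\<close>)
  have hy: "(\<lambda>\<phi>. \<phi> \<cdot> y) \<in> hom (Hom \<C> C W) (Hom \<C> B W)"
    by (rule homI) (use d in \<open>simp_all add: cmp_add_left mor_iff cmp_arr\<close>)
  interpret X: group_hom "Hom \<C> B W" "Hom \<C> A W" "\<lambda>\<phi>. \<phi> \<cdot> x"
    by (rule group_hom.intro) (use hx in \<open>auto intro: GA.is_group GB.is_group simp: group_hom_axioms_def\<close>)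
  interpret Y: group_hom "Hom \<C> C W" "Hom \<C> B W" "\<lambda>\<phi>. \<phi> \<cdot> y"
    by (rule group_hom.intro) (use hy in \<open>auto intro: GB.is_group GC.is_group simp: group_hom_axioms_def\<close>)
  have k: "kernel (Hom \<C> B W) (Hom \<C> A W) (\<lambda>\<phi>. \<phi> \<cdot> x) = (\<lambda>\<phi>. \<phi> \<cdot> y) ` Mor \<C> C W"
    using etri_exact_into etri_cmp_zero
    by (auto simp: kernel_def cat_simps d)
  have inj: "inj_on (\<lambda>\<phi>. \<phi> \<cdot> y) (Mor \<C> C W) \<longleftrightarrow>
      (\<forall>u \<in> Mor \<C> C W. u \<cdot> y = zero_mor \<C> B W \<longrightarrow> u = zero_mor \<C> C W)"
    unfolding Y.inj_on_one_iff by blast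
  show ?thesis
    unfolding hom_exact_into_def short_exact_sequence_iff
    by (auto simp: k mon_def epi_iff_subset inj hx hy X.group_hom_axioms Y.group_hom_axioms
        GA.is_group GB.is_group GC.is_group image_iff subset_iff cong: conj_cong)
qed

end
end

section \<open>Realizations\<close>

context additive_category
begin

lemma iso_morE:
  assumes "iso_mor \<C> A B f"
  obtains g where "f \<in> Mor \<C> A B" "g \<in> Mor \<C> B A" "g \<cdot> f = Idn \<C> A" "f \<cdot> g = Idn \<C> B"
  using assms unfolding iso_mor_def by blast

lemma iso_mor_idn: "iso_mor \<C> A A (Idn \<C> A)"
  unfolding iso_mor_def by (rule conjI[OF _ bexI[of _ "Idn \<C> A"]]) (simp_all add: cat_simps)

lemma iso_mor_cmp:
  assumes "iso_mor \<C> A B f" "iso_mor \<C> B C g" shows "iso_mor \<C> A C (g \<cdot> f)"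
proof -
  obtain f' where f: "f \<in> Mor \<C> A B" "f' \<in> Mor \<C> B A" "f' \<cdot> f = Idn \<C> A" "f \<cdot> f' = Idn \<C> B"
    using assms(1) by (rule iso_morE)
  obtain g' where g: "g \<in> Mor \<C> B C" "g' \<in> Mor \<C> C B" "g' \<cdot> g = Idn \<C> B" "g \<cdot> g' = Idn \<C> C"
    using assms(2) by (rule iso_morE)
  note m = f(1,2)[unfolded mor_iff] g(1,2)[unfolded mor_iff]
  have "g' \<cdot> (g \<cdot> f) = f" "f \<cdot> (f' \<cdot> g') = g'"
    using m cmp_eq_extend[OF g(3), of f] cmp_eq_extend[OF f(4), of g'] by (simp_all add: idn_cmp)
  then have "(f' \<cdot> g') \<cdot> (g \<cdot> f) = Idn \<C> A" "(g \<cdot> f) \<cdot> (f' \<cdot> g') = Idn \<C> C"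
    using m f g by (simp_all add: cmp_assoc' cmp_arr)
  then show ?thesis
    unfolding iso_mor_def using m by (intro conjI bexI[of _ "f' \<cdot> g'"]) (simp_all add: arr_simps)
qed

text \<open>The inverse \<open>f\<close> of \<open>b' \<cdot> b\<close> gives \<open>b\<close> the
  left inverse \<open>f \<cdot> b'\<close>, the inverse \<open>g\<close> of
  \<open>b \<cdot> b'\<close> gives it the right inverse \<open>b' \<cdot> g\<close>, and the two
  must agree.\<close>

lemma iso_mor_cancel:
  assumes b: "b \<in> Mor \<C> A B" and b': "b' \<in> Mor \<C> B A"
    and "iso_mor \<C> A A (b' \<cdot> b)" "iso_mor \<C> B B (b \<cdot> b')"
  shows "iso_mor \<C> A B b"
proof -
  obtain f where f: "f \<in> Mor \<C> A A" "f \<cdot> (b' \<cdot> b) = Idn \<C> A" using assms(3) by (rule iso_morE)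
  obtain g where g: "g \<in> Mor \<C> B B" "(b \<cdot> b') \<cdot> g = Idn \<C> B" using assms(4) by (rule iso_morE)
  note m = b[unfolded mor_iff] b'[unfolded mor_iff] f(1)[unfolded mor_iff] g(1)[unfolded mor_iff]
  have "f \<cdot> b' = (f \<cdot> b') \<cdot> (b \<cdot> (b' \<cdot> g))"
    using m g(2) by (simp add: cat_simps)
  also have "\<dots> = (f \<cdot> (b' \<cdot> b)) \<cdot> (b' \<cdot> g)" using m by (simp add: cat_simps del: f g)
  also have "\<dots> = b' \<cdot> g" using m f(2) by (simp add: cat_simps)
  finally have "f \<cdot> b' = b' \<cdot> g" .
  moreover have "b \<cdot> (b' \<cdot> g) = Idn \<C> B" "(f \<cdot> b') \<cdot> b = Idn \<C> A" using m f(2) g(2) by (simp_all add: cmp_assoc')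
  ultimately show ?thesis
    unfolding iso_mor_def using m by (intro conjI bexI[of _ "f \<cdot> b'"]) (simp_all add: arr_simps)
qed

text \<open>If \<open>e = 1 + n\<close> with \<open>n\<^sup>2 = 0\<close>, then \<open>1 - n\<close> is the inverse of \<open>e\<close>.\<close>

lemma iso_mor_unipotent:
  assumes e: "e \<in> Mor \<C> B B" and n: "(e \<boxplus> \<boxminus> Idn \<C> B) \<cdot> (e \<boxplus> \<boxminus> Idn \<C> B) = zero_mor \<C> B B"
  shows "iso_mor \<C> B B e"
proof -
  define n where "n = e \<boxplus> \<boxminus> Idn \<C> B"
  note m = e[unfolded mor_iff]
  have g: "arr n" "src n = B" "tgt n = B" using m by (simp_all add: n_def arr_simps)
  have en: "e = Idn \<C> B \<boxplus> n" using m by (simp add: n_def cat_ac)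
  have "n \<boxplus> (Idn \<C> B \<boxplus> \<boxminus> n) = Idn \<C> B"
    using g madd_lcomm[of n "Idn \<C> B" "\<boxminus> n"] by (simp add: cat_simps)
  then have "(Idn \<C> B \<boxplus> \<boxminus> n) \<cdot> e = Idn \<C> B" "e \<cdot> (Idn \<C> B \<boxplus> \<boxminus> n) = Idn \<C> B"
    using n g unfolding en n_def[symmetric] by (simp_all add: cat_ac)
  then show ?thesis
    unfolding iso_mor_def using e g by (intro conjI bexI[of _ "Idn \<C> B \<boxplus> \<boxminus> n"]) (simp_all add: arr_simps)
qed

text \<open>Lets a statement about the first summand be used for the second one, as in the two
  halves of the pullback.\<close>

definition biprod_swap :: "('o, 'm) biprod_data \<Rightarrow> ('o, 'm) biprod_data"
  where "biprod_swap S = \<lparr>bobj = bobj S, in1 = in2 S, in2 = in1 S, pr1 = pr2 S, pr2 = pr1 S\<rparr>"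

lemma biprod_swap: "is_biproduct \<C> A B S \<Longrightarrow> is_biproduct \<C> B A (biprod_swap S)"
  using madd_comm[of "in1 S \<cdot> pr1 S" "in2 S \<cdot> pr2 S"]
  by (auto simp: biproduct_iff biprod_swap_def arr_simps)

end

context extriangulated_category
begin

lemma ext_map_cmp':
  "\<lbrakk>arr c; arr c'; src c = tgt c'; arr a; arr a'; tgt a = src a'; \<delta> \<in> carrier (Ext \<C> (tgt c) (src a))\<rbrakk>
   \<Longrightarrow> ext_map \<C> c' a' (ext_map \<C> c a \<delta>) = ext_map \<C> (c \<cdot> c') (a' \<cdot> a) \<delta>"
  by (rule ext_map_cmp[symmetric]) (auto simp: mor_iff)

text \<open>Makes \<open>realz_class\<close> usable: classes are nonempty
  (\<open>etri_exists\<close>), any two members are isomorphic (\<open>etri_unique\<close>), and a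
  class is closed under isomorphism of the middle term (\<open>etri_middle_iso\<close>).\<close>

lemma equiv_seq_equiv: "equiv (seqs \<C> A C) (seq_equiv \<C> A C)"
proof (rule equivI)
  show "seq_equiv \<C> A C \<subseteq> seqs \<C> A C \<times> seqs \<C> A C"
    by (auto simp: seq_equiv_def seqs_def)
  show "refl_on (seqs \<C> A C) (seq_equiv \<C> A C)"
  proof (rule refl_onI, clarify)
    fix x y assume "(x, y) \<in> seqs \<C> A C"
    then obtain B where "x \<in> Mor \<C> A B" "y \<in> Mor \<C> B C" by (auto simp: seqs_def)
    then show "((x, y), (x, y)) \<in> seq_equiv \<C> A C"
      using iso_mor_idn[of B] idn_left idn_right unfolding seq_equiv_def by blast
  qed
  show "sym (seq_equiv \<C> A C)"
  proof (rule symI, clarify)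
    fix x y x' y' assume "((x, y), (x', y')) \<in> seq_equiv \<C> A C"
    then obtain B B' b where *: "x \<in> Mor \<C> A B" "y \<in> Mor \<C> B C" "x' \<in> Mor \<C> A B'" "y' \<in> Mor \<C> B' C"
      "iso_mor \<C> B B' b" "b \<cdot> x = x'" "y' \<cdot> b = y"
      unfolding seq_equiv_def by blast
    obtain g where g: "b \<in> Mor \<C> B B'" "g \<in> Mor \<C> B' B" "g \<cdot> b = Idn \<C> B" "b \<cdot> g = Idn \<C> B'"
      using *(5) by (rule iso_morE)
    have "iso_mor \<C> B' B g" using g unfolding iso_mor_def by blast
    moreover have "g \<cdot> x' = x" "y \<cdot> g = y'"
      unfolding *(6,7)[symmetric] using *(1-4) g
      by (simp_all add: cmp_assoc'[symmetric] mor_iff idn_cmp) (simp_all add: cmp_assoc' idn_cmp)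
    ultimately show "((x', y'), (x, y)) \<in> seq_equiv \<C> A C"
      using * unfolding seq_equiv_def by blast
  qed
  show "trans (seq_equiv \<C> A C)"
  proof (rule transI, clarify)
    fix x y x' y' x'' y''
    assume 1: "((x, y), (x', y')) \<in> seq_equiv \<C> A C" and 2: "((x', y'), (x'', y'')) \<in> seq_equiv \<C> A C"
    obtain B B' b where *: "x \<in> Mor \<C> A B" "y \<in> Mor \<C> B C" "x' \<in> Mor \<C> A B'" "y' \<in> Mor \<C> B' C"
      "iso_mor \<C> B B' b" "b \<cdot> x = x'" "y' \<cdot> b = y"
      using 1 unfolding seq_equiv_def by blast
    obtain B1 B'' d where **: "x' \<in> Mor \<C> A B1" "x'' \<in> Mor \<C> A B''" "y'' \<in> Mor \<C> B'' C"
      "iso_mor \<C> B1 B'' d" "d \<cdot> x' = x''" "y'' \<cdot> d = y'"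
      using 2 unfolding seq_equiv_def by blast
    have [simp]: "B1 = B'" using * ** by (auto simp: mor_iff)
    have "b \<in> Mor \<C> B B'" "d \<in> Mor \<C> B' B''" using * ** by (auto simp: iso_mor_def)
    then have "(d \<cdot> b) \<cdot> x = x''" "y'' \<cdot> (d \<cdot> b) = y"
      using * ** by (auto simp: cmp_assoc' mor_iff)
    then show "((x, y), (x'', y'')) \<in> seq_equiv \<C> A C"
      using * ** iso_mor_cmp[of B B' b B'' d] unfolding seq_equiv_def by fastforce
  qed
qed

lemma etri_exists:
  assumes "\<delta> \<in> carrier (Ext \<C> C A)" shows "\<exists>x B y. etri \<C> A x B y C \<delta>"
proof -
  obtain p where p: "p \<in> realz \<C> C A \<delta>" "p \<in> seqs \<C> A C"
    using realz_class[OF assms] equiv_seq_equiv in_quotient_imp_non_empty in_quotient_imp_subset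
    by (metis subsetD ex_in_conv)
  then show ?thesis using assms by (cases p) (auto simp: etri_def seqs_def)
qed

lemma etri_unique:
  assumes "etri \<C> A x B y C \<delta>" "etri \<C> A x' B' y' C \<delta>"
  shows "\<exists>b. iso_mor \<C> B B' b \<and> b \<cdot> x = x' \<and> y' \<cdot> b = y"
proof -
  have "((x, y), (x', y')) \<in> seq_equiv \<C> A C"
    using assms in_quotient_imp_in_rel[OF equiv_seq_equiv realz_class] by (auto simp: etri_def)
  then show ?thesis using etriD[OF assms(1)] etriD[OF assms(2)]
    by (auto simp: seq_equiv_def mor_iff)
qed

lemma etri_middle_iso:
  assumes "etri \<C> A x B y C \<delta>" "iso_mor \<C> B B' b" "y' \<in> Mor \<C> B' C" "y' \<cdot> b = y"
  shows "etri \<C> A (b \<cdot> x) B' y' C \<delta>"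
proof -
  have b: "b \<in> Mor \<C> B B'" using assms(2) by (simp add: iso_mor_def)
  have m: "x \<in> Mor \<C> A B" "y \<in> Mor \<C> B C" "\<delta> \<in> carrier (Ext \<C> C A)" "(x, y) \<in> realz \<C> C A \<delta>"
    using assms(1) by (auto simp: etri_def)
  have c: "b \<cdot> x \<in> Mor \<C> A B'" using b m by (rule_tac cmp_closed)
  have "((x, y), (b \<cdot> x, y')) \<in> seq_equiv \<C> A C"
    unfolding seq_equiv_def using assms m b c by blast
  then have "(b \<cdot> x, y') \<in> realz \<C> C A \<delta>"
    using in_quotient_imp_closed[OF equiv_seq_equiv realz_class] m by blast
  then show ?thesis using m c assms(3) by (simp add: etri_def)
qed

text \<open>
  Replaces the five lemma, which would need exactness one step further on the left than an
  \<open>E\<close>-triangle provides: \<open>e - 1\<close> kills \<open>x\<close>, so it factors through \<open>y\<close>, which kills \<open>e - 1\<close>.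
\<close>

lemma etri_endo_iso:
  assumes t: "etri \<C> A x B y C \<delta>" and e: "e \<in> Mor \<C> B B" "e \<cdot> x = x" "y \<cdot> e = y"
  shows "iso_mor \<C> B B e"
proof (rule iso_mor_unipotent[OF e(1)])
  let ?n = "e \<boxplus> \<boxminus> Idn \<C> B"
  note m = etriD[OF t] e(1)[unfolded mor_iff]
  have n: "?n \<in> Mor \<C> B B" using m by (simp add: arr_simps)
  have "?n \<cdot> x = zero_mor \<C> A B" using m e by (simp add: cat_simps)
  then obtain u where u: "u \<in> Mor \<C> C B" "u \<cdot> y = ?n"
    using etri_exact_into[OF t n] by blast
  have "y \<cdot> ?n = zero_mor \<C> B C" using m e by (simp add: cat_simps)
  then show "?n \<cdot> ?n = zero_mor \<C> B B"
    using u m n unfolding u(2)[symmetric] by (simp add: cmp_assoc' mor_iff cmp_zero)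
qed

text \<open>\<open>seq_equiv\<close> fixes both end terms, so changing the third term needs an
  argument. Realize the pulled back extension and lift \<open>c\<close> and \<open>c'\<close> to
  middle terms by (ET2). Both composites of the lifts are compatible with inflation and deflation,
  hence invertible by \<open>etri_endo_iso\<close>, and so is each lift.\<close>

lemma etri_end_iso:
  assumes t: "etri \<C> A x B y C \<delta>"
    and c: "c \<in> Mor \<C> C C'" "c' \<in> Mor \<C> C' C" "c' \<cdot> c = Idn \<C> C" "c \<cdot> c' = Idn \<C> C'"
  shows "etri \<C> A x B (c \<cdot> y) C' (pull \<C> A c' \<delta>)"
proof -
  let ?d = "pull \<C> A c' \<delta>"
  note m = etriD[OF t] c(1,2)[unfolded mor_iff]
  have d: "?d \<in> carrier (Ext \<C> C' A)" using c m by (intro ext_closed) (simp_all add: arr_simps)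
  obtain x' B' y' where t': "etri \<C> A x' B' y' C' ?d" using etri_exists[OF d] by blast
  note m' = etriD[OF t']
  have "ext_morphism \<C> A C \<delta> A C' ?d (Idn \<C> A) c"
    using m c by (simp add: ext_morphism_def arr_simps ext_map_cmp' idn_cmp ext_map_idn)
  from realz_morphism[OF t t' this] obtain b where
    b: "b \<in> Mor \<C> B B'" "b \<cdot> x = x'" "y' \<cdot> b = c \<cdot> y" using m' by (auto simp: idn_cmp)
  have "ext_morphism \<C> A C' ?d A C \<delta> (Idn \<C> A) c'"
    using m c by (simp add: ext_morphism_def arr_simps ext_map_cmp' idn_cmp ext_map_idn)
  from realz_morphism[OF t' t this] obtain b' where
    b': "b' \<in> Mor \<C> B' B" "b' \<cdot> x' = x" "y \<cdot> b' = c' \<cdot> y'" using m by (auto simp: idn_cmp)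
  note mb = b(1)[unfolded mor_iff] b'(1)[unfolded mor_iff]
  have "iso_mor \<C> B B (b' \<cdot> b)"
  proof (rule etri_endo_iso[OF t])
    have "y \<cdot> (b' \<cdot> b) = (c' \<cdot> c) \<cdot> y"
      using m m' mb cmp_eq_extend[OF b'(3), of b] b(3) by (simp add: cmp_assoc')
    then show "y \<cdot> (b' \<cdot> b) = y" using c(3) m by (simp add: idn_cmp)
  qed (use m mb b b' in \<open>simp_all add: arr_simps cmp_assoc'\<close>)
  moreover have "iso_mor \<C> B' B' (b \<cdot> b')"
  proof (rule etri_endo_iso[OF t'])
    have "y' \<cdot> (b \<cdot> b') = (c \<cdot> c') \<cdot> y'"
      using m m' mb cmp_eq_extend[OF b(3), of b'] b'(3) by (simp add: cmp_assoc')
    then show "y' \<cdot> (b \<cdot> b') = y'" using c(4) m' by (simp add: idn_cmp)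
  qed (use m m' mb b b' in \<open>simp_all add: arr_simps cmp_assoc'\<close>)
  ultimately have "iso_mor \<C> B B' b" using b b' by (blast intro: iso_mor_cancel)
  then obtain g where g: "g \<in> Mor \<C> B' B" "g \<cdot> b = Idn \<C> B" "b \<cdot> g = Idn \<C> B'" by (rule iso_morE)
  have i: "iso_mor \<C> B' B g" using g b unfolding iso_mor_def by blast
  have gx: "g \<cdot> x' = x" unfolding b(2)[symmetric] using g m mb
    by (simp add: cmp_assoc'[symmetric] mor_iff idn_cmp)
  have "(c \<cdot> y) \<cdot> g = y'" unfolding b(3)[symmetric] using g m' mb
    by (simp add: cmp_assoc' mor_iff idn_cmp)
  then show ?thesis using etri_middle_iso[OF t' i, of "c \<cdot> y"] m gx by (simp add: arr_simps)
qed

text \<open>The biproduct structure is transported along the isomorphism with the standard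
  realization of zero, so that the given \<open>x\<close> and \<open>y\<close> themselves become an
  inclusion and a projection.\<close>

lemma etri_split:
  assumes t: "etri \<C> A x B y C \<one>\<^bsub>Ext \<C> C A\<^esub>"
  shows "\<exists>S. is_biproduct \<C> A C S \<and> bobj S = B \<and> in1 S = x \<and> pr2 S = y"
proof -
  obtain S where S: "is_biproduct \<C> A C S" using has_biproducts by blast
  obtain b where b: "iso_mor \<C> (bobj S) B b" "b \<cdot> in1 S = x" "y \<cdot> b = pr2 S"
    using etri_unique[OF realz_zero[OF S] t] by blast
  obtain g where g: "b \<in> Mor \<C> (bobj S) B" "g \<in> Mor \<C> B (bobj S)" "g \<cdot> b = Idn \<C> (bobj S)" "b \<cdot> g = Idn \<C> B"
    using b(1) by (rule iso_morE)
  let ?T = "\<lparr>bobj = B, in1 = x, in2 = b \<cdot> in2 S, pr1 = pr1 S \<cdot> g, pr2 = y\<rparr>"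
  note m = etriD[OF t] g(1,2)[unfolded mor_iff]
  have y: "y = pr2 S \<cdot> g" unfolding b(3)[symmetric] using m g by (simp add: cmp_assoc' idn_cmp)
  have gb: "g \<cdot> (b \<cdot> z) = z" if "arr z" "tgt z = bobj S" for z
    using cmp_eq_extend[OF g(3), of z] m that by (simp add: idn_cmp)
  have sum: "b \<cdot> (((in1 S \<cdot> pr1 S) \<boxplus> (in2 S \<cdot> pr2 S)) \<cdot> g) = Idn \<C> B"
    using m g by (simp add: biprod_simps[OF S] idn_cmp)
  have "is_biproduct \<C> A C ?T"
    unfolding biproduct_iff using m sum gb
    by (simp add: b(2)[symmetric] y biprod_simps[OF S] cat_simps del: biprod_eqs(5)[OF S])
  then show ?thesis by (intro exI[of _ ?T]) simp
qed

text \<open>(ET4) for the inclusion of \<open>A\<close> into \<open>A \<oplus> L\<close> followed by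
  \<open>n\<close>. The cone \<open>E\<close> it produces sits in a triangle realizing the
  pushforward of \<open>\<nu>\<close> along \<open>pr2\<close>, as \<open>H\<close> does, so
  \<open>E\<close> and \<open>H\<close> are isomorphic and \<open>H\<close> can be put in place of
  \<open>E\<close>.\<close>

lemma etri_pullback_half:
  assumes S: "is_biproduct \<C> A L S" and t: "etri \<C> (bobj S) n T w C \<nu>"
    and l: "etri \<C> L l H c C (push \<C> C (pr2 S) \<nu>)"
  shows "\<exists>p. etri \<C> A (n \<cdot> in1 S) T p H (pull \<C> A c (push \<C> C (pr1 S) \<nu>)) \<and>
    p \<cdot> n = l \<cdot> pr2 S \<and> c \<cdot> p = w"
proof -
  note b = biprod_simps[OF S]
  obtain E h' d e \<delta>'' where E: "etri \<C> A (n \<cdot> in1 S) T h' E \<delta>''" "etri \<C> L d E e C (push \<C> C (pr2 S) \<nu>)"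
    "h' \<cdot> n = d \<cdot> pr2 S" "e \<cdot> h' = w" "push \<C> E (in1 S) \<delta>'' = pull \<C> (bobj S) e \<nu>"
    using ET4[OF realz_zero[OF S] t] by blast
  obtain i where "iso_mor \<C> E H i" and i: "i \<cdot> d = l" "c \<cdot> i = e"
    using etri_unique[OF E(2) l] by blast
  then obtain j where j: "i \<in> Mor \<C> E H" "j \<in> Mor \<C> H E" "j \<cdot> i = Idn \<C> E" "i \<cdot> j = Idn \<C> H"
    by (blast elim: iso_morE)
  note m = etriD[OF t] etriD[OF l] etriD[OF E(1)] etriD[OF E(2)] j(1,2)[unfolded mor_iff]
  have ej: "e \<cdot> j = c" unfolding i(2)[symmetric] using m j by (simp add: cmp_assoc' idn_cmp)
  \<comment> \<open>(ET4) determines \<delta>'' only after pushing along \<open>in1\<close>; pushing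
    back along \<open>pr1\<close> recovers it, since \<open>pr1 S \<cdot> in1 S\<close> is the
    identity.\<close>
  have "\<delta>'' = push \<C> E (pr1 S) (push \<C> E (in1 S) \<delta>'')"
    using m b by (simp add: ext_map_cmp' idn_arr idn_cmp ext_map_idn)
  also have "\<dots> = ext_map \<C> e (pr1 S) \<nu>"
    unfolding E(5) using m b by (simp add: ext_map_cmp' idn_arr idn_cmp)
  finally have "pull \<C> A j \<delta>'' = ext_map \<C> c (pr1 S) \<nu>"
    using m b ej by (simp add: ext_map_cmp' idn_arr idn_cmp)
  also have "\<dots> = pull \<C> A c (push \<C> C (pr1 S) \<nu>)"
    using m b by (simp add: ext_map_cmp' idn_arr idn_cmp)
  finally have "etri \<C> A (n \<cdot> in1 S) T (i \<cdot> h') H (pull \<C> A c (push \<C> C (pr1 S) \<nu>))"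
    using etri_end_iso[OF E(1) j] by simp
  moreover have "(i \<cdot> h') \<cdot> n = l \<cdot> pr2 S"
    using m b E(3) cmp_eq_extend[OF i(1), of "pr2 S"] by (simp add: cmp_assoc')
  moreover have "c \<cdot> (i \<cdot> h') = w"
    using m E(4) cmp_eq_extend[OF i(2), of h'] by simp
  ultimately show ?thesis by blast
qed

text \<open>
  The pullback of two deflations with the same target: realize \<open>in1\<^sub>*\<delta> + in2\<^sub>*\<kappa>\<close> and apply (ET4) to
  either inclusion into the biproduct \<open>A \<oplus> L\<close>.
\<close>

lemma etri_pullback:
  assumes d: "etri \<C> A x B y C \<delta>" and l: "etri \<C> L l H c C \<kappa>"
  shows "\<exists>T i p j q. etri \<C> A i T p H (pull \<C> A c \<delta>) \<and> etri \<C> L j T q B (pull \<C> L y \<kappa>) \<and>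
    q \<cdot> i = x \<and> p \<cdot> j = l \<and> y \<cdot> q = c \<cdot> p"
proof -
  obtain S where S: "is_biproduct \<C> A L S" using has_biproducts by blast
  note b = biprod_simps[OF S] and m = etriD[OF d] etriD[OF l]
  let ?S' = "biprod_swap S"
  interpret E: comm_group "Ext \<C> C (bobj S)" by (rule ext_group)
  interpret EA: comm_group "Ext \<C> C A" by (rule ext_group)
  interpret EL: comm_group "Ext \<C> C L" by (rule ext_group)
  have c: "push \<C> C (in1 S) \<delta> \<in> carrier (Ext \<C> C (bobj S))" "push \<C> C (in2 S) \<kappa> \<in> carrier (Ext \<C> C (bobj S))"
    using m b by (auto intro!: ext_closed simp: arr_simps)
  define \<nu> where "\<nu> = push \<C> C (in1 S) \<delta> \<otimes>\<^bsub>Ext \<C> C (bobj S)\<^esub> push \<C> C (in2 S) \<kappa>"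
  have \<nu>: "\<nu> \<in> carrier (Ext \<C> C (bobj S))" using c by (simp add: \<nu>_def)
  \<comment> \<open>The mixed terms vanish because \<open>pr1\<close> kills \<open>in2\<close> and
    \<open>pr2\<close> kills \<open>in1\<close>; the sum was formed so as to have \<delta> and
    \<kappa> as its two components.\<close>
  have pr: "push \<C> C (pr1 S) \<nu> = \<delta>" "push \<C> C (pr2 S) \<nu> = \<kappa>"
    using c m b ext_map_zero_right[of "Idn \<C> C" C C \<kappa> L A] ext_map_zero_right[of "Idn \<C> C" C C \<delta> A L]
      ext_map_mult[of "Idn \<C> C" C C "pr1 S" "bobj S" A] ext_map_mult[of "Idn \<C> C" C C "pr2 S" "bobj S" L]
    by (simp_all add: \<nu>_def ext_map_cmp' arr_simps idn_cmp ext_map_idn)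
  obtain n T w where t: "etri \<C> (bobj S) n T w C \<nu>" using etri_exists[OF \<nu>] by blast
  note m = m etriD[OF t]
  obtain p where p: "etri \<C> A (n \<cdot> in1 S) T p H (pull \<C> A c \<delta>)" "p \<cdot> n = l \<cdot> pr2 S" "c \<cdot> p = w"
    using etri_pullback_half[OF S t, of l H c] l pr by auto
  obtain q where q: "etri \<C> L (n \<cdot> in2 S) T q B (pull \<C> L y \<kappa>)" "q \<cdot> n = x \<cdot> pr1 S" "y \<cdot> q = w"
    using etri_pullback_half[OF biprod_swap[OF S], of n T w C \<nu> x B y] t d pr by (auto simp: biprod_swap_def)
  note m = m etriD[OF p(1)] etriD[OF q(1)]
  have "q \<cdot> (n \<cdot> in1 S) = x" "p \<cdot> (n \<cdot> in2 S) = l"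
    using cmp_eq_extend[OF q(2), of "in1 S"] cmp_eq_extend[OF p(2), of "in2 S"] m b
    by (simp_all add: cmp_assoc' idn_cmp)
  then show ?thesis using p q by (metis)
qed

section \<open>Sums and the one-step horseshoe\<close>

lemma hom_exact_from_biproduct:
  assumes S: "is_biproduct \<C> P Q S" and t: "etri \<C> A x B y C \<delta>"
    and "hom_exact_from \<C> P A x B y C" "hom_exact_from \<C> Q A x B y C"
  shows "hom_exact_from \<C> (bobj S) A x B y C"
proof -
  note b = biprod_simps[OF S] and m = etriD[OF t]
  note P = assms(3)[unfolded hom_exact_from_iff[OF t]] and Q = assms(4)[unfolded hom_exact_from_iff[OF t]]
  have "u = zero_mor \<C> (bobj S) A" if u: "u \<in> Mor \<C> (bobj S) A" "x \<cdot> u = zero_mor \<C> (bobj S) B" for u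
  proof (rule biprod_eq_from[OF S])
    have z: "x \<cdot> (u \<cdot> in1 S) = zero_mor \<C> P B" "x \<cdot> (u \<cdot> in2 S) = zero_mor \<C> Q B"
      using cmp_eq_extend[OF u(2), of "in1 S"] cmp_eq_extend[OF u(2), of "in2 S"] u(1) m b
      by (simp_all add: mor_iff zero_cmp)
    have "u \<cdot> in1 S \<in> Mor \<C> P A" "u \<cdot> in2 S \<in> Mor \<C> Q A" using u(1) b by (simp_all add: arr_simps)
    then have "u \<cdot> in1 S = zero_mor \<C> P A" "u \<cdot> in2 S = zero_mor \<C> Q A" using P Q z by blast+
    then show "u \<cdot> in1 S = zero_mor \<C> (bobj S) A \<cdot> in1 S" "u \<cdot> in2 S = zero_mor \<C> (bobj S) A \<cdot> in2 S"
      using b by (simp_all add: zero_cmp)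
  qed (use u in \<open>simp_all add: arr_simps\<close>)
  moreover have "\<exists>t \<in> Mor \<C> (bobj S) B. y \<cdot> t = v" if v: "v \<in> Mor \<C> (bobj S) C" for v
  proof -
    have "v \<cdot> in1 S \<in> Mor \<C> P C" "v \<cdot> in2 S \<in> Mor \<C> Q C" using v b by (simp_all add: arr_simps)
    then obtain s t where st: "s \<in> Mor \<C> P B" "y \<cdot> s = v \<cdot> in1 S" "t \<in> Mor \<C> Q B" "y \<cdot> t = v \<cdot> in2 S"
      using P Q by meson
    have "y \<cdot> ((s \<cdot> pr1 S) \<boxplus> (t \<cdot> pr2 S)) = v"
      using st v b m cmp_eq_extend[OF st(2), of "pr1 S"] cmp_eq_extend[OF st(4), of "pr2 S"]
        biprod_split_from[OF S, of v]
      by (simp add: cat_simps)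
    moreover have "(s \<cdot> pr1 S) \<boxplus> (t \<cdot> pr2 S) \<in> Mor \<C> (bobj S) B" using st b by (simp add: arr_simps)
    ultimately show ?thesis by blast
  qed
  ultimately show ?thesis unfolding hom_exact_from_iff[OF t] by blast
qed

lemma hom_exact_into_sum:
  assumes t: "etri \<C> A x B y C \<delta>" and t': "etri \<C> A' x' B' y' C' \<delta>'"
    and SA: "is_biproduct \<C> A A' SA" and SB: "is_biproduct \<C> B B' SB" and SC: "is_biproduct \<C> C C' SC"
    and "hom_exact_into \<C> W A x B y C" "hom_exact_into \<C> W A' x' B' y' C'"
  shows "hom_exact_into \<C> W (bobj SA) (mor_sum \<C> SA SB x x') (bobj SB) (mor_sum \<C> SB SC y y') (bobj SC)"
proof -
  note b = biprod_simps[OF SA] biprod_simps[OF SB] biprod_simps[OF SC] and m = etriD[OF t] etriD[OF t']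
  note P = assms(6)[unfolded hom_exact_into_iff[OF t]] and Q = assms(7)[unfolded hom_exact_into_iff[OF t']]
  note T = realz_sum[OF t t' SA SB SC]
  define X where "X = mor_sum \<C> SA SB x x'"
  define Y where "Y = mor_sum \<C> SB SC y y'"
  have X: "arr X" "src X = bobj SA" "tgt X = bobj SB" "X \<cdot> in1 SA = in1 SB \<cdot> x" "X \<cdot> in2 SA = in2 SB \<cdot> x'"
    using mor_sum_simps[OF SA SB, of x x'] m by (simp_all add: X_def mor_iff)
  have Y: "arr Y" "src Y = bobj SB" "tgt Y = bobj SC" "Y \<cdot> in1 SB = in1 SC \<cdot> y" "Y \<cdot> in2 SB = in2 SC \<cdot> y'"
    using mor_sum_simps[OF SB SC, of y y'] m by (simp_all add: Y_def mor_iff)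
  have "u = zero_mor \<C> (bobj SC) W" if u: "u \<in> Mor \<C> (bobj SC) W" "u \<cdot> Y = zero_mor \<C> (bobj SB) W" for u
  proof (rule biprod_eq_from[OF SC])
    have z: "(u \<cdot> in1 SC) \<cdot> y = zero_mor \<C> B W" "(u \<cdot> in2 SC) \<cdot> y' = zero_mor \<C> B' W"
      using cmp_eq_extend[OF u(2), of "in1 SB"] cmp_eq_extend[OF u(2), of "in2 SB"] u(1) m b Y
      by (simp_all add: mor_iff zero_cmp cmp_assoc')
    have "u \<cdot> in1 SC \<in> Mor \<C> C W" "u \<cdot> in2 SC \<in> Mor \<C> C' W" using u(1) b by (simp_all add: arr_simps)
    then have "u \<cdot> in1 SC = zero_mor \<C> C W" "u \<cdot> in2 SC = zero_mor \<C> C' W" using P Q z by blast+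
    then show "u \<cdot> in1 SC = zero_mor \<C> (bobj SC) W \<cdot> in1 SC" "u \<cdot> in2 SC = zero_mor \<C> (bobj SC) W \<cdot> in2 SC"
      using b by (simp_all add: zero_cmp)
  qed (use u in \<open>simp_all add: arr_simps\<close>)
  moreover have "\<exists>t \<in> Mor \<C> (bobj SB) W. t \<cdot> X = v" if v: "v \<in> Mor \<C> (bobj SA) W" for v
  proof -
    have "v \<cdot> in1 SA \<in> Mor \<C> A W" "v \<cdot> in2 SA \<in> Mor \<C> A' W" using v b by (simp_all add: arr_simps)
    then obtain s t where st: "s \<in> Mor \<C> B W" "s \<cdot> x = v \<cdot> in1 SA" "t \<in> Mor \<C> B' W" "t \<cdot> x' = v \<cdot> in2 SA"
      using P Q by meson
    let ?w = "(s \<cdot> pr1 SB) \<boxplus> (t \<cdot> pr2 SB)"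
    have w: "?w \<in> Mor \<C> (bobj SB) W" using st b by (simp add: arr_simps)
    have "?w \<cdot> X = v"
    proof (rule biprod_eq_from[OF SA])
      show "?w \<cdot> X \<cdot> in1 SA = v \<cdot> in1 SA" "?w \<cdot> X \<cdot> in2 SA = v \<cdot> in2 SA"
        using st v b m X by (simp_all add: cat_simps)
    qed (use w v X in \<open>simp_all add: mor_iff cmp_arr\<close>)
    then show ?thesis using w by blast
  qed
  ultimately show ?thesis
    unfolding X_def[symmetric] Y_def[symmetric] hom_exact_into_iff[OF T[folded X_def Y_def]] by blast
qed

end

section \<open>Sums of Gorenstein projectives, and triangles exact under them\<close>

context proper_class
begin

lemma xi_projectives_biproduct:
  assumes "is_biproduct \<C> P Q S" "P \<in> xi_projectives \<C> \<xi>" "Q \<in> xi_projectives \<C> \<xi>"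
  shows "bobj S \<in> xi_projectives \<C> \<xi>"
  using assms(2,3) unfolding xi_projectives_def
  by (blast intro: hom_exact_from_biproduct[OF assms(1) xi_etri])

text \<open>The degreewise sum of two complete resolutions is one again. Membership is obtained for
  the sum of syzygies chosen in this construction, hence the existential quantifier over the
  biproduct.\<close>

lemma GProj_biproduct:
  assumes "G \<in> GProj \<C> \<xi>" "H \<in> GProj \<C> \<xi>"
  shows "\<exists>S. is_biproduct \<C> G H S \<and> bobj S \<in> GProj \<C> \<xi>"
proof -
  obtain X d K g f \<delta> n where 1: "complete_xi_projective_resolution \<C> \<xi> X d K g f \<delta>" "G = K n"
    using assms(1) by (auto simp: GProj_def)
  obtain X' d' K' g' f' \<delta>' n' where 2: "complete_xi_projective_resolution \<C> \<xi> X' d' K' g' f' \<delta>'" "H = K' n'"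
    using assms(2) by (auto simp: GProj_def)
  \<comment> \<open>\<open>G\<close> and \<open>H\<close> may occur as syzygies in different
    degrees; the shift aligns degree \<open>n\<close> of the first resolution with degree
    \<open>n'\<close> of the second.\<close>
  define s where "s = (\<lambda>i. i + (n' - n))"
  have s: "s n = n'" "s (i + 1) = s i + 1" for i by (simp_all add: s_def)
  define SX where "SX = (\<lambda>i. SOME S. is_biproduct \<C> (X i) (X' (s i)) S)"
  define SK where "SK = (\<lambda>i. SOME S. is_biproduct \<C> (K i) (K' (s i)) S)"
  have SX: "is_biproduct \<C> (X i) (X' (s i)) (SX i)" for i
    unfolding SX_def by (rule someI_ex[OF has_biproducts])
  have SK: "is_biproduct \<C> (K i) (K' (s i)) (SK i)" for i
    unfolding SK_def by (rule someI_ex[OF has_biproducts])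
  have SK1: "is_biproduct \<C> (K (i + 1)) (K' (s i + 1)) (SK (i + 1))" for i
    using SK[of "i + 1"] by (simp add: s)
  let ?g = "\<lambda>i. mor_sum \<C> (SK (i + 1)) (SX i) (g i) (g' (s i))"
  let ?f = "\<lambda>i. mor_sum \<C> (SX i) (SK i) (f i) (f' (s i))"
  let ?d = "\<lambda>i. ext_sum \<C> (SK i) (SK (i + 1)) (\<delta> i) (\<delta>' (s i))"
  have t: "\<xi> (K (i + 1)) (g i) (X i) (f i) (K i) (\<delta> i)"
    "\<xi> (K' (s i + 1)) (g' (s i)) (X' (s i)) (f' (s i)) (K' (s i)) (\<delta>' (s i))" for i
    using 1(1) 2(1) by (simp_all add: complete_xi_projective_resolution_def xi_exact_complex_def)
  have "complete_xi_projective_resolution \<C> \<xi> (\<lambda>i. bobj (SX i)) (\<lambda>i. ?g (i - 1) \<cdot> ?f i)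
      (\<lambda>i. bobj (SK i)) ?g ?f ?d"
    unfolding complete_xi_projective_resolution_def xi_exact_complex_def
  proof (intro conjI allI ballI)
    fix i
    show "\<xi> (bobj (SK (i + 1))) (?g i) (bobj (SX i)) (?f i) (bobj (SK i)) (?d i)"
      by (rule xi_sum[OF t SK1 SX SK])
    show "bobj (SX i) \<in> xi_projectives \<C> \<xi>"
      by (rule xi_projectives_biproduct[OF SX]) (use 1(1) 2(1) in \<open>auto simp: complete_xi_projective_resolution_def\<close>)
    fix W assume "W \<in> xi_projectives \<C> \<xi>"
    then show "hom_exact_into \<C> W (bobj (SK (i + 1))) (?g i) (bobj (SX i)) (?f i) (bobj (SK i))"
      by (intro hom_exact_into_sum[OF xi_etri[OF t(1)] xi_etri[OF t(2)] SK1 SX SK])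
        (use 1(1) 2(1) in \<open>auto simp: complete_xi_projective_resolution_def\<close>)
  qed (rule refl)
  then have "bobj (SK n) \<in> GProj \<C> \<xi>" unfolding GProj_def by blast
  then show ?thesis using SK[of n] 1(2) 2(2) s(1) by auto
qed

text \<open>The condition satisfied by the given triangle and by every resolution triangle alike; it
  is the invariant under which the horseshoe step can be iterated.\<close>

definition gp_triangle :: "('o, 'm, 'e) tri_class"
  where "gp_triangle A x B y C \<delta> \<longleftrightarrow>
    \<xi> A x B y C \<delta> \<and> (\<forall>W \<in> GProj \<C> \<xi>. hom_exact_from \<C> W A x B y C)"

lemma gp_triangle_iff:
  "gp_triangle A x B y C \<delta> \<longleftrightarrow> \<xi> A x B y C \<delta> \<and>
    (\<forall>W \<in> GProj \<C> \<xi>. (\<forall>u \<in> Mor \<C> W A. x \<cdot> u = zero_mor \<C> W B \<longrightarrow> u = zero_mor \<C> W A) \<and>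
      (\<forall>v \<in> Mor \<C> W C. \<exists>t \<in> Mor \<C> W B. y \<cdot> t = v))"
  unfolding gp_triangle_def using hom_exact_from_iff[OF xi_etri] by blast

text \<open>Add the split triangle Z -> H -> H. With \<open>K\<close> taken as its own sum with
  \<open>Z\<close>, the first term stays \<open>K\<close> on the nose.\<close>

lemma xi_sum_trivial:
  assumes k: "\<xi> K k G a A \<kappa>" and S: "is_biproduct \<C> G H S" and T: "is_biproduct \<C> A H T"
  shows "\<exists>\<epsilon>. \<xi> K (in1 S \<cdot> k) (bobj S) (mor_sum \<C> S T a (Idn \<C> H)) (bobj T) \<epsilon>"
proof -
  obtain Z where Z: "zero_object \<C> Z" using has_zero_object by blast
  note m = etriD[OF xi_etri[OF k]] and R = biprod_zero_right[OF Z, of K]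
  have z: "\<xi> Z (zero_mor \<C> Z H) H (Idn \<C> H) H \<one>\<^bsub>Ext \<C> H Z\<^esub>"
    by (rule xi_split[OF etri_split_zero_left[OF Z]])
  have "mor_sum \<C> (biprod_zero_right K Z) S k (zero_mor \<C> Z H) = in1 S \<cdot> k"
    using m mor_sum_madd[OF R S, of k "zero_mor \<C> Z H"]
    by (simp add: biprod_zero_right_def biprod_simps[OF S] cat_simps)
  then show ?thesis
    using xi_sum[OF k z R S T] by (auto simp: biprod_zero_right_def)
qed

text \<open>
  Since \<open>c\<close> lifts through \<open>y\<close>, the pullback of \<open>y\<close> and \<open>c\<close> is a biproduct \<open>T = A \<oplus> H\<close>, and (ET4)\<open>\<^sup>o\<^sup>p\<close>
  applied to the deflations \<open>S \<rightarrow> T \<rightarrow> B\<close> gives both triangles.  The first one lies in \<open>\<xi>\<close> by saturation: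
  pulled back along \<open>T \<rightarrow> B\<close> it becomes a cobase change of \<open>K \<rightarrow> S \<rightarrow> T\<close>.
\<close>

lemma horseshoe_step:
  assumes dl: "gp_triangle A x B y C \<delta>" and kp: "gp_triangle K k G a A \<kappa>"
    and lm: "gp_triangle L l H c C \<mu>" and H: "H \<in> GProj \<C> \<xi>" and S: "is_biproduct \<C> G H S"
  shows "\<exists>M m b \<epsilon> x' y' \<delta>'. gp_triangle M m (bobj S) b B \<epsilon> \<and> gp_triangle K x' M y' L \<delta>' \<and>
    b \<cdot> in1 S = x \<cdot> a \<and> y \<cdot> b = c \<cdot> pr2 S \<and> m \<cdot> x' = in1 S \<cdot> k \<and> pr2 S \<cdot> m = l \<cdot> y'"
proof -
  note dl' = dl[unfolded gp_triangle_iff] and kp' = kp[unfolded gp_triangle_iff] and lm' = lm[unfolded gp_triangle_iff]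
  have et: "etri \<C> A x B y C \<delta>" "etri \<C> K k G a A \<kappa>" "etri \<C> L l H c C \<mu>"
    using dl' kp' lm' xi_etri by blast+
  note m = etriD[OF et(1)] etriD[OF et(2)] etriD[OF et(3)]
  obtain h where h: "h \<in> Mor \<C> H B" "y \<cdot> h = c"
    using dl' H m by (force simp: mor_iff)
  have "pull \<C> A c \<delta> = \<one>\<^bsub>Ext \<C> H A\<^esub>" using etri_lift_pull_zero[OF et(1) h(1)] h(2) by simp
  then obtain T0 i p j q where
    T0: "etri \<C> A i T0 p H \<one>\<^bsub>Ext \<C> H A\<^esub>" and j: "etri \<C> L j T0 q B (pull \<C> L y \<mu>)"
    and e: "q \<cdot> i = x" "p \<cdot> j = l" "y \<cdot> q = c \<cdot> p"
    using etri_pullback[OF et(1,3)] by metis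
  obtain T where T: "is_biproduct \<C> A H T" and T': "bobj T = T0" "in1 T = i" "pr2 T = p"
    using etri_split[OF T0] by blast
  note m = m etriD[OF j] and bS = biprod_simps[OF S] and bT = biprod_simps[OF T]
  define g where "g = mor_sum \<C> S T a (Idn \<C> H)"
  have g: "arr g" "src g = bobj S" "tgt g = bobj T" "g \<cdot> in1 S = in1 T \<cdot> a" "g \<cdot> in2 S = in2 T"
    "pr1 T \<cdot> g = a \<cdot> pr1 S" "pr2 T \<cdot> g = pr2 S"
    using mor_sum_simps[OF S T, of a "Idn \<C> H"] m bS bT by (simp_all add: g_def arr_simps idn_cmp)
  obtain \<epsilon>0 where s: "\<xi> K (in1 S \<cdot> k) (bobj S) g (bobj T) \<epsilon>0"
    using xi_sum_trivial[OF _ S T] kp' unfolding g_def by blast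
  obtain M n d e' \<epsilon> where
    M: "etri \<C> M n (bobj S) (q \<cdot> g) B \<epsilon>" "etri \<C> K e' M d L (pull \<C> K j \<epsilon>0)"
      "g \<cdot> n = j \<cdot> d" "n \<cdot> e' = in1 S \<cdot> k" "pull \<C> M q \<epsilon> = push \<C> (bobj T) e' \<epsilon>0"
    using ET4_op[OF j, of K "in1 S \<cdot> k" "bobj S" g \<epsilon>0] xi_etri[OF s] T' by blast
  note m = m etriD[OF M(1)] etriD[OF M(2)]
  have xi2: "\<xi> K e' M d L (pull \<C> K j \<epsilon>0)"
    by (rule xi_base_change[OF s _ M(2)]) (use m T' in \<open>simp add: mor_iff\<close>)
  have xi1: "\<xi> M n (bobj S) (q \<cdot> g) B \<epsilon>"
  proof -
    have xj: "\<xi> L j T0 q B (pull \<C> L y \<mu>)"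
      by (rule xi_base_change[OF _ _ j]) (use lm' m in \<open>auto simp: mor_iff\<close>)
    have c: "push \<C> (bobj T) e' \<epsilon>0 \<in> carrier (Ext \<C> (bobj T) M)"
      using xi_etri[OF s] m by (auto intro!: ext_closed simp: etri_def arr_simps)
    then obtain u V v where uv: "etri \<C> M u V v (bobj T) (push \<C> (bobj T) e' \<epsilon>0)"
      using etri_exists by blast
    have "\<xi> M u V v (bobj T) (push \<C> (bobj T) e' \<epsilon>0)"
      by (rule xi_cobase_change[OF s _ uv]) (use m in \<open>simp add: mor_iff\<close>)
    then show ?thesis using xi_saturated[OF M(1) xj] M(5) T' by auto
  qed
  \<comment> \<open>On the summand \<open>A\<close> the map \<open>q\<close> is \<open>x\<close>,
    and on \<open>H\<close> it lies over \<open>c\<close>. Lifting \<open>y \<cdot> v\<close>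
    through \<open>c\<close> corrects \<open>v\<close> by a map through \<open>H\<close>; the
    remainder is killed by \<open>y\<close>, so it comes from \<open>A\<close>.\<close>
  have lift_q: "\<exists>t \<in> Mor \<C> W (bobj T). q \<cdot> t = v" if W: "W \<in> GProj \<C> \<xi>" and v: "v \<in> Mor \<C> W B" for W v
  proof -
    have "y \<cdot> v \<in> Mor \<C> W C" using v m by (simp add: arr_simps)
    then obtain t where t: "t \<in> Mor \<C> W H" "c \<cdot> t = y \<cdot> v" using lm' W by blast
    let ?r = "v \<boxplus> \<boxminus> (q \<cdot> (in2 T \<cdot> t))"
    have "y \<cdot> (q \<cdot> (in2 T \<cdot> t)) = y \<cdot> v"
      using cmp_eq_extend[OF e(3), of "in2 T \<cdot> t"] t m bT T' by (simp add: mor_iff cmp_arr cmp_assoc')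
    then have "y \<cdot> ?r = zero_mor \<C> W C" and r: "?r \<in> Mor \<C> W B"
      using t v m bT T' by (simp_all add: cat_simps)
    then obtain a0 where a0: "a0 \<in> Mor \<C> W A" "x \<cdot> a0 = ?r"
      using etri_exact_from[OF et(1)] by blast
    have "q \<cdot> (in1 T \<cdot> a0) = ?r"
      using cmp_eq_extend[OF e(1), of a0] a0 m bT T' by (simp add: mor_iff)
    then have "q \<cdot> ((in1 T \<cdot> a0) \<boxplus> (in2 T \<cdot> t)) = v"
      using t v a0 m bT T' by (simp add: cat_simps)
    moreover have "(in1 T \<cdot> a0) \<boxplus> (in2 T \<cdot> t) \<in> Mor \<C> W (bobj T)" using a0 t bT by (simp add: arr_simps)
    ultimately show ?thesis by blast
  qed
  have lift_g: "\<exists>t \<in> Mor \<C> W (bobj S). g \<cdot> t = v" if W: "W \<in> GProj \<C> \<xi>" and v: "v \<in> Mor \<C> W (bobj T)" for W v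
  proof -
    have "pr1 T \<cdot> v \<in> Mor \<C> W A" using v bT by (simp add: arr_simps)
    then obtain s where s: "s \<in> Mor \<C> W G" "a \<cdot> s = pr1 T \<cdot> v" using kp' W by blast
    let ?t = "(in1 S \<cdot> s) \<boxplus> (in2 S \<cdot> (pr2 T \<cdot> v))"
    have "g \<cdot> ?t = v"
      using s v g bT bS m cmp_eq_extend[OF g(4), of s] cmp_eq_extend[OF g(5), of "pr2 T \<cdot> v"]
      by (simp add: cat_simps biprod_split_into[OF T])
    moreover have "?t \<in> Mor \<C> W (bobj S)" using s v bS bT by (simp add: arr_simps)
    ultimately show ?thesis by blast
  qed
  have inj_j: "u = zero_mor \<C> W L" if "W \<in> GProj \<C> \<xi>" "u \<in> Mor \<C> W L" "j \<cdot> u = zero_mor \<C> W (bobj T)" for W u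
  proof -
    have "l \<cdot> u = zero_mor \<C> W H"
      using cmp_eq_extend[OF e(2), of u] that m bT T' by (simp add: mor_iff cmp_zero)
    then show ?thesis using lm' that by blast
  qed
  have inj_e: "u = zero_mor \<C> W K" if "W \<in> GProj \<C> \<xi>" "u \<in> Mor \<C> W K" "e' \<cdot> u = zero_mor \<C> W M" for W u
  proof -
    have "in1 S \<cdot> (k \<cdot> u) = zero_mor \<C> W (bobj S)"
      using cmp_eq_extend[OF M(4), of u] that m bS by (simp add: mor_iff cmp_zero cmp_assoc')
    then have "pr1 S \<cdot> (in1 S \<cdot> (k \<cdot> u)) = zero_mor \<C> W G" using bS by (simp add: cmp_zero)
    then have "k \<cdot> u = zero_mor \<C> W G" using bS m that by (simp add: mor_iff cmp_arr)
    then show ?thesis using kp' that by blast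
  qed
  \<comment> \<open>A four lemma chase: \<open>n \<cdot> u = 0\<close> forces
    \<open>d \<cdot> u = 0\<close> because \<open>j\<close> is injective on such maps, so
    \<open>u\<close> comes from \<open>K\<close>, where the composite with \<open>n\<close> is
    \<open>in1 S \<cdot> k\<close>, again injective.\<close>
  have inj_n: "u = zero_mor \<C> W M" if W: "W \<in> GProj \<C> \<xi>" "u \<in> Mor \<C> W M" "n \<cdot> u = zero_mor \<C> W (bobj S)" for W u
  proof -
    have "j \<cdot> (d \<cdot> u) = zero_mor \<C> W (bobj T)"
      using cmp_eq_extend[OF M(3), of u] that m g by (simp add: mor_iff cmp_zero cmp_assoc')
    then have "d \<cdot> u = zero_mor \<C> W L" using inj_j[of W "d \<cdot> u"] W m by (simp add: arr_simps)
    then obtain v where v: "v \<in> Mor \<C> W K" "e' \<cdot> v = u"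
      using etri_exact_from[OF M(2) W(2)] by blast
    have "in1 S \<cdot> (k \<cdot> v) = zero_mor \<C> W (bobj S)"
      using cmp_eq_extend[OF M(4), of v] v W(3) m bS by (simp add: mor_iff cmp_zero cmp_assoc')
    then have "pr1 S \<cdot> (in1 S \<cdot> (k \<cdot> v)) = zero_mor \<C> W G" using bS by (simp add: cmp_zero)
    then have "k \<cdot> v = zero_mor \<C> W G" using bS m v by (simp add: mor_iff cmp_arr)
    then have "v = zero_mor \<C> W K" using kp' v W by blast
    then show ?thesis using v m by (simp add: cmp_zero)
  qed
  have lift_qg: "\<exists>t \<in> Mor \<C> W (bobj S). (q \<cdot> g) \<cdot> t = v" if W: "W \<in> GProj \<C> \<xi>" and v: "v \<in> Mor \<C> W B" for W v
  proof -
    obtain t where t: "t \<in> Mor \<C> W (bobj T)" "q \<cdot> t = v" using lift_q[OF W v] by blast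
    obtain s where "s \<in> Mor \<C> W (bobj S)" "g \<cdot> s = t" using lift_g[OF W t(1)] by blast
    then show ?thesis using t g m T' by (intro bexI[of _ s]) (auto simp: mor_iff cmp_assoc')
  qed
  \<comment> \<open>Lift \<open>j \<cdot> v\<close> through \<open>g\<close>. Since
    \<open>q \<cdot> j = 0\<close>, the lift factors through \<open>n\<close>, say as
    \<open>n \<cdot> s\<close>. Then \<open>d \<cdot> s\<close> and \<open>v\<close> agree after
    composing with \<open>j\<close>, and \<open>inj_j\<close> cancels \<open>j\<close>.\<close>
  have lift_d: "\<exists>t \<in> Mor \<C> W M. d \<cdot> t = v" if W: "W \<in> GProj \<C> \<xi>" and v: "v \<in> Mor \<C> W L" for W v
  proof -
    have jv: "j \<cdot> v \<in> Mor \<C> W (bobj T)" using v m T' by (simp add: arr_simps)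
    obtain t where t: "t \<in> Mor \<C> W (bobj S)" "g \<cdot> t = j \<cdot> v" using lift_g[OF W jv] by blast
    have "(q \<cdot> g) \<cdot> t = (q \<cdot> j) \<cdot> v" using t v g m T' by (simp add: mor_iff cmp_assoc')
    then have "(q \<cdot> g) \<cdot> t = zero_mor \<C> W B"
      using etri_cmp_zero[OF j] v by (simp add: mor_iff zero_cmp)
    then obtain s where s: "s \<in> Mor \<C> W M" "n \<cdot> s = t" using etri_exact_from[OF M(1) t(1)] by blast
    have js: "j \<cdot> (d \<cdot> s) = j \<cdot> v"
      using cmp_eq_extend[OF M(3), of s] s t m g by (simp add: mor_iff cmp_assoc')
    have "(d \<cdot> s) \<boxplus> \<boxminus> v = zero_mor \<C> W L"
      by (rule inj_j[OF W]) (use js s v m T' in \<open>simp_all add: cat_simps\<close>)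
    then have "d \<cdot> s = v" using madd_eq_iff[of "d \<cdot> s" v] s v m by (simp add: arr_simps)
    then show ?thesis using s by blast
  qed
  have "gp_triangle M n (bobj S) (q \<cdot> g) B \<epsilon>" unfolding gp_triangle_iff using xi1 inj_n lift_qg by blast
  moreover have "gp_triangle K e' M d L (pull \<C> K j \<epsilon>0)" unfolding gp_triangle_iff using xi2 inj_e lift_d by blast
  moreover have "(q \<cdot> g) \<cdot> in1 S = x \<cdot> a"
    using g m bS bT T' cmp_eq_extend[OF e(1), of a] by (simp add: cmp_assoc')
  moreover have "y \<cdot> (q \<cdot> g) = c \<cdot> pr2 S"
    using cmp_eq_extend[OF e(3), of g] g m bT T' by (simp add: cmp_assoc')
  moreover have "pr2 S \<cdot> n = l \<cdot> d"
    using cmp_eq_extend[OF g(7), of n] cmp_eq_extend[OF e(2), of d] M(3) g m bT bS T' by simp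
  ultimately show ?thesis using M(4) by blast
qed

end

section \<open>Resolutions and comparison of lifts\<close>

context additive_category
begin

text \<open>Indexed so that \<open>rdif R n\<close> goes from \<open>robj R n\<close> to \<open>aug A R n\<close>.\<close>

definition aug :: "'o \<Rightarrow> ('o, 'm) resolution \<Rightarrow> nat \<Rightarrow> 'o"
  where "aug A R n = (case n of 0 \<Rightarrow> A | Suc m \<Rightarrow> robj R m)"

definition aug_complex :: "'o \<Rightarrow> ('o, 'm) resolution \<Rightarrow> bool"
  where "aug_complex A R \<longleftrightarrow>
    (\<forall>n. rdif R n \<in> Mor \<C> (robj R n) (aug A R n) \<and>
      rdif R n \<cdot> rdif R (Suc n) = zero_mor \<C> (robj R (Suc n)) (aug A R n))"

text \<open>Exactly what comparison of lifts asks of the target resolution: objects of \<W> behave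
  as if they were projective with respect to it. Triangles and syzygies no longer appear.\<close>

definition hom_acyclic :: "'o set \<Rightarrow> 'o \<Rightarrow> ('o, 'm) resolution \<Rightarrow> bool"
  where "hom_acyclic \<W> A R \<longleftrightarrow> aug_complex A R \<and>
    (\<forall>W \<in> \<W>. (\<forall>v \<in> Mor \<C> W A. \<exists>t \<in> Mor \<C> W (robj R 0). rdif R 0 \<cdot> t = v) \<and>
      (\<forall>n. \<forall>t \<in> Mor \<C> W (robj R n). rdif R n \<cdot> t = zero_mor \<C> W (aug A R n) \<longrightarrow>
        (\<exists>s \<in> Mor \<C> W (robj R (Suc n)). rdif R (Suc n) \<cdot> s = t)))"

lemma aug_simps [simp]: "aug A R 0 = A" "aug A R (Suc n) = robj R n"
  by (simp_all add: aug_def)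

lemma aug_complexD:
  assumes "aug_complex A R"
  shows "arr (rdif R n)" "src (rdif R n) = robj R n" "tgt (rdif R n) = aug A R n"
    "rdif R n \<cdot> rdif R (Suc n) = zero_mor \<C> (robj R (Suc n)) (aug A R n)"
    "\<lbrakk>arr z; tgt z = robj R (Suc n)\<rbrakk> \<Longrightarrow> rdif R n \<cdot> (rdif R (Suc n) \<cdot> z) = zero_mor \<C> (src z) (aug A R n)"
proof -
  have m: "arr (rdif R k)" "src (rdif R k) = robj R k" "tgt (rdif R k) = aug A R k" for k
    using assms unfolding aug_complex_def mor_iff by blast+
  have z: "rdif R n \<cdot> rdif R (Suc n) = zero_mor \<C> (robj R (Suc n)) (aug A R n)"
    using assms unfolding aug_complex_def by blast
  show "arr (rdif R n)" "src (rdif R n) = robj R n" "tgt (rdif R n) = aug A R n"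
    "rdif R n \<cdot> rdif R (Suc n) = zero_mor \<C> (robj R (Suc n)) (aug A R n)" by (fact m z)+
  show "rdif R n \<cdot> (rdif R (Suc n) \<cdot> z) = zero_mor \<C> (src z) (aug A R n)"
    if "arr z" "tgt z = robj R (Suc n)"
    using that m cmp_eq_extend[OF z, of z] by (simp add: zero_cmp)
qed

lemma hom_acyclicD:
  assumes "hom_acyclic \<W> A R" "W \<in> \<W>"
  shows "v \<in> Mor \<C> W A \<Longrightarrow> \<exists>t \<in> Mor \<C> W (robj R 0). rdif R 0 \<cdot> t = v"
    "\<lbrakk>t \<in> Mor \<C> W (robj R n); rdif R n \<cdot> t = zero_mor \<C> W (aug A R n)\<rbrakk>
      \<Longrightarrow> \<exists>s \<in> Mor \<C> W (robj R (Suc n)). rdif R (Suc n) \<cdot> s = t"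
  using assms unfolding hom_acyclic_def by blast+

lemma lifts_exist:
  assumes R: "aug_complex A R" "\<And>n. robj R n \<in> \<W>" and S: "hom_acyclic \<W> B S" and f: "f \<in> Mor \<C> A B"
  shows "\<exists>F. lifts \<C> R S f F"
proof -
  have S': "aug_complex B S" using S by (simp add: hom_acyclic_def)
  note r = aug_complexD[OF R(1)] and s = aug_complexD[OF S'] and f' = f[unfolded mor_iff]
  \<comment> \<open>The last clause says that \<open>F \<cdot> rdif R (Suc n)\<close> is a cycle,
    which is what allows the next component to be chosen. The augmentation square enters as a clause
    for \<open>n = 0\<close>, since the choice principle only constrains single terms and
    consecutive pairs.\<close>
  let ?P = "\<lambda>n F. F \<in> Mor \<C> (robj R n) (robj S n) \<and> (n = 0 \<longrightarrow> rdif S 0 \<cdot> F = f \<cdot> rdif R 0) \<and>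
    rdif S n \<cdot> (F \<cdot> rdif R (Suc n)) = zero_mor \<C> (robj R (Suc n)) (aug B S n)"
  let ?Q = "\<lambda>n F F'. rdif S (Suc n) \<cdot> F' = F \<cdot> rdif R (Suc n)"
  have "\<exists>F. \<forall>n. ?P n (F n) \<and> ?Q n (F n) (F (Suc n))"
  proof (rule dependent_nat_choice[where P = ?P and Q = ?Q])
    have "f \<cdot> rdif R 0 \<in> Mor \<C> (robj R 0) B" using f' r[where n=0] by (simp add: arr_simps)
    then obtain F where F: "F \<in> Mor \<C> (robj R 0) (robj S 0)" "rdif S 0 \<cdot> F = f \<cdot> rdif R 0"
      using hom_acyclicD(1)[OF S R(2)] by blast
    then have "rdif S 0 \<cdot> (F \<cdot> rdif R (Suc 0)) = zero_mor \<C> (robj R (Suc 0)) (aug B S 0)"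
      using cmp_eq_extend[OF F(2), of "rdif R (Suc 0)"] f' r[where n=0] r[where n="Suc 0"] s[where n=0]
      by (simp add: mor_iff cmp_assoc' cmp_zero)
    then show "\<exists>F. ?P 0 F" using F by blast
  next
    fix F n assume P: "?P n F"
    then have "F \<cdot> rdif R (Suc n) \<in> Mor \<C> (robj R (Suc n)) (robj S n)" using r by (simp add: arr_simps)
    then obtain F' where F': "F' \<in> Mor \<C> (robj R (Suc n)) (robj S (Suc n))"
        "rdif S (Suc n) \<cdot> F' = F \<cdot> rdif R (Suc n)"
      using hom_acyclicD(2)[OF S R(2)] P by blast
    then have "rdif S (Suc n) \<cdot> (F' \<cdot> rdif R (Suc (Suc n))) = zero_mor \<C> (robj R (Suc (Suc n))) (aug B S (Suc n))"
      using cmp_eq_extend[OF F'(2), of "rdif R (Suc (Suc n))"] P r[where n="Suc n"] r[where n="Suc (Suc n)"] s[where n="Suc n"]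
      by (simp add: mor_iff cmp_assoc' cmp_zero)
    then show "\<exists>F'. ?P (Suc n) F' \<and> ?Q n F F'" using F' by blast
  qed
  then show ?thesis unfolding lifts_def by blast
qed

text \<open>Both families cover the same \<open>f\<close>, so their difference in degree 0 is
  already a cycle over the augmentation. This is why the identity in degree 0 has a single
  term.\<close>

lemma lifts_homotopic:
  assumes R: "aug_complex A R" "\<And>n. robj R n \<in> \<W>" and S: "hom_acyclic \<W> B S" and f: "f \<in> Mor \<C> A B"
    and F: "lifts \<C> R S f F" and G: "lifts \<C> R S f G"
  shows "\<exists>h. (\<forall>n. h n \<in> Mor \<C> (robj R n) (robj S (Suc n))) \<and>
    F 0 \<boxplus> \<boxminus> G 0 = rdif S (Suc 0) \<cdot> h 0 \<and>
    (\<forall>n. F (Suc n) \<boxplus> \<boxminus> G (Suc n) = (rdif S (Suc (Suc n)) \<cdot> h (Suc n)) \<boxplus> (h n \<cdot> rdif R (Suc n)))"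
proof -
  have S': "aug_complex B S" using S by (simp add: hom_acyclic_def)
  note r = aug_complexD[OF R(1)] and s = aug_complexD[OF S'] and f' = f[unfolded mor_iff]
  define D where "D = (\<lambda>n. F n \<boxplus> \<boxminus> G n)"
  have m: "arr (F n)" "src (F n) = robj R n" "tgt (F n) = robj S n" "arr (G n)" "src (G n) = robj R n" "tgt (G n) = robj S n" for n
    using F G unfolding lifts_def mor_iff by blast+
  have D: "arr (D n)" "src (D n) = robj R n" "tgt (D n) = robj S n" for n
    using m by (simp_all add: D_def arr_simps)
  have eF: "rdif S 0 \<cdot> F 0 = f \<cdot> rdif R 0" "rdif S 0 \<cdot> G 0 = f \<cdot> rdif R 0"
    "rdif S (Suc n) \<cdot> F (Suc n) = F n \<cdot> rdif R (Suc n)" "rdif S (Suc n) \<cdot> G (Suc n) = G n \<cdot> rdif R (Suc n)" for n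
    using F G unfolding lifts_def by blast+
  have D0: "rdif S 0 \<cdot> D 0 = zero_mor \<C> (robj R 0) B"
    using m f' r s by (simp add: D_def cat_simps eF)
  have DS: "rdif S (Suc n) \<cdot> D (Suc n) = D n \<cdot> rdif R (Suc n)" for n
    using m r[where n="Suc n"] s[where n="Suc n"] by (simp add: D_def cat_simps eF)
  \<comment> \<open>The homotopy identity in degree \<open>n\<close> also involves the preceding
    component, but composing with \<open>rdif R (Suc n)\<close> kills that term. What is left
    mentions \<open>h\<close> alone and makes the error in the next degree a cycle.\<close>
  let ?P = "\<lambda>n h. h \<in> Mor \<C> (robj R n) (robj S (Suc n)) \<and> (n = 0 \<longrightarrow> D 0 = rdif S (Suc 0) \<cdot> h) \<and>
    rdif S (Suc n) \<cdot> (h \<cdot> rdif R (Suc n)) = D n \<cdot> rdif R (Suc n)"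
  let ?Q = "\<lambda>n h h'. D (Suc n) = (rdif S (Suc (Suc n)) \<cdot> h') \<boxplus> (h \<cdot> rdif R (Suc n))"
  have "\<exists>h. \<forall>n. ?P n (h n) \<and> ?Q n (h n) (h (Suc n))"
  proof (rule dependent_nat_choice[where P = ?P and Q = ?Q])
    have "D 0 \<in> Mor \<C> (robj R 0) (robj S 0)" using D by (simp add: mor_iff)
    then obtain h where h: "h \<in> Mor \<C> (robj R 0) (robj S (Suc 0))" "rdif S (Suc 0) \<cdot> h = D 0"
      using hom_acyclicD(2)[OF S R(2)] D0 by force
    then have "rdif S (Suc 0) \<cdot> (h \<cdot> rdif R (Suc 0)) = D 0 \<cdot> rdif R (Suc 0)"
      using r[where n="Suc 0"] s[where n="Suc 0"] by (intro cmp_eq_extend) (simp_all add: mor_iff)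
    then show "\<exists>h. ?P 0 h" using h by auto
  next
    fix h n assume P: "?P n h"
    let ?E = "D (Suc n) \<boxplus> \<boxminus> (h \<cdot> rdif R (Suc n))"
    have E: "?E \<in> Mor \<C> (robj R (Suc n)) (robj S (Suc n))"
      using P r[where n="Suc n"] D by (simp add: arr_simps)
    have "rdif S (Suc n) \<cdot> ?E = zero_mor \<C> (robj R (Suc n)) (aug B S (Suc n))"
      using P r[where n="Suc n"] D s[where n="Suc n"] by (simp add: cat_simps DS)
    then obtain h' where h': "h' \<in> Mor \<C> (robj R (Suc n)) (robj S (Suc (Suc n)))"
        "rdif S (Suc (Suc n)) \<cdot> h' = ?E"
      using hom_acyclicD(2)[OF S R(2) E] by blast
    have "rdif S (Suc (Suc n)) \<cdot> (h' \<cdot> rdif R (Suc (Suc n))) = D (Suc n) \<cdot> rdif R (Suc (Suc n))"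
      using cmp_eq_extend[OF h'(2), of "rdif R (Suc (Suc n))"] P h'(1) r[where n="Suc n"] r[where n="Suc (Suc n)"] D s[where n="Suc (Suc n)"]
      by (simp add: cat_simps)
    moreover have "?Q n h h'" unfolding h'(2) using P D r[where n="Suc n"] by (simp add: cat_simps)
    ultimately show "\<exists>h'. ?P (Suc n) h' \<and> ?Q n h h'" using h' by blast
  qed
  then show ?thesis unfolding D_def by blast
qed

lemma lifts_cmp:
  assumes R: "aug_complex A R" and S: "aug_complex B S" and T: "aug_complex C T"
    and f: "f \<in> Mor \<C> A B" and g: "g \<in> Mor \<C> B C"
    and F: "lifts \<C> R S f F" and G: "lifts \<C> S T g G"
  shows "lifts \<C> R T (g \<cdot> f) (\<lambda>n. G n \<cdot> F n)"
proof -
  note r = aug_complexD[OF R] and s = aug_complexD[OF S] and t = aug_complexD[OF T]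
  have m: "arr (F n)" "src (F n) = robj R n" "tgt (F n) = robj S n" "arr (G n)" "src (G n) = robj S n" "tgt (G n) = robj T n" for n
    using F G unfolding lifts_def mor_iff by blast+
  have eF: "rdif S 0 \<cdot> F 0 = f \<cdot> rdif R 0" "rdif T 0 \<cdot> G 0 = g \<cdot> rdif S 0"
    "rdif S (Suc n) \<cdot> F (Suc n) = F n \<cdot> rdif R (Suc n)" "rdif T (Suc n) \<cdot> G (Suc n) = G n \<cdot> rdif S (Suc n)" for n
    using F G unfolding lifts_def by blast+
  have "rdif T 0 \<cdot> (G 0 \<cdot> F 0) = (g \<cdot> f) \<cdot> rdif R 0"
    using cmp_eq_extend[OF eF(2), of "F 0"] m r[where n=0] s[where n=0] t[where n=0] f g by (simp add: mor_iff cmp_assoc' eF)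
  moreover have "rdif T (Suc n) \<cdot> (G (Suc n) \<cdot> F (Suc n)) = (G n \<cdot> F n) \<cdot> rdif R (Suc n)" for n
    using cmp_eq_extend[OF eF(4)[of n], of "F (Suc n)"] m r[where n="Suc n"] s[where n="Suc n"] t[where n="Suc n"] by (simp add: cmp_assoc' eF)
  ultimately show ?thesis unfolding lifts_def using m by (simp add: mor_iff cmp_arr)
qed

lemma lifts_idn: "aug_complex A R \<Longrightarrow> lifts \<C> R R (Idn \<C> A) (\<lambda>n. Idn \<C> (robj R n))"
  unfolding lifts_def by (simp add: aug_complexD arr_simps idn_cmp)

end

section \<open>Acyclicity of proper resolutions, and the horseshoe lemma\<close>

context proper_class
begin

lemma proper_GProj_resolution_iff:
  "proper_GProj_resolution \<C> \<xi> A R \<longleftrightarrow> (\<forall>n. robj R n \<in> GProj \<C> \<xi>) \<and>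
    (\<exists>K g f \<delta>. K 0 = A \<and> (\<forall>n. gp_triangle (K (Suc n)) (g n) (robj R n) (f n) (K n) (\<delta> n)) \<and>
      rdif R 0 = f 0 \<and> (\<forall>n. rdif R (Suc n) = g n \<cdot> f (Suc n)))"
  unfolding proper_GProj_resolution_def gp_triangle_def by simp

lemma proper_resolution_acyclic:
  assumes "proper_GProj_resolution \<C> \<xi> A R"
  shows "hom_acyclic (GProj \<C> \<xi>) A R"
proof -
  obtain K g f \<delta> where K: "K 0 = A" "\<And>n. gp_triangle (K (Suc n)) (g n) (robj R n) (f n) (K n) (\<delta> n)"
    "rdif R 0 = f 0" "\<And>n. rdif R (Suc n) = g n \<cdot> f (Suc n)"
    using assms unfolding proper_GProj_resolution_iff by blast
  note gp = K(2)[unfolded gp_triangle_iff]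
  have et: "etri \<C> (K (Suc n)) (g n) (robj R n) (f n) (K n) (\<delta> n)" for n using gp xi_etri by blast
  note m = etriD[OF et] and z = etri_cmp_zero[OF et]
  have zz: "f n \<cdot> (g n \<cdot> v) = zero_mor \<C> (src v) (K n)" if "arr v" "tgt v = K (Suc n)" for n v
    using cmp_eq_extend[OF z[of n], of v] m that by (simp add: zero_cmp)
  have c: "aug_complex A R" unfolding aug_complex_def
  proof
    fix n
    show "rdif R n \<in> Mor \<C> (robj R n) (aug A R n) \<and>
      rdif R n \<cdot> rdif R (Suc n) = zero_mor \<C> (robj R (Suc n)) (aug A R n)"
      by (cases n) (auto simp: K(1)[symmetric] K(3,4) m mor_iff cmp_arr cmp_assoc' zz cmp_zero)
  qed
  have ex: "\<exists>s \<in> Mor \<C> W (robj R (Suc n)). rdif R (Suc n) \<cdot> s = t"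
    if W: "W \<in> GProj \<C> \<xi>" and t: "t \<in> Mor \<C> W (robj R n)" "rdif R n \<cdot> t = zero_mor \<C> W (aug A R n)" for W n t
  proof -
    \<comment> \<open>In positive degree a cycle \<open>t\<close> only satisfies
      \<open>g k \<cdot> (f n \<cdot> t) = 0\<close>; cancelling \<open>g k\<close> uses the
      injectivity part of the exactness condition. In degree 0 the differential is
      \<open>f 0\<close> itself.\<close>
    have "f n \<cdot> t = zero_mor \<C> W (K n)"
    proof (cases n)
      case 0 then show ?thesis using t K by simp
    next
      case (Suc k)
      then have "g k \<cdot> (f n \<cdot> t) = zero_mor \<C> W (robj R k)" using t m[of k] m[of n] by (simp add: K(4) mor_iff cmp_assoc')
      moreover have "f n \<cdot> t \<in> Mor \<C> W (K (Suc k))" using t m[of n] Suc by (simp add: arr_simps)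
      ultimately show ?thesis using gp[of k] W Suc by blast
    qed
    then obtain u where u: "u \<in> Mor \<C> W (K (Suc n))" "g n \<cdot> u = t"
      using etri_exact_from[OF et t(1)] by blast
    then obtain s where "s \<in> Mor \<C> W (robj R (Suc n))" "f (Suc n) \<cdot> s = u"
      using gp[of "Suc n"] W by blast
    then show ?thesis using u m[of n] m[of "Suc n"] by (intro bexI[of _ s]) (auto simp: K(4) mor_iff cmp_assoc')
  qed
  have "\<exists>t \<in> Mor \<C> W (robj R 0). rdif R 0 \<cdot> t = v" if "W \<in> GProj \<C> \<xi>" "v \<in> Mor \<C> W A" for W v
    using that gp[of 0] K(1,3) by auto
  then show ?thesis unfolding hom_acyclic_def using c ex by blast
qed

text \<open>The iterated datum is a triangle K n -> M n -> L n between corresponding syzygies, kept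
  as the quadruple of its middle term, two maps and extension. It starts with the given triangle,
  and each horseshoe step produces the next one.\<close>

lemma horseshoe:
  assumes dl: "gp_triangle A x B y C \<delta>"
    and P: "proper_GProj_resolution \<C> \<xi> A P" and Q: "proper_GProj_resolution \<C> \<xi> C Q"
  shows "\<exists>R S. proper_GProj_resolution \<C> \<xi> B R \<and>
    (\<forall>n. is_biproduct \<C> (robj P n) (robj Q n) (S n) \<and> bobj (S n) = robj R n) \<and>
    lifts \<C> P R x (\<lambda>n. in1 (S n)) \<and> lifts \<C> R Q y (\<lambda>n. pr2 (S n))"
proof -
  obtain K k a \<kappa> where K: "K 0 = A" "\<And>n. gp_triangle (K (Suc n)) (k n) (robj P n) (a n) (K n) (\<kappa> n)"
    "rdif P 0 = a 0" "\<And>n. rdif P (Suc n) = k n \<cdot> a (Suc n)" and PG: "\<And>n. robj P n \<in> GProj \<C> \<xi>"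
    using P unfolding proper_GProj_resolution_iff by blast
  obtain L l c \<mu> where L: "L 0 = C" "\<And>n. gp_triangle (L (Suc n)) (l n) (robj Q n) (c n) (L n) (\<mu> n)"
    "rdif Q 0 = c 0" "\<And>n. rdif Q (Suc n) = l n \<cdot> c (Suc n)" and QG: "\<And>n. robj Q n \<in> GProj \<C> \<xi>"
    using Q unfolding proper_GProj_resolution_iff by blast
  \<comment> \<open>\<open>horseshoe_step\<close> accepts any biproduct as middle term, so one with
    Gorenstein projective object can be fixed in every degree beforehand.\<close>
  define S where "S = (\<lambda>n. SOME S. is_biproduct \<C> (robj P n) (robj Q n) S \<and> bobj S \<in> GProj \<C> \<xi>)"
  have S: "is_biproduct \<C> (robj P n) (robj Q n) (S n)" "bobj (S n) \<in> GProj \<C> \<xi>" for n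
    unfolding S_def using someI_ex[OF GProj_biproduct[OF PG QG]] by blast+
  let ?X = "\<lambda>s. fst (snd s)" and ?Y = "\<lambda>s. fst (snd (snd s))" and ?d = "\<lambda>s. snd (snd (snd s))"
  let ?P = "\<lambda>n s. gp_triangle (K n) (?X s) (fst s) (?Y s) (L n) (?d s) \<and>
    (n = 0 \<longrightarrow> fst s = B \<and> ?X s = x \<and> ?Y s = y)"
  let ?E = "\<lambda>n s s' m b \<epsilon>. gp_triangle (fst s') m (bobj (S n)) b (fst s) \<epsilon> \<and>
      b \<cdot> in1 (S n) = ?X s \<cdot> a n \<and> ?Y s \<cdot> b = c n \<cdot> pr2 (S n) \<and>
      m \<cdot> ?X s' = in1 (S n) \<cdot> k n \<and> pr2 (S n) \<cdot> m = l n \<cdot> ?Y s'"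
  let ?Q = "\<lambda>n s s'. \<exists>m b \<epsilon>. ?E n s s' m b \<epsilon>"
  have "\<exists>s. \<forall>n. ?P n (s n) \<and> ?Q n (s n) (s (Suc n))"
  proof (rule dependent_nat_choice[where P = ?P and Q = ?Q])
    show "\<exists>s. ?P 0 s" using dl K(1) L(1) by (intro exI[of _ "(B, x, y, \<delta>)"]) simp
  next
    fix s n assume P: "?P n s"
    obtain M' m b \<epsilon> x' y' \<delta>' where
      "gp_triangle M' m (bobj (S n)) b (fst s) \<epsilon>" "gp_triangle (K (Suc n)) x' M' y' (L (Suc n)) \<delta>'"
      "b \<cdot> in1 (S n) = ?X s \<cdot> a n" "?Y s \<cdot> b = c n \<cdot> pr2 (S n)"
      "m \<cdot> x' = in1 (S n) \<cdot> k n" "pr2 (S n) \<cdot> m = l n \<cdot> y'"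
      using horseshoe_step[OF conjunct1[OF P] K(2) L(2) QG S(1)] by blast
    then have "?P (Suc n) (M', x', y', \<delta>') \<and> ?E n s (M', x', y', \<delta>') m b \<epsilon>" by simp
    then show "\<exists>s'. ?P (Suc n) s' \<and> ?Q n s s'" by blast
  qed
  then obtain s where s: "\<forall>n. ?P n (s n) \<and> ?Q n (s n) (s (Suc n))" ..
  define M where "M n = fst (s n)" for n
  define X where "X n = ?X (s n)" for n
  define Y where "Y n = ?Y (s n)" for n
  have M0: "M 0 = B" "X 0 = x" "Y 0 = y" using s[rule_format, of 0] by (simp_all add: M_def X_def Y_def)
  have tM: "gp_triangle (K n) (X n) (M n) (Y n) (L n) (?d (s n))" for n
    using s[rule_format, of n] by (simp add: M_def X_def Y_def)
  \<comment> \<open>The recursion keeps the resolution triangle linking two consecutive quadruples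
    only existentially; a second choice names its maps \<open>m\<close> and
    \<open>b\<close>.\<close>
  have "\<forall>n. \<exists>t. ?E n (s n) (s (Suc n)) (fst t) (fst (snd t)) (snd (snd t))"
  proof
    fix n
    obtain m b \<epsilon> where "?E n (s n) (s (Suc n)) m b \<epsilon>" using s by blast
    then show "\<exists>t. ?E n (s n) (s (Suc n)) (fst t) (fst (snd t)) (snd (snd t))"
      by (intro exI[of _ "(m, b, \<epsilon>)"]) simp
  qed
  from choice[OF this] obtain t where
    t: "\<forall>n. ?E n (s n) (s (Suc n)) (fst (t n)) (fst (snd (t n))) (snd (snd (t n)))" ..
  define m where "m n = fst (t n)" for n
  define b where "b n = fst (snd (t n))" for n
  have E: "gp_triangle (M (Suc n)) (m n) (bobj (S n)) (b n) (M n) (snd (snd (t n)))"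
    "b n \<cdot> in1 (S n) = X n \<cdot> a n" "Y n \<cdot> b n = c n \<cdot> pr2 (S n)"
    "m n \<cdot> X (Suc n) = in1 (S n) \<cdot> k n" "pr2 (S n) \<cdot> m n = l n \<cdot> Y (Suc n)" for n
    using t[rule_format, of n] by (simp_all add: m_def b_def M_def X_def Y_def)
  define R where "R = \<lparr>robj = (\<lambda>n. bobj (S n)), rdif = (\<lambda>n. case n of 0 \<Rightarrow> b 0 | Suc j \<Rightarrow> m j \<cdot> b (Suc j))\<rparr>"
  have R: "robj R n = bobj (S n)" "rdif R 0 = b 0" "rdif R (Suc n) = m n \<cdot> b (Suc n)" for n
    by (simp_all add: R_def)
  have pR: "proper_GProj_resolution \<C> \<xi> B R"
    unfolding proper_GProj_resolution_iff 
    by (rule conjI, simp add: S(2) R, rule exI[of _ M], rule exI[of _ m], rule exI[of _ b],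
        rule exI[of _ "\<lambda>n. snd (snd (t n))"]) (simp add: E(1) R M0)
  have gp_etri: "etri \<C> A' x' B' y' C' \<delta>'" if "gp_triangle A' x' B' y' C' \<delta>'" for A' x' B' y' C' \<delta>'
    using that xi_etri by (auto simp: gp_triangle_def)
  note mm = etriD[OF gp_etri[OF E(1)]] etriD[OF gp_etri[OF K(2)]] etriD[OF gp_etri[OF L(2)]]
  have mX: "arr (X n)" "src (X n) = K n" "tgt (X n) = M n" "arr (Y n)" "src (Y n) = M n" "tgt (Y n) = L n" for n
    using etriD[OF gp_etri[OF tM]] by blast+
  note bS = biprod_arr[OF S(1)]
  have "lifts \<C> P R x (\<lambda>n. in1 (S n))"
    unfolding lifts_def
  proof (intro conjI allI)
    fix n
    show "rdif R (Suc n) \<cdot> in1 (S (Suc n)) = in1 (S n) \<cdot> rdif P (Suc n)"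
      using cmp_eq_extend[OF E(4)[of n], of "a (Suc n)"] mm[of n] mm[of "Suc n"] bS mX
      by (simp add: R K cmp_assoc' E(2))
  qed (use bS E(2)[of 0] M0 in \<open>simp_all add: R K mor_iff\<close>)
  moreover have "lifts \<C> R Q y (\<lambda>n. pr2 (S n))"
    unfolding lifts_def
  proof (intro conjI allI)
    fix n
    show "rdif Q (Suc n) \<cdot> pr2 (S (Suc n)) = pr2 (S n) \<cdot> rdif R (Suc n)"
      using cmp_eq_extend[OF E(5)[of n], of "b (Suc n)"] mm[of n] mm[of "Suc n"] bS mX
      by (simp add: R L cmp_assoc' E(3))
  qed (use bS E(3)[of 0] M0 in \<open>simp_all add: R L mor_iff\<close>)
  ultimately show ?thesis using pR S(1) R(1) by metis
qed

end

section \<open>Cohomology\<close>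

context additive_category
begin

lemma cocycles_iff:
  "\<phi> \<in> cocycles \<C> R n X \<longleftrightarrow> \<phi> \<in> Mor \<C> (robj R n) X \<and> \<phi> \<cdot> rdif R (Suc n) = zero_mor \<C> (robj R (Suc n)) X"
  by (simp add: cocycles_def kernel_def)

lemma coboundaries_0: "\<phi> \<in> coboundaries \<C> R 0 X \<longleftrightarrow> \<phi> = zero_mor \<C> (robj R 0) X"
  by (simp add: coboundaries_def)

lemma coboundaries_Suc:
  "\<phi> \<in> coboundaries \<C> R (Suc n) X \<longleftrightarrow> (\<exists>\<psi> \<in> Mor \<C> (robj R n) X. \<phi> = \<psi> \<cdot> rdif R (Suc n))"
  by (auto simp: coboundaries_def)

lemma coboundaries_cocycles:
  assumes "aug_complex A R" "\<phi> \<in> coboundaries \<C> R n X" shows "\<phi> \<in> cocycles \<C> R n X"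
proof (cases n)
  case 0
  then show ?thesis using assms aug_complexD[OF assms(1), where n = "Suc 0"]
    by (simp add: coboundaries_0 cocycles_iff mor_iff cat_simps)
next
  case (Suc m)
  then show ?thesis
    using assms aug_complexD[OF assms(1), where n = "Suc m"] aug_complexD[OF assms(1), where n = "Suc (Suc m)"]
    by (auto simp: coboundaries_Suc cocycles_iff mor_iff cat_simps)
qed

lemma coboundaries_closed:
  assumes R: "aug_complex A R"
  shows "zero_mor \<C> (robj R n) X \<in> coboundaries \<C> R n X"
    "\<lbrakk>\<phi> \<in> coboundaries \<C> R n X; \<psi> \<in> coboundaries \<C> R n X\<rbrakk> \<Longrightarrow> \<phi> \<boxplus> \<psi> \<in> coboundaries \<C> R n X"
    "\<phi> \<in> coboundaries \<C> R n X \<Longrightarrow> \<boxminus> \<phi> \<in> coboundaries \<C> R n X"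
proof -
  have r: "arr (rdif R (Suc m))" "src (rdif R (Suc m)) = robj R (Suc m)" "tgt (rdif R (Suc m)) = robj R m" for m
    using aug_complexD[OF R, where n = "Suc m"] by simp_all
  show "zero_mor \<C> (robj R n) X \<in> coboundaries \<C> R n X"
    by (cases n) (auto simp: coboundaries_0 coboundaries_Suc cat_simps r intro!: bexI[of _ "zero_mor \<C> (robj R m) X" for m])
  show "\<phi> \<boxplus> \<psi> \<in> coboundaries \<C> R n X" if c: "\<phi> \<in> coboundaries \<C> R n X" "\<psi> \<in> coboundaries \<C> R n X"
  proof (cases n)
    case (Suc m)
    then obtain u v where "u \<in> Mor \<C> (robj R m) X" "\<phi> = u \<cdot> rdif R (Suc m)" "v \<in> Mor \<C> (robj R m) X" "\<psi> = v \<cdot> rdif R (Suc m)"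
      using c unfolding Suc coboundaries_Suc by blast
    then show ?thesis using Suc r by (auto simp: coboundaries_Suc cat_simps intro!: bexI[of _ "u \<boxplus> v"])
  qed (use c in \<open>auto simp: coboundaries_0 cat_simps\<close>)
  show "\<boxminus> \<phi> \<in> coboundaries \<C> R n X" if c: "\<phi> \<in> coboundaries \<C> R n X"
  proof (cases n)
    case (Suc m)
    then obtain u where "u \<in> Mor \<C> (robj R m) X" "\<phi> = u \<cdot> rdif R (Suc m)"
      using c unfolding Suc coboundaries_Suc by blast
    then show ?thesis using Suc r by (auto simp: coboundaries_Suc cat_simps intro!: bexI[of _ "\<boxminus> u"])
  qed (use c in \<open>auto simp: coboundaries_0 cat_simps\<close>)
qed

lemma cocycles_closed:
  assumes R: "aug_complex A R"
  shows "\<lbrakk>\<phi> \<in> cocycles \<C> R n X; \<psi> \<in> cocycles \<C> R n X\<rbrakk> \<Longrightarrow> \<phi> \<boxplus> \<psi> \<in> cocycles \<C> R n X"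
    "\<phi> \<in> cocycles \<C> R n X \<Longrightarrow> \<boxminus> \<phi> \<in> cocycles \<C> R n X"
  using aug_complexD[OF R, where n = "Suc n"] by (auto simp: cocycles_iff cat_simps)

lemma cocycles_arr:
  "\<phi> \<in> cocycles \<C> R n X \<Longrightarrow> arr \<phi>" "\<phi> \<in> cocycles \<C> R n X \<Longrightarrow> src \<phi> = robj R n"
  "\<phi> \<in> cocycles \<C> R n X \<Longrightarrow> tgt \<phi> = X"
  by (simp_all add: cocycles_iff mor_iff)

lemma cocycles_group:
  assumes R: "aug_complex A R"
  shows "comm_group ((Hom \<C> (robj R n) X)\<lparr>carrier := cocycles \<C> R n X\<rparr>)"
    "subgroup (coboundaries \<C> R n X) ((Hom \<C> (robj R n) X)\<lparr>carrier := cocycles \<C> R n X\<rparr>)"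
proof -
  interpret H: comm_group "Hom \<C> (robj R n) X" by (rule hom_group)
  let ?Z = "(Hom \<C> (robj R n) X)\<lparr>carrier := cocycles \<C> R n X\<rparr>"
  have m: "\<phi> \<otimes>\<^bsub>Hom \<C> (robj R n) X\<^esub> \<psi> = \<phi> \<boxplus> \<psi>" "inv\<^bsub>Hom \<C> (robj R n) X\<^esub> \<phi> = \<boxminus> \<phi>"
    if "\<phi> \<in> cocycles \<C> R n X" for \<phi> \<psi>
    using that by (simp_all add: cocycles_iff mult_madd inv_mneg)
  have sub: "coboundaries \<C> R n X \<subseteq> cocycles \<C> R n X" "cocycles \<C> R n X \<subseteq> Mor \<C> (robj R n) X"
    using coboundaries_cocycles[OF R] by (auto simp: cocycles_iff)
  note ne = coboundaries_closed(1)[OF R, of n X]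
  have Z: "subgroup (cocycles \<C> R n X) (Hom \<C> (robj R n) X)"
  proof (rule H.subgroupI)
    show "cocycles \<C> R n X \<noteq> {}" using ne sub by blast
  qed (use sub cocycles_closed[OF R] in \<open>simp_all add: m\<close>)
  have B: "subgroup (coboundaries \<C> R n X) (Hom \<C> (robj R n) X)"
  proof (rule H.subgroupI)
    show "coboundaries \<C> R n X \<noteq> {}" using ne by blast
  qed (use sub coboundaries_closed[OF R] in \<open>auto simp: m[OF subsetD[OF sub(1)]]\<close>)
  show "comm_group ?Z" using H.subgroup_imp_group[OF Z] H.m_comm sub(2)
    by (auto intro!: group.group_comm_groupI simp: subset_iff)
  show "subgroup (coboundaries \<C> R n X) ?Z"
    using H.subgroup_incl[OF B Z] coboundaries_cocycles[OF R] by blast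
qed

text \<open>Cosets depend only on the multiplication, so they may be formed in the cocycle group,
  where the coboundaries are normal and the theory of factor groups applies.\<close>

lemma coh_class_def':
  assumes "aug_complex A R"
  shows "coh_class \<C> R n X \<phi> =
    coboundaries \<C> R n X #>\<^bsub>(Hom \<C> (robj R n) X)\<lparr>carrier := cocycles \<C> R n X\<rparr>\<^esub> \<phi>"
  by (simp add: coh_class_def r_coset_def)

context
  fixes A R assumes R: "aug_complex A R"
begin

lemma coh_class_eq_iff:
  assumes "\<phi> \<in> cocycles \<C> R n X" "\<psi> \<in> cocycles \<C> R n X"
  shows "coh_class \<C> R n X \<phi> = coh_class \<C> R n X \<psi> \<longleftrightarrow> \<phi> \<boxplus> \<boxminus> \<psi> \<in> coboundaries \<C> R n X"
proof -
  let ?Z = "(Hom \<C> (robj R n) X)\<lparr>carrier := cocycles \<C> R n X\<rparr>"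
  interpret Z: comm_group ?Z by (rule cocycles_group[OF R])
  interpret H: comm_group "Hom \<C> (robj R n) X" by (rule hom_group)
  note B = cocycles_group(2)[OF R, of n X]
  have m: "\<phi> \<in> Mor \<C> (robj R n) X" "\<psi> \<in> Mor \<C> (robj R n) X" using assms by (simp_all add: cocycles_iff)
  have e: "u = (u \<boxplus> \<boxminus> v) \<boxplus> v" if "u \<in> Mor \<C> (robj R n) X" "v \<in> Mor \<C> (robj R n) X" for u v
    using that by (simp add: cat_simps)
  show ?thesis
  proof
    assume "coh_class \<C> R n X \<phi> = coh_class \<C> R n X \<psi>"
    then have "\<phi> \<in> coboundaries \<C> R n X #>\<^bsub>?Z\<^esub> \<psi>"
      using Z.rcos_self[OF _ B, of \<phi>] assms by (simp add: coh_class_def'[OF R])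
    then obtain b where b: "b \<in> coboundaries \<C> R n X" "\<phi> = b \<otimes>\<^bsub>Hom \<C> (robj R n) X\<^esub> \<psi>"
      by (auto simp: r_coset_def)
    then have bm: "b \<in> Mor \<C> (robj R n) X" using coboundaries_cocycles[OF R] cocycles_iff by blast
    then have "\<phi> = b \<boxplus> \<psi>" using b(2) by (simp add: mult_madd)
    then have "\<phi> \<boxplus> \<boxminus> \<psi> = b" using bm m(2) by (simp add: cat_simps)
    then show "\<phi> \<boxplus> \<boxminus> \<psi> \<in> coboundaries \<C> R n X" using b by simp
  next
    assume c: "\<phi> \<boxplus> \<boxminus> \<psi> \<in> coboundaries \<C> R n X"
    then have "\<phi> \<boxplus> \<boxminus> \<psi> \<in> Mor \<C> (robj R n) X" using coboundaries_cocycles[OF R] cocycles_iff by blast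
    then have "\<phi> = (\<phi> \<boxplus> \<boxminus> \<psi>) \<otimes>\<^bsub>Hom \<C> (robj R n) X\<^esub> \<psi>" using e[OF m] by (simp add: mult_madd)
    then have "\<phi> \<in> coboundaries \<C> R n X #>\<^bsub>?Z\<^esub> \<psi>" using c by (auto simp: r_coset_def)
    then show "coh_class \<C> R n X \<phi> = coh_class \<C> R n X \<psi>"
      using Z.repr_independence[OF _ _ B, of \<phi> \<psi>] assms by (simp add: coh_class_def'[OF R])
  qed
qed

lemma coh_class_self: "\<phi> \<in> cocycles \<C> R n X \<Longrightarrow> \<phi> \<in> coh_class \<C> R n X \<phi>"
  using group.rcos_self[OF comm_group.axioms(2)[OF cocycles_group(1)[OF R]] _ cocycles_group(2)[OF R]]
  by (simp add: coh_class_def'[OF R])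

lemma coh_class_mem:
  assumes "\<phi> \<in> cocycles \<C> R n X" "\<psi> \<in> coh_class \<C> R n X \<phi>"
  shows "\<psi> \<in> cocycles \<C> R n X" "coh_class \<C> R n X \<psi> = coh_class \<C> R n X \<phi>"
proof -
  let ?Z = "(Hom \<C> (robj R n) X)\<lparr>carrier := cocycles \<C> R n X\<rparr>"
  interpret Z: comm_group ?Z by (rule cocycles_group[OF R])
  note B = cocycles_group(2)[OF R, of n X]
  show "\<psi> \<in> cocycles \<C> R n X"
    using Z.r_coset_subset_G[OF subgroup.subset[OF B], of \<phi>] assms by (auto simp: coh_class_def'[OF R])
  show "coh_class \<C> R n X \<psi> = coh_class \<C> R n X \<phi>"
    using Z.repr_independence[OF _ _ B, of \<psi> \<phi>] assms by (simp add: coh_class_def'[OF R])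
qed

lemma coh_class_coboundary_iff:
  assumes "\<phi> \<in> cocycles \<C> R n X"
  shows "coh_class \<C> R n X \<phi> = coboundaries \<C> R n X \<longleftrightarrow> \<phi> \<in> coboundaries \<C> R n X"
proof -
  interpret Z: comm_group "(Hom \<C> (robj R n) X)\<lparr>carrier := cocycles \<C> R n X\<rparr>" by (rule cocycles_group[OF R])
  note B = cocycles_group(2)[OF R, of n X]
  show ?thesis
    using Z.coset_join1[OF _ _ B, of \<phi>] Z.coset_join2[OF _ B, of \<phi>] assms subgroup.subset[OF B]
    by (auto simp: coh_class_def'[OF R])
qed

end

context
  fixes A M :: 'o and R :: "'o \<Rightarrow> ('o, 'm) resolution"
  assumes R: "aug_complex A (R M)"
begin

lemma xt_group: "group (xt \<C> R n M X)"
proof -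
  interpret Z: comm_group "(Hom \<C> (robj (R M) n) X)\<lparr>carrier := cocycles \<C> (R M) n X\<rparr>"
    by (rule cocycles_group[OF R])
  show ?thesis unfolding xt_def
    using normal.factorgroup_is_group Z.subgroup_imp_normal cocycles_group(2)[OF R] by blast
qed

lemma xt_carrier: "carrier (xt \<C> R n M X) = coh_class \<C> (R M) n X ` cocycles \<C> (R M) n X"
  unfolding xt_def coh_class_def'[OF R] by (auto simp: FactGroup_def RCOSETS_def)

lemma xt_one: "\<one>\<^bsub>xt \<C> R n M X\<^esub> = coboundaries \<C> (R M) n X"
  by (simp add: xt_def)

lemma xt_mult:
  assumes "\<phi> \<in> cocycles \<C> (R M) n X" "\<psi> \<in> cocycles \<C> (R M) n X"
  shows "coh_class \<C> (R M) n X \<phi> \<otimes>\<^bsub>xt \<C> R n M X\<^esub> coh_class \<C> (R M) n X \<psi> = coh_class \<C> (R M) n X (\<phi> \<boxplus> \<psi>)"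
proof -
  let ?Z = "(Hom \<C> (robj (R M) n) X)\<lparr>carrier := cocycles \<C> (R M) n X\<rparr>"
  interpret Z: comm_group ?Z by (rule cocycles_group[OF R])
  interpret N: normal "coboundaries \<C> (R M) n X" ?Z
    using Z.subgroup_imp_normal cocycles_group(2)[OF R] by blast
  show ?thesis
    using N.rcos_sum[of \<phi> \<psi>] assms
    by (simp add: xt_def FactGroup_def coh_class_def'[OF R] cocycles_iff mult_madd)
qed

end

text \<open>Every map between cohomology groups below is induced by such an operation on
  representatives: composing with a lift, with the connecting entry (which raises the degree), or
  with a morphism \<open>u\<close> on the left.\<close>

definition coh_hom :: "('o, 'm) resolution \<Rightarrow> nat \<Rightarrow> 'o \<Rightarrow> ('o, 'm) resolution \<Rightarrow> nat \<Rightarrow> 'o \<Rightarrow> ('m \<Rightarrow> 'm) \<Rightarrow> bool"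
  where "coh_hom P n X Q m Y T \<longleftrightarrow>
    (\<forall>\<phi> \<in> cocycles \<C> P n X. T \<phi> \<in> cocycles \<C> Q m Y) \<and>
    (\<forall>\<phi> \<in> coboundaries \<C> P n X. T \<phi> \<in> coboundaries \<C> Q m Y) \<and>
    (\<forall>\<phi> \<in> cocycles \<C> P n X. \<forall>\<psi> \<in> cocycles \<C> P n X. T (\<phi> \<boxplus> \<psi>) = T \<phi> \<boxplus> T \<psi>)"

lemma coh_homD:
  assumes T: "coh_hom P n X Q m Y T" and P: "aug_complex A P" and Q: "aug_complex B Q"
    and \<phi>: "\<phi> \<in> cocycles \<C> P n X"
  shows "T \<phi> \<in> cocycles \<C> Q m Y"
    "\<lbrakk>\<psi> \<in> cocycles \<C> P n X; coh_class \<C> P n X \<phi> = coh_class \<C> P n X \<psi>\<rbrakk>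
      \<Longrightarrow> coh_class \<C> Q m Y (T \<phi>) = coh_class \<C> Q m Y (T \<psi>)"
proof -
  have c: "T \<phi> \<in> cocycles \<C> Q m Y" if "\<phi> \<in> cocycles \<C> P n X" for \<phi>
    using T that by (simp add: coh_hom_def)
  show "T \<phi> \<in> cocycles \<C> Q m Y" by (rule c[OF \<phi>])
  assume \<psi>: "\<psi> \<in> cocycles \<C> P n X" and eq: "coh_class \<C> P n X \<phi> = coh_class \<C> P n X \<psi>"
  let ?d = "\<phi> \<boxplus> \<boxminus> \<psi>"
  note cl = cocycles_arr[OF \<phi>] cocycles_arr[OF \<psi>] cocycles_arr[OF c[OF \<phi>]] cocycles_arr[OF c[OF \<psi>]]
  have d: "?d \<in> coboundaries \<C> P n X" using coh_class_eq_iff[OF P \<phi> \<psi>] eq by simp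
  have dz: "?d \<in> cocycles \<C> P n X" using d coboundaries_cocycles[OF P] by blast
  \<comment> \<open>Compatibility with negatives is not part of \<open>coh_hom\<close>; writing
    \<phi> as the difference plus \<psi> lets additivity do the work.\<close>
  have "\<phi> = ?d \<boxplus> \<psi>" using cl by (simp add: cat_simps)
  moreover have "T (?d \<boxplus> \<psi>) = T ?d \<boxplus> T \<psi>" using T dz \<psi> by (simp add: coh_hom_def)
  ultimately have "T \<phi> = T ?d \<boxplus> T \<psi>" by simp
  then have "T \<phi> \<boxplus> \<boxminus> T \<psi> = T ?d" using cl cocycles_arr[OF c[OF dz]] by (simp add: cat_simps)
  then show "coh_class \<C> Q m Y (T \<phi>) = coh_class \<C> Q m Y (T \<psi>)"
    using coh_class_eq_iff[OF Q c[OF \<phi>] c[OF \<psi>]] T d by (simp add: coh_hom_def)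
qed

text \<open>Independence of the representative, in the form of the definite description that
  \<open>xt_co\<close> uses and that the connecting map will use.\<close>

lemma coh_hom_the:
  assumes T: "coh_hom P n X Q m Y T" and P: "aug_complex A P" and Q: "aug_complex B Q"
    and \<phi>: "\<phi> \<in> cocycles \<C> P n X"
  shows "(THE c'. \<exists>\<psi> \<in> coh_class \<C> P n X \<phi>. c' = coh_class \<C> Q m Y (T \<psi>)) = coh_class \<C> Q m Y (T \<phi>)"
proof (rule the_equality)
  show "\<exists>\<psi> \<in> coh_class \<C> P n X \<phi>. coh_class \<C> Q m Y (T \<phi>) = coh_class \<C> Q m Y (T \<psi>)"
    using coh_class_self[OF P \<phi>] by blast
  show "c' = coh_class \<C> Q m Y (T \<phi>)" if "\<exists>\<psi> \<in> coh_class \<C> P n X \<phi>. c' = coh_class \<C> Q m Y (T \<psi>)" for c'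
    using that coh_class_mem[OF P \<phi>] coh_homD(2)[OF T P Q _ \<phi>] by blast
qed

lemma xt_homI:
  assumes T: "coh_hom (R M) n X (R N) m Y T" and P: "aug_complex A (R M)" and Q: "aug_complex B (R N)"
    and h: "\<And>\<phi>. \<phi> \<in> cocycles \<C> (R M) n X \<Longrightarrow> h (coh_class \<C> (R M) n X \<phi>) = coh_class \<C> (R N) m Y (T \<phi>)"
  shows "h \<in> hom (xt \<C> R n M X) (xt \<C> R m N Y)"
proof (rule homI)
  fix a assume "a \<in> carrier (xt \<C> R n M X)"
  then show "h a \<in> carrier (xt \<C> R m N Y)"
    using h coh_homD(1)[OF T P Q] by (auto simp: xt_carrier[where A = A and R = R and M = M, OF P] xt_carrier[where A = B and R = R and M = N, OF Q])
next
  fix a b assume "a \<in> carrier (xt \<C> R n M X)" "b \<in> carrier (xt \<C> R n M X)"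
  then obtain \<phi> \<psi> where ab: "\<phi> \<in> cocycles \<C> (R M) n X" "a = coh_class \<C> (R M) n X \<phi>"
    "\<psi> \<in> cocycles \<C> (R M) n X" "b = coh_class \<C> (R M) n X \<psi>"
    by (auto simp: xt_carrier[where A = A and R = R and M = M, OF P])
  have "T (\<phi> \<boxplus> \<psi>) = T \<phi> \<boxplus> T \<psi>" using T ab by (simp add: coh_hom_def)
  then show "h (a \<otimes>\<^bsub>xt \<C> R n M X\<^esub> b) = h a \<otimes>\<^bsub>xt \<C> R m N Y\<^esub> h b"
    using ab h coh_homD(1)[OF T P Q] cocycles_closed(1)[OF P]
    by (simp add: xt_mult[where A = A and R = R and M = M, OF P] xt_mult[where A = B and R = R and M = N, OF Q])
qed

text \<open>Reduces exactness at one place to a statement on cocycles: the class of \<phi> maps to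
  zero if and only if it is the class of some \<open>T \<psi>\<close>.\<close>

lemma xt_exactI:
  assumes P: "aug_complex A (R L)" and Q: "aug_complex B (R M)" and S: "aug_complex C (R N)"
    and T: "coh_hom (R L) l X (R M) m Y T" and U: "coh_hom (R M) m Y (R N) n Z U"
    and h: "\<And>\<phi>. \<phi> \<in> cocycles \<C> (R L) l X \<Longrightarrow> h (coh_class \<C> (R L) l X \<phi>) = coh_class \<C> (R M) m Y (T \<phi>)"
    and g: "\<And>\<phi>. \<phi> \<in> cocycles \<C> (R M) m Y \<Longrightarrow> g (coh_class \<C> (R M) m Y \<phi>) = coh_class \<C> (R N) n Z (U \<phi>)"
    and ex: "\<And>\<phi>. \<phi> \<in> cocycles \<C> (R M) m Y \<Longrightarrow> U \<phi> \<in> coboundaries \<C> (R N) n Z \<longleftrightarrow>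
      (\<exists>\<psi> \<in> cocycles \<C> (R L) l X. coh_class \<C> (R M) m Y \<phi> = coh_class \<C> (R M) m Y (T \<psi>))"
  shows "kernel (xt \<C> R m M Y) (xt \<C> R n N Z) g = h ` carrier (xt \<C> R l L X)"
proof -
  note cP = xt_carrier[where A = A and R = R and M = L, OF P]
    and cQ = xt_carrier[where A = B and R = R and M = M, OF Q]
    and oS = xt_one[where A = C and R = R and M = N, OF S]
  have "kernel (xt \<C> R m M Y) (xt \<C> R n N Z) g =
      {coh_class \<C> (R M) m Y \<phi> | \<phi>. \<phi> \<in> cocycles \<C> (R M) m Y \<and> U \<phi> \<in> coboundaries \<C> (R N) n Z}"
    unfolding kernel_def cQ oS
    using coh_class_coboundary_iff[OF S coh_homD(1)[OF U Q S]] g by (blast | force)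
  also have "\<dots> = {coh_class \<C> (R M) m Y (T \<psi>) | \<psi>. \<psi> \<in> cocycles \<C> (R L) l X}"
    using ex coh_homD(1)[OF T P Q] by blast
  also have "\<dots> = h ` carrier (xt \<C> R l L X)" unfolding cP image_image using h by force
  finally show ?thesis .
qed

lemma coh_hom_lift:
  assumes P: "aug_complex A P" and Q: "aug_complex B Q" and F: "lifts \<C> P Q f F"
  shows "coh_hom Q n X P n X (\<lambda>\<phi>. \<phi> \<cdot> F n)"
proof -
  have m: "arr (F n)" "src (F n) = robj P n" "tgt (F n) = robj Q n" for n
    using F unfolding lifts_def mor_iff by blast+
  have e: "rdif Q (Suc n) \<cdot> F (Suc n) = F n \<cdot> rdif P (Suc n)" for n
    using F unfolding lifts_def by blast
  note p = aug_complexD[OF P, where n = "Suc k" for k, unfolded aug_simps]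
    and q = aug_complexD[OF Q, where n = "Suc k" for k, unfolded aug_simps]
  have ec: "\<phi> \<cdot> (F k \<cdot> rdif P (Suc k)) = (\<phi> \<cdot> rdif Q (Suc k)) \<cdot> F (Suc k)"
    if "arr \<phi>" "src \<phi> = robj Q k" for \<phi> k
    using that m q by (simp add: cmp_assoc' e)
  show ?thesis unfolding coh_hom_def
  proof (intro conjI ballI)
    fix \<phi> assume "\<phi> \<in> cocycles \<C> Q n X"
    then show "\<phi> \<cdot> F n \<in> cocycles \<C> P n X"
      using m p ec[of \<phi> n] by (simp add: cocycles_iff mor_iff cmp_arr cmp_assoc' zero_cmp)
  next
    fix \<phi> assume \<phi>: "\<phi> \<in> coboundaries \<C> Q n X"
    show "\<phi> \<cdot> F n \<in> coboundaries \<C> P n X"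
    proof (cases n)
      case 0
      then show ?thesis using \<phi> m by (simp add: coboundaries_0 zero_cmp)
    next
      case (Suc k)
      then obtain \<psi> where "\<psi> \<in> Mor \<C> (robj Q k) X" "\<phi> = \<psi> \<cdot> rdif Q (Suc k)"
        using \<phi> by (auto simp: coboundaries_Suc)
      then show ?thesis using Suc m p q
        by (auto simp: coboundaries_Suc mor_iff cmp_arr cmp_assoc' e intro!: bexI[of _ "\<psi> \<cdot> F k"])
    qed
  next
    fix \<phi> \<psi> assume "\<phi> \<in> cocycles \<C> Q n X" "\<psi> \<in> cocycles \<C> Q n X"
    then show "(\<phi> \<boxplus> \<psi>) \<cdot> F n = (\<phi> \<cdot> F n) \<boxplus> (\<psi> \<cdot> F n)"
      using m by (simp add: cocycles_iff mor_iff madd_cmp)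
  qed
qed

text \<open>Composing the homotopy identity with a cocycle \<phi> kills the term that starts with
  the differential of \<open>Q\<close>, and the other term is the coboundary of
  \<open>\<phi> \<cdot> h k\<close>. In degree 0 that other term is absent, matching the fact that
  zero is the only coboundary there.\<close>

lemma coh_class_lifts_eq:
  assumes P: "aug_complex A P" "\<And>n. robj P n \<in> \<W>" and Q: "hom_acyclic \<W> B Q" and f: "f \<in> Mor \<C> A B"
    and F: "lifts \<C> P Q f F" and G: "lifts \<C> P Q f G" and \<phi>: "\<phi> \<in> cocycles \<C> Q n X"
  shows "coh_class \<C> P n X (\<phi> \<cdot> F n) = coh_class \<C> P n X (\<phi> \<cdot> G n)"
proof -
  have Q': "aug_complex B Q" using Q by (simp add: hom_acyclic_def)
  note p = aug_complexD[OF P(1), where n = "Suc k" for k, unfolded aug_simps]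
    and q = aug_complexD[OF Q', where n = "Suc k" for k, unfolded aug_simps]
  have m: "arr (F n)" "src (F n) = robj P n" "tgt (F n) = robj Q n" "arr (G n)" "src (G n) = robj P n" "tgt (G n) = robj Q n" for n
    using F G unfolding lifts_def mor_iff by blast+
  obtain h where h: "\<And>n. h n \<in> Mor \<C> (robj P n) (robj Q (Suc n))"
    "F 0 \<boxplus> \<boxminus> G 0 = rdif Q (Suc 0) \<cdot> h 0"
    "\<And>n. F (Suc n) \<boxplus> \<boxminus> G (Suc n) = (rdif Q (Suc (Suc n)) \<cdot> h (Suc n)) \<boxplus> (h n \<cdot> rdif P (Suc n))"
    using lifts_homotopic[OF P Q f F G] by blast
  have \<phi>m: "arr \<phi>" "src \<phi> = robj Q n" "tgt \<phi> = X" and \<phi>z: "\<phi> \<cdot> rdif Q (Suc n) = zero_mor \<C> (robj Q (Suc n)) X"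
    using \<phi> by (simp_all add: cocycles_iff mor_iff)
  have z: "\<phi> \<cdot> (rdif Q (Suc n) \<cdot> h n) = zero_mor \<C> (robj P n) X"
    using cmp_eq_extend[OF \<phi>z, of "h n"] \<phi>m q h(1)[of n] by (simp add: mor_iff zero_cmp)
  have e: "(\<phi> \<cdot> F n) \<boxplus> \<boxminus> (\<phi> \<cdot> G n) = \<phi> \<cdot> (F n \<boxplus> \<boxminus> G n)" using m \<phi>m by (simp add: cat_simps)
  have "(\<phi> \<cdot> F n) \<boxplus> \<boxminus> (\<phi> \<cdot> G n) \<in> coboundaries \<C> P n X"
  proof (cases n)
    case 0
    then show ?thesis using z unfolding e by (simp add: coboundaries_0 h(2))
  next
    case (Suc k)
    have "\<phi> \<cdot> (F n \<boxplus> \<boxminus> G n) = (\<phi> \<cdot> h k) \<cdot> rdif P (Suc k)"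
      using z h(1)[of k] h(1)[of n] \<phi>m p q unfolding Suc h(3) by (simp add: cat_simps)
    moreover have "\<phi> \<cdot> h k \<in> Mor \<C> (robj P k) X" using h(1)[of k] \<phi>m Suc by (simp add: arr_simps)
    ultimately show ?thesis unfolding e using Suc by (auto simp: coboundaries_Suc)
  qed
  then show ?thesis
    using coh_class_eq_iff[OF P(1)] coh_homD(1)[OF coh_hom_lift[OF P(1) Q' F] Q' P(1) \<phi>]
      coh_homD(1)[OF coh_hom_lift[OF P(1) Q' G] Q' P(1) \<phi>] by blast
qed

text \<open>Two choices are hidden in the description: the lift, which changes by a homotopy, and
  the representative, which changes by a coboundary.\<close>

lemma xt_contra_class:
  assumes P: "aug_complex A (R A)" "\<And>n. robj (R A) n \<in> \<W>" and Q: "hom_acyclic \<W> B (R B)" and f: "f \<in> Mor \<C> A B"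
    and F: "lifts \<C> (R A) (R B) f F" and \<phi>: "\<phi> \<in> cocycles \<C> (R B) n X"
  shows "xt_contra \<C> R n A B f X (coh_class \<C> (R B) n X \<phi>) = coh_class \<C> (R A) n X (\<phi> \<cdot> F n)"
  unfolding xt_contra_def
proof (rule the_equality)
  have Q': "aug_complex B (R B)" using Q by (simp add: hom_acyclic_def)
  show "\<exists>F' \<psi>. lifts \<C> (R A) (R B) f F' \<and> \<psi> \<in> coh_class \<C> (R B) n X \<phi> \<and>
      coh_class \<C> (R A) n X (\<phi> \<cdot> F n) = coh_class \<C> (R A) n X (\<psi> \<cdot> F' n)"
    using F coh_class_self[OF Q' \<phi>] by blast
  fix c' assume "\<exists>F' \<psi>. lifts \<C> (R A) (R B) f F' \<and> \<psi> \<in> coh_class \<C> (R B) n X \<phi> \<and>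
      c' = coh_class \<C> (R A) n X (\<psi> \<cdot> F' n)"
  then obtain F' \<psi> where *: "lifts \<C> (R A) (R B) f F'" "\<psi> \<in> coh_class \<C> (R B) n X \<phi>"
    "c' = coh_class \<C> (R A) n X (\<psi> \<cdot> F' n)" by blast
  note \<psi> = coh_class_mem[OF Q' \<phi> *(2)]
  have "c' = coh_class \<C> (R A) n X (\<psi> \<cdot> F n)"
    unfolding *(3) by (rule coh_class_lifts_eq[OF P Q f *(1) F \<psi>(1)])
  also have "\<dots> = coh_class \<C> (R A) n X (\<phi> \<cdot> F n)"
    by (rule coh_homD(2)[OF coh_hom_lift[OF P(1) Q' F] Q' P(1) \<psi>(1) \<phi> \<psi>(2)])
  finally show "c' = coh_class \<C> (R A) n X (\<phi> \<cdot> F n)" .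
qed

lemma coh_hom_post:
  assumes P: "aug_complex A P" and u: "u \<in> Mor \<C> X Y"
  shows "coh_hom P n X P n Y (\<lambda>\<phi>. u \<cdot> \<phi>)"
proof -
  note p = aug_complexD[OF P, where n = "Suc k" for k, unfolded aug_simps] and u' = u[unfolded mor_iff]
  show ?thesis unfolding coh_hom_def
  proof (intro conjI ballI)
    fix \<phi> assume \<phi>: "\<phi> \<in> coboundaries \<C> P n X"
    show "u \<cdot> \<phi> \<in> coboundaries \<C> P n Y"
    proof (cases n)
      case 0
      then show ?thesis using \<phi> u' by (simp add: coboundaries_0 cmp_zero)
    next
      case (Suc k)
      then obtain \<psi> where "\<psi> \<in> Mor \<C> (robj P k) X" "\<phi> = \<psi> \<cdot> rdif P (Suc k)"
        using \<phi> by (auto simp: coboundaries_Suc)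
      then show ?thesis using Suc u' p
        by (auto simp: coboundaries_Suc mor_iff cmp_arr cmp_assoc' intro!: bexI[of _ "u \<cdot> \<psi>"])
    qed
  qed (use u' p in \<open>simp_all add: cocycles_iff mor_iff cat_simps\<close>)
qed

lemma xt_co_class:
  assumes P: "aug_complex A (R A)" and u: "u \<in> Mor \<C> X Y" and \<phi>: "\<phi> \<in> cocycles \<C> (R A) n X"
  shows "xt_co \<C> R n A u Y (coh_class \<C> (R A) n X \<phi>) = coh_class \<C> (R A) n Y (u \<cdot> \<phi>)"
  unfolding xt_co_def by (rule coh_hom_the[OF coh_hom_post[OF P u] P P \<phi>])

section \<open>The long exact sequence\<close>

text \<open>
  The off-diagonal entry of the differential of a degreewise split extension of complexes.
\<close>

definition connecting :: "('o, 'm) resolution \<Rightarrow> (nat \<Rightarrow> ('o, 'm) biprod_data) \<Rightarrow> nat \<Rightarrow> 'm"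
  where "connecting R T n = pr1 (T n) \<cdot> (rdif R (Suc n) \<cdot> in2 (T (Suc n)))"

context
  fixes A B C x y P Q R T
  assumes P: "aug_complex A P" and R: "aug_complex B R" and Q: "aug_complex C Q"
    and T: "\<And>n. is_biproduct \<C> (robj P n) (robj Q n) (T n)" and TR: "\<And>n. bobj (T n) = robj R n"
    and i: "lifts \<C> P R x (\<lambda>n. in1 (T n))" and p: "lifts \<C> R Q y (\<lambda>n. pr2 (T n))"
begin

text \<open>Cohomology does not see the augmentation, so only differentials with index
  \<open>Suc k\<close> occur, and for these \<open>aug\<close> reduces to
  \<open>robj\<close>.\<close>

lemmas les_arr = aug_complexD(1-3)[OF P, where n = "Suc k" for k, unfolded aug_simps]
  aug_complexD(1-3)[OF Q, where n = "Suc k" for k, unfolded aug_simps]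
  aug_complexD(1-3)[OF R, where n = "Suc k" for k, unfolded aug_simps]
  biprod_arr[OF T, unfolded TR]

lemmas les_biprod = biprod_eqs(1-4)[OF T] biprod_ext[OF T]

lemma les_in1: "rdif R (Suc n) \<cdot> in1 (T (Suc n)) = in1 (T n) \<cdot> rdif P (Suc n)"
  using i unfolding lifts_def by blast

lemma les_pr2: "pr2 (T n) \<cdot> rdif R (Suc n) = rdif Q (Suc n) \<cdot> pr2 (T (Suc n))"
  using p unfolding lifts_def by simp

lemma les_in1_ext: "\<lbrakk>arr z; tgt z = robj P (Suc n)\<rbrakk>
    \<Longrightarrow> rdif R (Suc n) \<cdot> (in1 (T (Suc n)) \<cdot> z) = in1 (T n) \<cdot> (rdif P (Suc n) \<cdot> z)"
  using cmp_eq_extend[OF les_in1[of n], of z] by (simp add: les_arr cmp_assoc')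

lemma les_pr2_ext: "\<lbrakk>arr z; tgt z = robj R (Suc n)\<rbrakk>
    \<Longrightarrow> pr2 (T n) \<cdot> (rdif R (Suc n) \<cdot> z) = rdif Q (Suc n) \<cdot> (pr2 (T (Suc n)) \<cdot> z)"
  using cmp_eq_extend[OF les_pr2[of n], of z] by (simp add: les_arr cmp_assoc')

lemma connecting_arr:
  "arr (connecting R T n)" "src (connecting R T n) = robj Q (Suc n)" "tgt (connecting R T n) = robj P n"
  by (simp_all add: connecting_def les_arr cmp_arr)

text \<open>Second column of the differential of \<open>R\<close>, written as an upper triangular
  matrix with the differentials of \<open>P\<close> and \<open>Q\<close> on the diagonal.\<close>

lemma les_dif_in2:
  "rdif R (Suc n) \<cdot> in2 (T (Suc n)) = (in1 (T n) \<cdot> connecting R T n) \<boxplus> (in2 (T n) \<cdot> rdif Q (Suc n))"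
  using biprod_split_into[OF T[of n], of "rdif R (Suc n) \<cdot> in2 (T (Suc n))"]
  by (simp add: connecting_def les_arr les_biprod les_pr2_ext cat_simps TR)

text \<open>First row of the same matrix.\<close>

lemma les_pr1_dif:
  "pr1 (T n) \<cdot> rdif R (Suc n) = (rdif P (Suc n) \<cdot> pr1 (T (Suc n))) \<boxplus> (connecting R T n \<cdot> pr2 (T (Suc n)))"
  using biprod_split_from[OF T[of "Suc n"], of "pr1 (T n) \<cdot> rdif R (Suc n)"]
  by (simp add: connecting_def les_arr les_biprod les_in1_ext cat_simps TR)

text \<open>The upper right entry of the squared differential of \<open>R\<close>, which is zero:
  the off-diagonal entry is a chain map up to sign.\<close>

lemma connecting_dif:
  "connecting R T n \<cdot> rdif Q (Suc (Suc n)) = \<boxminus> (rdif P (Suc n) \<cdot> connecting R T (Suc n))"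
proof (rule mneg_unique)
  let ?v = "rdif R (Suc (Suc n)) \<cdot> in2 (T (Suc (Suc n)))"
  have v: "arr ?v" "src ?v = robj Q (Suc (Suc n))" "tgt ?v = robj R (Suc n)"
    by (simp_all add: les_arr cmp_arr)
  have "pr1 (T n) \<cdot> (rdif R (Suc n) \<cdot> ?v) = zero_mor \<C> (robj Q (Suc (Suc n))) (robj P n)"
    using aug_complexD(5)[OF R, where z = "in2 (T (Suc (Suc n)))" and n = "Suc n"] by (simp add: les_arr cmp_zero)
  moreover have "pr1 (T n) \<cdot> (rdif R (Suc n) \<cdot> ?v) =
      (rdif P (Suc n) \<cdot> (pr1 (T (Suc n)) \<cdot> ?v)) \<boxplus> (connecting R T n \<cdot> (pr2 (T (Suc n)) \<cdot> ?v))"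
    using cmp_eq_extend[OF les_pr1_dif[of n], of ?v] v by (simp add: les_arr connecting_arr cmp_arr cmp_assoc' madd_cmp)
  moreover have "pr1 (T (Suc n)) \<cdot> ?v = connecting R T (Suc n)" by (simp add: connecting_def)
  moreover have "pr2 (T (Suc n)) \<cdot> ?v = rdif Q (Suc (Suc n))"
    by (simp add: les_pr2_ext les_arr les_biprod idn_cmp)
  ultimately show "(rdif P (Suc n) \<cdot> connecting R T (Suc n)) \<boxplus> (connecting R T n \<cdot> rdif Q (Suc (Suc n))) =
      zero_mor \<C> (src (rdif P (Suc n) \<cdot> connecting R T (Suc n))) (tgt (rdif P (Suc n) \<cdot> connecting R T (Suc n)))"
    by (simp add: les_arr connecting_arr cmp_arr)
qed (simp_all add: les_arr connecting_arr cmp_arr)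

lemma connecting_dif_ext: "\<lbrakk>arr \<phi>; src \<phi> = robj P n\<rbrakk>
    \<Longrightarrow> \<phi> \<cdot> (connecting R T n \<cdot> rdif Q (Suc (Suc n))) = \<boxminus> ((\<phi> \<cdot> rdif P (Suc n)) \<cdot> connecting R T (Suc n))"
  by (simp add: connecting_dif les_arr connecting_arr cmp_arr cmp_mneg cmp_assoc')

text \<open>The sign in \<open>connecting_dif\<close> does no harm: zero stays zero for cocycles,
  and for coboundaries the sign is absorbed into the primitive.\<close>

lemma coh_hom_connecting: "coh_hom P n X Q (Suc n) X (\<lambda>\<phi>. \<phi> \<cdot> connecting R T n)"
  unfolding coh_hom_def
proof (intro conjI ballI)
  fix \<phi> assume "\<phi> \<in> cocycles \<C> P n X"
  then show "\<phi> \<cdot> connecting R T n \<in> cocycles \<C> Q (Suc n) X"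
    using connecting_dif_ext[of \<phi> n]
    by (simp add: cocycles_iff mor_iff cmp_arr les_arr connecting_arr cmp_assoc' zero_cmp mneg_madd)
next
  fix \<phi> assume \<phi>: "\<phi> \<in> coboundaries \<C> P n X"
  show "\<phi> \<cdot> connecting R T n \<in> coboundaries \<C> Q (Suc n) X"
  proof (cases n)
    case 0
    then show ?thesis using \<phi> by (auto simp: coboundaries_0 coboundaries_Suc les_arr connecting_arr cat_simps
          intro!: bexI[of _ "zero_mor \<C> (robj Q 0) X"])
  next
    case (Suc k)
    then obtain \<psi> where \<psi>: "\<psi> \<in> Mor \<C> (robj P k) X" "\<phi> = \<psi> \<cdot> rdif P (Suc k)"
      using \<phi> unfolding Suc coboundaries_Suc by blast
    have "\<phi> \<cdot> connecting R T n = (\<boxminus> (\<psi> \<cdot> connecting R T k)) \<cdot> rdif Q (Suc (Suc k))"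
      using connecting_dif_ext[of \<psi> k] \<psi> Suc by (simp add: les_arr connecting_arr cat_simps)
    moreover have "\<boxminus> (\<psi> \<cdot> connecting R T k) \<in> Mor \<C> (robj Q n) X"
      using \<psi> Suc by (simp add: connecting_arr arr_simps)
    ultimately show ?thesis using Suc by (auto simp: coboundaries_Suc)
  qed
next
  fix \<phi> \<psi> assume "\<phi> \<in> cocycles \<C> P n X" "\<psi> \<in> cocycles \<C> P n X"
  then show "(\<phi> \<boxplus> \<psi>) \<cdot> connecting R T n = (\<phi> \<cdot> connecting R T n) \<boxplus> (\<psi> \<cdot> connecting R T n)"
    by (simp add: cocycles_iff mor_iff connecting_arr madd_cmp)
qed

lemma les_middle:
  assumes \<phi>: "\<phi> \<in> cocycles \<C> R n X"
  shows "\<phi> \<cdot> in1 (T n) \<in> coboundaries \<C> P n X \<longleftrightarrow>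
    (\<exists>\<psi> \<in> cocycles \<C> Q n X. coh_class \<C> R n X \<phi> = coh_class \<C> R n X (\<psi> \<cdot> pr2 (T n)))"
proof
  note \<phi>a = cocycles_arr[OF \<phi>]
  assume c: "\<phi> \<cdot> in1 (T n) \<in> coboundaries \<C> P n X"
  \<comment> \<open>The degreewise splitting extends a primitive on \<open>P\<close> to
    \<open>R\<close> through \<open>pr1\<close>. Subtracting the resulting coboundary leaves a
    cocycle in the same class that vanishes on \<open>P\<close>.\<close>
  have "\<exists>w \<in> coboundaries \<C> R n X. w \<cdot> in1 (T n) = \<phi> \<cdot> in1 (T n)"
  proof (cases n)
    case 0
    then show ?thesis using c \<phi>a by (simp add: coboundaries_0 les_arr zero_cmp)
  next
    case (Suc k)
    then obtain u where u: "u \<in> Mor \<C> (robj P k) X" "\<phi> \<cdot> in1 (T n) = u \<cdot> rdif P (Suc k)"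
      using c unfolding Suc coboundaries_Suc by blast
    have "(u \<cdot> pr1 (T k)) \<cdot> rdif R (Suc k) \<in> coboundaries \<C> R n X"
      using u Suc by (auto simp: coboundaries_Suc les_arr arr_simps intro!: bexI[of _ "u \<cdot> pr1 (T k)"])
    moreover have "((u \<cdot> pr1 (T k)) \<cdot> rdif R (Suc k)) \<cdot> in1 (T n) = \<phi> \<cdot> in1 (T n)"
      using u Suc by (simp add: les_arr mor_iff cmp_arr cmp_assoc' les_in1 les_biprod)
    ultimately show ?thesis by blast
  qed
  then obtain w where w: "w \<in> coboundaries \<C> R n X" "w \<cdot> in1 (T n) = \<phi> \<cdot> in1 (T n)" by blast
  have wz: "w \<in> cocycles \<C> R n X" using w coboundaries_cocycles[OF R] by blast
  define \<phi>' where "\<phi>' = \<phi> \<boxplus> \<boxminus> w"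
  have \<phi>': "\<phi>' \<in> cocycles \<C> R n X" unfolding \<phi>'_def using \<phi> wz cocycles_closed[OF R] by blast
  note wa = cocycles_arr[OF wz] and \<phi>'a = cocycles_arr[OF \<phi>']
  have z: "\<phi>' \<cdot> in1 (T n) = zero_mor \<C> (robj P n) X"
    unfolding \<phi>'_def using w(2) \<phi>a wa by (simp add: les_arr cat_simps)
  have eq: "(\<phi>' \<cdot> in2 (T n)) \<cdot> pr2 (T n) = \<phi>'"
    using biprod_split_from[OF T[of n], of \<phi>'] cmp_eq_extend[OF z, of "pr1 (T n)"] \<phi>'a
    by (simp add: TR les_arr cat_simps)
  have zd: "\<phi>' \<cdot> rdif R (Suc n) = zero_mor \<C> (robj R (Suc n)) X" using \<phi>' by (simp add: cocycles_iff)
  \<comment> \<open>\<open>in2\<close> is not a chain map, so the cocycle condition is tested after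
    inserting \<open>pr2\<close>, which is one, and using that \<phi>' factors through
    \<open>pr2\<close>.\<close>
  have "(\<phi>' \<cdot> in2 (T n)) \<cdot> rdif Q (Suc n) = (\<phi>' \<cdot> in2 (T n)) \<cdot> (pr2 (T n) \<cdot> (rdif R (Suc n) \<cdot> in2 (T (Suc n))))"
    by (simp add: les_pr2_ext les_arr les_biprod idn_cmp)
  also have "\<dots> = ((\<phi>' \<cdot> in2 (T n)) \<cdot> pr2 (T n)) \<cdot> (rdif R (Suc n) \<cdot> in2 (T (Suc n)))"
    using \<phi>'a by (simp add: les_arr cmp_arr cmp_assoc')
  also have "\<dots> = zero_mor \<C> (robj Q (Suc n)) X"
    unfolding eq using cmp_eq_extend[OF zd, of "in2 (T (Suc n))"] \<phi>'a by (simp add: les_arr zero_cmp)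
  finally have "\<phi>' \<cdot> in2 (T n) \<in> cocycles \<C> Q n X"
    using \<phi>'a by (simp add: cocycles_iff arr_simps les_arr)
  moreover have "coh_class \<C> R n X \<phi> = coh_class \<C> R n X \<phi>'"
    using coh_class_eq_iff[OF R \<phi> \<phi>'] w(1) \<phi>a wa by (simp add: \<phi>'_def cat_simps)
  ultimately show "\<exists>\<psi> \<in> cocycles \<C> Q n X. coh_class \<C> R n X \<phi> = coh_class \<C> R n X (\<psi> \<cdot> pr2 (T n))"
    using eq by force
next
  assume "\<exists>\<psi> \<in> cocycles \<C> Q n X. coh_class \<C> R n X \<phi> = coh_class \<C> R n X (\<psi> \<cdot> pr2 (T n))"
  then obtain \<psi> where \<psi>: "\<psi> \<in> cocycles \<C> Q n X" "coh_class \<C> R n X \<phi> = coh_class \<C> R n X (\<psi> \<cdot> pr2 (T n))"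
    by blast
  have c: "\<psi> \<cdot> pr2 (T n) \<in> cocycles \<C> R n X" by (rule coh_homD(1)[OF coh_hom_lift[OF R Q p] Q R \<psi>(1)])
  have "(\<psi> \<cdot> pr2 (T n)) \<cdot> in1 (T n) = zero_mor \<C> (robj P n) X"
    using cocycles_arr[OF \<psi>(1)] by (simp add: les_arr les_biprod cmp_assoc' cmp_zero)
  then have "(\<psi> \<cdot> pr2 (T n)) \<cdot> in1 (T n) \<in> coboundaries \<C> P n X" using coboundaries_closed(1)[OF P] by simp
  then show "\<phi> \<cdot> in1 (T n) \<in> coboundaries \<C> P n X"
    using coh_homD[OF coh_hom_lift[OF P R i] R P \<phi>] \<psi>(2) c coh_class_coboundary_iff[OF P]
      coh_homD(1)[OF coh_hom_lift[OF P R i] R P c] by metis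
qed

lemma les_left:
  assumes \<phi>: "\<phi> \<in> cocycles \<C> P n X"
  shows "\<phi> \<cdot> connecting R T n \<in> coboundaries \<C> Q (Suc n) X \<longleftrightarrow>
    (\<exists>\<psi> \<in> cocycles \<C> R n X. coh_class \<C> P n X \<phi> = coh_class \<C> P n X (\<psi> \<cdot> in1 (T n)))"
proof
  note \<phi>a = cocycles_arr[OF \<phi>]
  have \<phi>z: "\<phi> \<cdot> rdif P (Suc n) = zero_mor \<C> (robj P (Suc n)) X" using \<phi> by (simp add: cocycles_iff)
  assume "\<phi> \<cdot> connecting R T n \<in> coboundaries \<C> Q (Suc n) X"
  then obtain \<chi> where \<chi>: "\<chi> \<in> Mor \<C> (robj Q n) X" "\<phi> \<cdot> connecting R T n = \<chi> \<cdot> rdif Q (Suc n)"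
    by (auto simp: coboundaries_Suc)
  \<comment> \<open>\<open>\<phi> \<cdot> pr1\<close> extends \<phi> to \<open>R\<close>, and its
    coboundary is \<open>\<phi> \<cdot> connecting\<close> composed with \<open>pr2\<close>. The
    primitive \<chi> of that obstruction is subtracted to make the extension a cocycle.\<close>
  let ?\<psi> = "(\<phi> \<cdot> pr1 (T n)) \<boxplus> \<boxminus> (\<chi> \<cdot> pr2 (T n))"
  have "\<phi> \<cdot> (pr1 (T n) \<cdot> rdif R (Suc n)) = \<chi> \<cdot> (rdif Q (Suc n) \<cdot> pr2 (T (Suc n)))"
    using cmp_eq_extend[OF \<phi>z, of "pr1 (T (Suc n))"] cmp_eq_extend[OF \<chi>(2), of "pr2 (T (Suc n))"] \<phi>a \<chi>(1)
    by (simp add: les_pr1_dif les_arr connecting_arr cat_simps)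
  then have "?\<psi> \<in> cocycles \<C> R n X"
    using \<phi>a \<chi>(1) by (simp add: cocycles_iff les_arr les_pr2 cat_simps)
  moreover have "?\<psi> \<cdot> in1 (T n) = \<phi>"
    using \<phi>a \<chi>(1) by (simp add: les_arr les_biprod cat_simps)
  ultimately show "\<exists>\<psi> \<in> cocycles \<C> R n X. coh_class \<C> P n X \<phi> = coh_class \<C> P n X (\<psi> \<cdot> in1 (T n))"
    by force
next
  assume "\<exists>\<psi> \<in> cocycles \<C> R n X. coh_class \<C> P n X \<phi> = coh_class \<C> P n X (\<psi> \<cdot> in1 (T n))"
  then obtain \<psi> where \<psi>: "\<psi> \<in> cocycles \<C> R n X" "coh_class \<C> P n X \<phi> = coh_class \<C> P n X (\<psi> \<cdot> in1 (T n))"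
    by blast
  note \<psi>a = cocycles_arr[OF \<psi>(1)]
  have \<psi>z: "\<psi> \<cdot> rdif R (Suc n) = zero_mor \<C> (robj R (Suc n)) X" using \<psi>(1) by (simp add: cocycles_iff)
  have c: "\<psi> \<cdot> in1 (T n) \<in> cocycles \<C> P n X" by (rule coh_homD(1)[OF coh_hom_lift[OF P R i] R P \<psi>(1)])
  \<comment> \<open>The cocycle condition for \<psi>, restricted to the second summand: it exhibits
    the restriction of \<psi> to \<open>Q\<close>, with a sign, as a primitive of the connecting
    image.\<close>
  have "(\<psi> \<cdot> (in1 (T n) \<cdot> connecting R T n)) \<boxplus> (\<psi> \<cdot> (in2 (T n) \<cdot> rdif Q (Suc n))) = zero_mor \<C> (robj Q (Suc n)) X"
    using cmp_eq_extend[OF \<psi>z, of "in2 (T (Suc n))"] \<psi>a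
    by (simp add: les_dif_in2 les_arr connecting_arr cat_simps)
  then have "(\<psi> \<cdot> (in2 (T n) \<cdot> rdif Q (Suc n))) = \<boxminus> (\<psi> \<cdot> (in1 (T n) \<cdot> connecting R T n))"
    using \<psi>a by (intro mneg_unique) (simp_all add: les_arr connecting_arr cmp_arr)
  then have "(\<psi> \<cdot> in1 (T n)) \<cdot> connecting R T n = (\<boxminus> (\<psi> \<cdot> in2 (T n))) \<cdot> rdif Q (Suc n)"
    using \<psi>a by (simp add: les_arr connecting_arr cat_simps)
  moreover have "\<boxminus> (\<psi> \<cdot> in2 (T n)) \<in> Mor \<C> (robj Q n) X" using \<psi>a by (simp add: les_arr arr_simps)
  ultimately have "(\<psi> \<cdot> in1 (T n)) \<cdot> connecting R T n \<in> coboundaries \<C> Q (Suc n) X"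
    by (auto simp: coboundaries_Suc)
  then show "\<phi> \<cdot> connecting R T n \<in> coboundaries \<C> Q (Suc n) X"
    using coh_homD[OF coh_hom_connecting P Q \<phi>] \<psi>(2) c coh_class_coboundary_iff[OF Q]
      coh_homD(1)[OF coh_hom_connecting P Q c] by metis
qed

lemma les_right:
  assumes \<phi>: "\<phi> \<in> cocycles \<C> Q (Suc n) X"
  shows "\<phi> \<cdot> pr2 (T (Suc n)) \<in> coboundaries \<C> R (Suc n) X \<longleftrightarrow>
    (\<exists>\<psi> \<in> cocycles \<C> P n X. coh_class \<C> Q (Suc n) X \<phi> = coh_class \<C> Q (Suc n) X (\<psi> \<cdot> connecting R T n))"
proof
  note \<phi>a = cocycles_arr[OF \<phi>]
  assume "\<phi> \<cdot> pr2 (T (Suc n)) \<in> coboundaries \<C> R (Suc n) X"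
  then obtain \<psi> where \<psi>: "\<psi> \<in> Mor \<C> (robj R n) X" "\<phi> \<cdot> pr2 (T (Suc n)) = \<psi> \<cdot> rdif R (Suc n)"
    by (auto simp: coboundaries_Suc)
  note \<psi>a = \<psi>(1)[unfolded mor_iff]
  \<comment> \<open>The identity \<open>\<phi> \<cdot> pr2 = \<psi> \<cdot> rdif R\<close> is read
    on each summand. On \<open>P\<close> it says that \<open>\<psi> \<cdot> in1\<close> is a
    cocycle; on \<open>Q\<close> it says that \<phi> is the connecting image of that cocycle plus a
    coboundary.\<close>
  have "\<psi> \<cdot> (rdif R (Suc n) \<cdot> in1 (T (Suc n))) = \<phi> \<cdot> (pr2 (T (Suc n)) \<cdot> in1 (T (Suc n)))"
    using \<psi> \<psi>a \<phi>a by (simp add: les_arr cmp_assoc'[symmetric])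
  then have c: "\<psi> \<cdot> in1 (T n) \<in> cocycles \<C> P n X"
    using \<phi>a \<psi>a by (simp add: cocycles_iff arr_simps les_arr les_in1 les_biprod cmp_zero cmp_assoc')
  have "\<psi> \<cdot> (rdif R (Suc n) \<cdot> in2 (T (Suc n))) = \<phi> \<cdot> (pr2 (T (Suc n)) \<cdot> in2 (T (Suc n)))"
    using \<psi> \<psi>a \<phi>a by (simp add: les_arr cmp_assoc'[symmetric])
  then have "(\<psi> \<cdot> (in1 (T n) \<cdot> connecting R T n)) \<boxplus> (\<psi> \<cdot> (in2 (T n) \<cdot> rdif Q (Suc n))) = \<phi>"
    using \<phi>a \<psi>a by (simp add: les_dif_in2 les_arr connecting_arr les_biprod cmp_arr idn_cmp cmp_madd)
  then have "\<phi> \<boxplus> \<boxminus> ((\<psi> \<cdot> in1 (T n)) \<cdot> connecting R T n) = (\<psi> \<cdot> in2 (T n)) \<cdot> rdif Q (Suc n)"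
    using \<psi>a madd_comm[of "\<psi> \<cdot> (in1 (T n) \<cdot> connecting R T n)" "\<psi> \<cdot> (in2 (T n) \<cdot> rdif Q (Suc n))"]
    by (auto simp: les_arr connecting_arr cat_simps)
  moreover have "\<psi> \<cdot> in2 (T n) \<in> Mor \<C> (robj Q n) X" using \<psi>a by (simp add: arr_simps les_arr)
  ultimately have "\<phi> \<boxplus> \<boxminus> ((\<psi> \<cdot> in1 (T n)) \<cdot> connecting R T n) \<in> coboundaries \<C> Q (Suc n) X"
    by (auto simp: coboundaries_Suc)
  then show "\<exists>\<psi> \<in> cocycles \<C> P n X. coh_class \<C> Q (Suc n) X \<phi> = coh_class \<C> Q (Suc n) X (\<psi> \<cdot> connecting R T n)"
    using coh_class_eq_iff[OF Q \<phi> coh_homD(1)[OF coh_hom_connecting P Q c]] c by blast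
next
  assume "\<exists>\<psi> \<in> cocycles \<C> P n X. coh_class \<C> Q (Suc n) X \<phi> = coh_class \<C> Q (Suc n) X (\<psi> \<cdot> connecting R T n)"
  then obtain \<psi> where \<psi>: "\<psi> \<in> cocycles \<C> P n X"
    "coh_class \<C> Q (Suc n) X \<phi> = coh_class \<C> Q (Suc n) X (\<psi> \<cdot> connecting R T n)"
    by blast
  note \<psi>a = cocycles_arr[OF \<psi>(1)]
  have \<psi>z: "\<psi> \<cdot> rdif P (Suc n) = zero_mor \<C> (robj P (Suc n)) X" using \<psi>(1) by (simp add: cocycles_iff)
  have c: "\<psi> \<cdot> connecting R T n \<in> cocycles \<C> Q (Suc n) X" by (rule coh_homD(1)[OF coh_hom_connecting P Q \<psi>(1)])
  \<comment> \<open>By the first row of the differential: the diagonal entry contributes nothing,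
    since \<psi> is a cocycle.\<close>
  have "(\<psi> \<cdot> connecting R T n) \<cdot> pr2 (T (Suc n)) = (\<psi> \<cdot> pr1 (T n)) \<cdot> rdif R (Suc n)"
    using cmp_eq_extend[OF \<psi>z, of "pr1 (T (Suc n))"] \<psi>a
    by (simp add: les_pr1_dif les_arr connecting_arr cat_simps)
  moreover have "\<psi> \<cdot> pr1 (T n) \<in> Mor \<C> (robj R n) X" using \<psi>a by (simp add: les_arr arr_simps)
  ultimately have "(\<psi> \<cdot> connecting R T n) \<cdot> pr2 (T (Suc n)) \<in> coboundaries \<C> R (Suc n) X"
    by (auto simp: coboundaries_Suc)
  then show "\<phi> \<cdot> pr2 (T (Suc n)) \<in> coboundaries \<C> R (Suc n) X"
    using coh_homD[OF coh_hom_lift[OF R Q p] Q R \<phi>] \<psi>(2) c coh_class_coboundary_iff[OF R]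
      coh_homD(1)[OF coh_hom_lift[OF R Q p] Q R c] by metis
qed

end
end

section \<open>The sequence computed from the chosen resolutions\<close>

context proper_class
begin

theorem xt_long_exact_sequence:
  assumes dl: "gp_triangle A x B y C \<delta>" and A: "A \<in> Res \<C> \<xi>" and C: "C \<in> Res \<C> \<xi>"
    and R: "\<And>M. M \<in> Res \<C> \<xi> \<Longrightarrow> proper_GProj_resolution \<C> \<xi> M (R M)"
  shows "B \<in> Res \<C> \<xi> \<and>
    (\<exists>conn :: nat \<Rightarrow> 'o \<Rightarrow> 'm set \<Rightarrow> 'm set.
      (\<forall>n X. conn n X \<in> hom (xt \<C> R n A X) (xt \<C> R (Suc n) C X)) \<and>
      (\<forall>n X X'. \<forall>u \<in> Mor \<C> X X'. \<forall>c \<in> carrier (xt \<C> R n A X).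
        xt_co \<C> R (Suc n) C u X' (conn n X c) = conn n X' (xt_co \<C> R n A u X' c)) \<and>
      (\<forall>X.
        xt_contra \<C> R 0 B C y X \<in> mon (xt \<C> R 0 C X) (xt \<C> R 0 B X) \<and>
        (\<forall>n. exact_seq
          ([xt \<C> R (Suc n) B X, xt \<C> R (Suc n) C X, xt \<C> R n A X, xt \<C> R n B X, xt \<C> R n C X],
           [xt_contra \<C> R (Suc n) B C y X, conn n X, xt_contra \<C> R n A B x X, xt_contra \<C> R n B C y X]))))"
proof -
  obtain S T where S: "proper_GProj_resolution \<C> \<xi> B S"
    and T: "\<And>n. is_biproduct \<C> (robj (R A) n) (robj (R C) n) (T n)" and TR: "\<And>n. bobj (T n) = robj S n"
    and i: "lifts \<C> (R A) S x (\<lambda>n. in1 (T n))" and p: "lifts \<C> S (R C) y (\<lambda>n. pr2 (T n))"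
    using horseshoe[OF dl R[OF A] R[OF C]] by blast
  have B: "B \<in> Res \<C> \<xi>" using S unfolding Res_def by blast
  have m: "x \<in> Mor \<C> A B" "y \<in> Mor \<C> B C"
    using etriD[OF xi_etri[OF conjunct1[OF dl[unfolded gp_triangle_def]]]] by (simp_all add: mor_iff)
  have ac: "hom_acyclic (GProj \<C> \<xi>) A (R A)" "hom_acyclic (GProj \<C> \<xi>) B (R B)"
    "hom_acyclic (GProj \<C> \<xi>) C (R C)" "hom_acyclic (GProj \<C> \<xi>) B S"
    using R A B C S by (auto intro: proper_resolution_acyclic)
  then have cx: "aug_complex A (R A)" "aug_complex B (R B)" "aug_complex C (R C)" "aug_complex B S"
    by (simp_all add: hom_acyclic_def)
  have gp: "robj (R A) n \<in> GProj \<C> \<xi>" "robj (R B) n \<in> GProj \<C> \<xi>" "robj S n \<in> GProj \<C> \<xi>" for n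
    using R[OF A] R[OF B] S unfolding proper_GProj_resolution_def by blast+
  note les = cx(1) cx(4) cx(3) T TR i p
  note idB = idn_closed[of B]
  obtain \<alpha> where \<alpha>: "lifts \<C> S (R B) (Idn \<C> B) \<alpha>" using lifts_exist[OF cx(4) gp(3) ac(2) idB] by blast
  obtain \<beta> where \<beta>: "lifts \<C> (R B) S (Idn \<C> B) \<beta>" using lifts_exist[OF cx(2) gp(2) ac(4) idB] by blast
  \<comment> \<open>Particular lifts of \<open>x\<close> and \<open>y\<close> to the chosen
    resolutions, routed through \<open>S\<close>; since \<open>xt_contra\<close> may be computed
    with any lift, these can be used.\<close>
  define F where "F n = \<alpha> n \<cdot> in1 (T n)" for n
  define G where "G n = pr2 (T n) \<cdot> \<beta> n" for n
  define \<theta> where "\<theta> = connecting S T"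
  have F: "lifts \<C> (R A) (R B) x F"
    using lifts_cmp[OF cx(1) cx(4) cx(2) m(1) idB i \<alpha>] idn_left[OF m(1)] by (simp add: F_def[abs_def])
  have G: "lifts \<C> (R B) (R C) y G"
    using lifts_cmp[OF cx(2) cx(4) cx(3) idB m(2) \<beta> p] idn_right[OF m(2)] by (simp add: G_def[abs_def])
  have la: "arr (\<alpha> n)" "src (\<alpha> n) = robj S n" "tgt (\<alpha> n) = robj (R B) n"
    "arr (\<beta> n)" "src (\<beta> n) = robj (R B) n" "tgt (\<beta> n) = robj S n" for n
    using \<alpha> \<beta> unfolding lifts_def mor_iff by blast+
  note Ta = biprod_arr[OF T, unfolded TR]
  note \<theta>a = connecting_arr[OF les, folded \<theta>_def]
  note hi = coh_hom_lift[OF cx(1) cx(4) i] and hp = coh_hom_lift[OF cx(4) cx(3) p]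
    and h\<alpha> = coh_hom_lift[OF cx(4) cx(2) \<alpha>] and h\<beta> = coh_hom_lift[OF cx(2) cx(4) \<beta>]
    and hF = coh_hom_lift[OF cx(1) cx(2) F] and hG = coh_hom_lift[OF cx(2) cx(3) G]
    and h\<theta> = coh_hom_connecting[OF les, folded \<theta>_def]
  note ci = coh_homD[OF hi cx(4) cx(1)] and cp = coh_homD[OF hp cx(3) cx(4)]
    and c\<alpha> = coh_homD[OF h\<alpha> cx(2) cx(4)] and c\<beta> = coh_homD[OF h\<beta> cx(4) cx(2)]
    and cF = coh_homD[OF hF cx(2) cx(1)] and cG = coh_homD[OF hG cx(3) cx(2)]
    and c\<theta> = coh_homD[OF h\<theta> cx(1) cx(3)]
  \<comment> \<open>Both composites of \<alpha> and \<beta> lift an identity, as do the identity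
    families, so \<alpha> and \<beta> induce mutually inverse maps on cohomology.\<close>
  have \<alpha>\<beta>: "coh_class \<C> (R B) n X ((\<phi> \<cdot> \<alpha> n) \<cdot> \<beta> n) = coh_class \<C> (R B) n X \<phi>"
    if "\<phi> \<in> cocycles \<C> (R B) n X" for \<phi> n X
    using coh_class_lifts_eq[OF cx(2) gp(2) ac(2) idB _ lifts_idn[OF cx(2)] that, of "\<lambda>n. \<alpha> n \<cdot> \<beta> n"]
      lifts_cmp[OF cx(2) cx(4) cx(2) idB idB \<beta> \<alpha>] cocycles_arr[OF that] la
    by (simp add: cmp_assoc' idn_cmp idn_arr)
  have \<beta>\<alpha>: "coh_class \<C> S n X ((\<phi> \<cdot> \<beta> n) \<cdot> \<alpha> n) = coh_class \<C> S n X \<phi>"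
    if "\<phi> \<in> cocycles \<C> S n X" for \<phi> n X
    using coh_class_lifts_eq[OF cx(4) gp(3) ac(4) idB _ lifts_idn[OF cx(4)] that, of "\<lambda>n. \<beta> n \<cdot> \<alpha> n"]
      lifts_cmp[OF cx(4) cx(2) cx(4) idB idB \<alpha> \<beta>] cocycles_arr[OF that] la
    by (simp add: cmp_assoc' idn_cmp idn_arr)
  have Feq: "\<phi> \<cdot> F n = (\<phi> \<cdot> \<alpha> n) \<cdot> in1 (T n)" if "\<phi> \<in> cocycles \<C> (R B) n X" for \<phi> n X
    using cocycles_arr[OF that] la Ta by (simp add: F_def cmp_assoc')
  have Geq: "\<phi> \<cdot> G n = (\<phi> \<cdot> pr2 (T n)) \<cdot> \<beta> n" if "\<phi> \<in> cocycles \<C> (R C) n X" for \<phi> n X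
    using cocycles_arr[OF that] la Ta by (simp add: G_def cmp_assoc')
  have cob\<beta>: "\<phi> \<cdot> \<beta> n \<in> coboundaries \<C> (R B) n X \<longleftrightarrow> \<phi> \<in> coboundaries \<C> S n X"
    if \<phi>: "\<phi> \<in> cocycles \<C> S n X" for \<phi> n X
  proof
    assume "\<phi> \<cdot> \<beta> n \<in> coboundaries \<C> (R B) n X"
    then have "(\<phi> \<cdot> \<beta> n) \<cdot> \<alpha> n \<in> coboundaries \<C> S n X" using h\<alpha> by (simp add: coh_hom_def)
    then show "\<phi> \<in> coboundaries \<C> S n X"
      using \<beta>\<alpha>[OF \<phi>] coh_class_coboundary_iff[OF cx(4)] \<phi> coboundaries_cocycles[OF cx(4)] by metis
  qed (use h\<beta> in \<open>simp add: coh_hom_def\<close>)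
  have exB: "\<phi> \<cdot> F n \<in> coboundaries \<C> (R A) n X \<longleftrightarrow>
      (\<exists>\<psi> \<in> cocycles \<C> (R C) n X. coh_class \<C> (R B) n X \<phi> = coh_class \<C> (R B) n X (\<psi> \<cdot> G n))"
    if \<phi>: "\<phi> \<in> cocycles \<C> (R B) n X" for \<phi> n X
  proof -
    have "coh_class \<C> S n X (\<phi> \<cdot> \<alpha> n) = coh_class \<C> S n X (\<psi> \<cdot> pr2 (T n)) \<longleftrightarrow>
        coh_class \<C> (R B) n X \<phi> = coh_class \<C> (R B) n X (\<psi> \<cdot> G n)"
      if \<psi>: "\<psi> \<in> cocycles \<C> (R C) n X" for \<psi>
    proof
      assume "coh_class \<C> S n X (\<phi> \<cdot> \<alpha> n) = coh_class \<C> S n X (\<psi> \<cdot> pr2 (T n))"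
      from c\<beta>(2)[OF c\<alpha>(1)[OF \<phi>] cp(1)[OF \<psi>] this]
      show "coh_class \<C> (R B) n X \<phi> = coh_class \<C> (R B) n X (\<psi> \<cdot> G n)"
        using \<alpha>\<beta>[OF \<phi>] Geq[OF \<psi>] by simp
    next
      assume "coh_class \<C> (R B) n X \<phi> = coh_class \<C> (R B) n X (\<psi> \<cdot> G n)"
      from c\<alpha>(2)[OF \<phi> cG(1)[OF \<psi>] this]
      show "coh_class \<C> S n X (\<phi> \<cdot> \<alpha> n) = coh_class \<C> S n X (\<psi> \<cdot> pr2 (T n))"
        using \<beta>\<alpha>[OF cp(1)[OF \<psi>]] Geq[OF \<psi>] by simp
    qed
    then show ?thesis using les_middle[OF les c\<alpha>(1)[OF \<phi>]] Feq[OF \<phi>] by simp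
  qed
  have exA: "\<phi> \<cdot> \<theta> n \<in> coboundaries \<C> (R C) (Suc n) X \<longleftrightarrow>
      (\<exists>\<psi> \<in> cocycles \<C> (R B) n X. coh_class \<C> (R A) n X \<phi> = coh_class \<C> (R A) n X (\<psi> \<cdot> F n))"
    if \<phi>: "\<phi> \<in> cocycles \<C> (R A) n X" for \<phi> n X
  proof -
    have "(\<exists>\<psi> \<in> cocycles \<C> S n X. coh_class \<C> (R A) n X \<phi> = coh_class \<C> (R A) n X (\<psi> \<cdot> in1 (T n))) \<longleftrightarrow>
      (\<exists>\<psi> \<in> cocycles \<C> (R B) n X. coh_class \<C> (R A) n X \<phi> = coh_class \<C> (R A) n X (\<psi> \<cdot> F n))"
    proof
      assume "\<exists>\<psi> \<in> cocycles \<C> S n X. coh_class \<C> (R A) n X \<phi> = coh_class \<C> (R A) n X (\<psi> \<cdot> in1 (T n))"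
      then obtain \<psi> where \<psi>: "\<psi> \<in> cocycles \<C> S n X"
        "coh_class \<C> (R A) n X \<phi> = coh_class \<C> (R A) n X (\<psi> \<cdot> in1 (T n))" by blast
      note b = c\<beta>(1)[OF \<psi>(1)]
      show "\<exists>\<psi> \<in> cocycles \<C> (R B) n X. coh_class \<C> (R A) n X \<phi> = coh_class \<C> (R A) n X (\<psi> \<cdot> F n)"
        using ci(2)[OF c\<alpha>(1)[OF b] \<psi>(1) \<beta>\<alpha>[OF \<psi>(1)]] b Feq[OF b] \<psi>(2) by metis
    next
      assume "\<exists>\<psi> \<in> cocycles \<C> (R B) n X. coh_class \<C> (R A) n X \<phi> = coh_class \<C> (R A) n X (\<psi> \<cdot> F n)"
      then show "\<exists>\<psi> \<in> cocycles \<C> S n X. coh_class \<C> (R A) n X \<phi> = coh_class \<C> (R A) n X (\<psi> \<cdot> in1 (T n))"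
        using c\<alpha>(1) Feq by metis
    qed
    then show ?thesis using les_left[OF les \<phi>] by (simp add: \<theta>_def)
  qed
  have exC: "\<phi> \<cdot> G (Suc n) \<in> coboundaries \<C> (R B) (Suc n) X \<longleftrightarrow>
      (\<exists>\<psi> \<in> cocycles \<C> (R A) n X. coh_class \<C> (R C) (Suc n) X \<phi> = coh_class \<C> (R C) (Suc n) X (\<psi> \<cdot> \<theta> n))"
    if \<phi>: "\<phi> \<in> cocycles \<C> (R C) (Suc n) X" for \<phi> n X
    using les_right[OF les \<phi>] cob\<beta>[OF cp(1)[OF \<phi>]] Geq[OF \<phi>] by (simp add: \<theta>_def)
  \<comment> \<open>Only the chosen resolutions of \<open>A\<close> and \<open>C\<close> and the
    entry \<theta> enter here, so unlike the maps induced by \<open>x\<close> and \<open>y\<close>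
    it requires no passage to \<open>R B\<close>.\<close>
  define conn where "conn n X c = (THE c'. \<exists>\<phi> \<in> c. c' = coh_class \<C> (R C) (Suc n) X (\<phi> \<cdot> \<theta> n))" for n X c
  have conn: "conn n X (coh_class \<C> (R A) n X \<phi>) = coh_class \<C> (R C) (Suc n) X (\<phi> \<cdot> \<theta> n)"
    if "\<phi> \<in> cocycles \<C> (R A) n X" for n X \<phi>
    unfolding conn_def by (rule coh_hom_the[OF h\<theta> cx(1) cx(3) that])
  note kx = xt_contra_class[where R = R, OF cx(1) gp(1) ac(2) m(1) F] and ky = xt_contra_class[where R = R, OF cx(2) gp(2) ac(3) m(2) G]
  have Gx: "group (xt \<C> R n A X)" "group (xt \<C> R n B X)" "group (xt \<C> R n C X)" for n X
    using xt_group[where R = R, OF cx(1)] xt_group[where R = R, OF cx(2)] xt_group[where R = R, OF cx(3)] by blast+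
  have hy: "xt_contra \<C> R n B C y X \<in> hom (xt \<C> R n C X) (xt \<C> R n B X)" for n X
    by (rule xt_homI[where R = R, OF hG cx(3) cx(2) ky])
  have hx: "xt_contra \<C> R n A B x X \<in> hom (xt \<C> R n B X) (xt \<C> R n A X)" for n X
    by (rule xt_homI[where R = R, OF hF cx(2) cx(1) kx])
  have hc: "conn n X \<in> hom (xt \<C> R n A X) (xt \<C> R (Suc n) C X)" for n X
    by (rule xt_homI[where R = R, OF h\<theta> cx(1) cx(3) conn])
  have natural: "xt_co \<C> R (Suc n) C u X' (conn n X c) = conn n X' (xt_co \<C> R n A u X' c)"
    if u: "u \<in> Mor \<C> X X'" and c: "c \<in> carrier (xt \<C> R n A X)" for n X X' u c
  proof -
    obtain \<phi> where \<phi>: "\<phi> \<in> cocycles \<C> (R A) n X" "c = coh_class \<C> (R A) n X \<phi>"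
      using c xt_carrier[where R = R, OF cx(1)] by blast
    have "u \<cdot> \<phi> \<in> cocycles \<C> (R A) n X'"
      using coh_homD(1)[OF coh_hom_post[OF cx(1) u] cx(1) cx(1) \<phi>(1)] .
    moreover have "u \<cdot> (\<phi> \<cdot> \<theta> n) = (u \<cdot> \<phi>) \<cdot> \<theta> n"
      using u cocycles_arr[OF \<phi>(1)] \<theta>a by (simp add: mor_iff cmp_assoc')
    ultimately show ?thesis
      using \<phi> by (simp add: conn xt_co_class[where R = R, OF cx(3) u c\<theta>(1)] xt_co_class[where R = R, OF cx(1) u])
  qed
  have mono: "xt_contra \<C> R 0 B C y X \<in> mon (xt \<C> R 0 C X) (xt \<C> R 0 B X)" for X
  proof -
    interpret h: group_hom "xt \<C> R 0 C X" "xt \<C> R 0 B X" "xt_contra \<C> R 0 B C y X"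
      using Gx hy by (simp add: group_hom_def group_hom_axioms_def)
    have "c = \<one>\<^bsub>xt \<C> R 0 C X\<^esub>"
      if c: "c \<in> carrier (xt \<C> R 0 C X)" "xt_contra \<C> R 0 B C y X c = \<one>\<^bsub>xt \<C> R 0 B X\<^esub>" for c
    proof -
      obtain \<phi> where \<phi>: "\<phi> \<in> cocycles \<C> (R C) 0 X" "c = coh_class \<C> (R C) 0 X \<phi>"
        using c(1) xt_carrier[where R = R, OF cx(3)] by blast
      note \<phi>a = cocycles_arr[OF \<phi>(1)]
      have "\<phi> \<cdot> G 0 \<in> coboundaries \<C> (R B) 0 X"
        using c(2) \<phi> ky[OF \<phi>(1)] coh_class_coboundary_iff[OF cx(2) cG(1)[OF \<phi>(1)]] xt_one[where R = R, OF cx(2)] by simp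
      then have "\<phi> \<cdot> pr2 (T 0) \<in> coboundaries \<C> S 0 X"
        using cob\<beta>[OF cp(1)[OF \<phi>(1)]] Geq[OF \<phi>(1)] by simp
      \<comment> \<open>Degree 0 is special because zero is its only coboundary; \<open>in2\<close>
        then cancels \<open>pr2\<close>.\<close>
      then have z: "\<phi> \<cdot> pr2 (T 0) = zero_mor \<C> (robj S 0) X" by (simp add: coboundaries_0)
      have "\<phi> = \<phi> \<cdot> (pr2 (T 0) \<cdot> in2 (T 0))" using \<phi>a by (simp add: biprod_eqs[OF T] idn_cmp)
      also have "\<dots> = zero_mor \<C> (robj (R C) 0) X"
        using cmp_eq_extend[OF z, of "in2 (T 0)"] \<phi>a Ta by (simp add: zero_cmp)
      finally have "\<phi> \<in> coboundaries \<C> (R C) 0 X" by (simp add: coboundaries_0)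
      then show ?thesis
        using coh_class_coboundary_iff[OF cx(3) \<phi>(1)] \<phi>(2) xt_one[where R = R, OF cx(3)] by simp
    qed
    then have "inj_on (xt_contra \<C> R 0 B C y X) (carrier (xt \<C> R 0 C X))"
      unfolding h.inj_on_one_iff by blast
    then show ?thesis using hy by (simp add: mon_def)
  qed
  \<comment> \<open>Consecutive windows of five terms share the map from the term of
    \<open>C\<close> to the term of \<open>B\<close> in degree \<open>Suc n\<close>, so they cover
    the whole sequence; exactness at its left end is \<open>mono\<close>.\<close>
  have "exact_seq
      ([xt \<C> R (Suc n) B X, xt \<C> R (Suc n) C X, xt \<C> R n A X, xt \<C> R n B X, xt \<C> R n C X],
       [xt_contra \<C> R (Suc n) B C y X, conn n X, xt_contra \<C> R n A B x X, xt_contra \<C> R n B C y X])" for n X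
  proof (intro exact_seq.intros)
    show "group_hom (xt \<C> R n C X) (xt \<C> R n B X) (xt_contra \<C> R n B C y X)"
      using Gx hy by (simp add: group_hom_def group_hom_axioms_def)
    show "kernel (xt \<C> R n B X) (xt \<C> R n A X) (xt_contra \<C> R n A B x X) =
        xt_contra \<C> R n B C y X ` carrier (xt \<C> R n C X)"
      by (rule xt_exactI[where R = R, OF cx(3) cx(2) cx(1) hG hF ky kx exB])
    show "kernel (xt \<C> R n A X) (xt \<C> R (Suc n) C X) (conn n X) =
        xt_contra \<C> R n A B x X ` carrier (xt \<C> R n B X)"
      by (rule xt_exactI[where R = R, OF cx(2) cx(1) cx(3) hF h\<theta> kx conn exA])
    show "kernel (xt \<C> R (Suc n) C X) (xt \<C> R (Suc n) B X) (xt_contra \<C> R (Suc n) B C y X) =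
        conn n X ` carrier (xt \<C> R n A X)"
      by (rule xt_exactI[where R = R, OF cx(1) cx(3) cx(2) h\<theta> hG conn ky exC])
  qed (fact Gx hx hy hc)+
  then show ?thesis using B hc natural mono by blast
qed

end

theorem theorem3p12:
  fixes \<C> :: "('o, 'm, 'e) extri_cat"
    and \<xi> :: "('o, 'm, 'e) tri_class"
    and A B C :: 'o and x y :: 'm and \<delta> :: 'e
    and R :: "'o \<Rightarrow> ('o, 'm) resolution"
  assumes "extriangulated_category \<C>"
    and "WIC \<C>"
    and "proper_class \<C> \<xi>"
    and "enough_xi_projectives \<C> \<xi>"
    and "enough_xi_injectives \<C> \<xi>"
    and "\<xi> A x B y C \<delta>"
    and "\<forall>W \<in> GProj \<C> \<xi>. hom_exact_from \<C> W A x B y C"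
    and "A \<in> Res \<C> \<xi>"
    and "C \<in> Res \<C> \<xi>"
    and "\<forall>M \<in> Res \<C> \<xi>. proper_GProj_resolution \<C> \<xi> M (R M)"
  shows "B \<in> Res \<C> \<xi> \<and>
    (\<exists>conn :: nat \<Rightarrow> 'o \<Rightarrow> 'm set \<Rightarrow> 'm set.
      (\<forall>n X. conn n X \<in> hom (xt \<C> R n A X) (xt \<C> R (Suc n) C X)) \<and>
      (\<forall>n X X'. \<forall>u \<in> Mor \<C> X X'. \<forall>c \<in> carrier (xt \<C> R n A X).
        xt_co \<C> R (Suc n) C u X' (conn n X c) = conn n X' (xt_co \<C> R n A u X' c)) \<and>
      (\<forall>X.
        xt_contra \<C> R 0 B C y X \<in> mon (xt \<C> R 0 C X) (xt \<C> R 0 B X) \<and>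
        (\<forall>n. exact_seq
          ([xt \<C> R (Suc n) B X, xt \<C> R (Suc n) C X, xt \<C> R n A X, xt \<C> R n B X, xt \<C> R n C X],
           [xt_contra \<C> R (Suc n) B C y X, conn n X, xt_contra \<C> R n A B x X, xt_contra \<C> R n B C y X]))))"
proof -
  interpret proper_class \<C> \<xi> by (rule assms(3))
  have "gp_triangle A x B y C \<delta>" using assms(6,7) by (simp add: gp_triangle_def)
  then show ?thesis by (rule xt_long_exact_sequence) (use assms(8-10) in blast)+
qed

end
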